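(* Let $0<s<1$, $1\leq p<\infty$, and let $n\geq 1$ be an integer. If $\Omega\subset\mathbb{R}^n$ is open and $f\in W^{s,p}(\Omega)$ is real-valued, then $$\mathcal{H}^{n-s}(\{f=y\})=0\qquad\text{for (Lebesgue-)a.e. } y\in\mathbb{R},$$ where the level set $\{f=y\}$ is understood in the sense defined in the context.
   Context: $\mathcal{H}^{a}$ is the $a$-dimensional Hausdorff measure. $W^{s,p}(\Omega)$ is the space of $f\in L^p(\Omega)$ such that $\int_\Omega\int_\Omega\frac{|f(y)-f(z)|^p}{|y-z|^{sp+n}}\,dy\,dz<\infty$. For a (locally) integrable function $f:\Omega\to\mathbb{R}$, the level set $\{f=y\}$ is defined as the set of points $x\in\Omega$ such that $$\liminf_{r\downarrow 0}\frac{1}{|B_r(x)|}\int_{B_r(x)}f\;\leq\; y\;\leq\;\limsup_{r\downarrow 0}\frac{1}{|B_r(x)|}\int_{B_r(x)}f ,$$ where $B_r(x)$ is the ball of radius $r$ centered at $x$. *)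

theory Defs
  imports "HOL-Analysis.Analysis"
begin

text \<open>
  The standard normalization is used: a set of diameter \<open>d\<close> contributes
  \<open>\<omega>\<^sub>a (d/2)\<^sup>a\<close>, where \<open>\<omega>\<^sub>a = \<pi>\<^bsup>a/2\<^esup> / \<Gamma>(a/2 + 1)\<close>.  The case \<open>a = 0\<close> is treated separately
  because \<open>0 powr 0 = 0\<close>, whereas a nonempty set has to contribute \<open>1\<close> to the counting measure.
\<close>
definition hausdorff_weight :: "real \<Rightarrow> 'a::metric_space set \<Rightarrow> ennreal" where
  "hausdorff_weight a U =
     (if U = {} then 0
      else if a = 0 then 1
      else ennreal (unit_ball_vol a * (diameter U / 2) powr a))"

text \<open>
  Boundedness is demanded explicitly since \<open>diameter\<close> is unspecified on unbounded sets.
\<close>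
definition hausdorff_premeasure :: "real \<Rightarrow> real \<Rightarrow> 'a::metric_space set \<Rightarrow> ennreal" where
  "hausdorff_premeasure a \<delta> A =
     (INF U \<in> {U :: nat \<Rightarrow> 'a set.
                 A \<subseteq> (\<Union>i. U i) \<and> (\<forall>i. bounded (U i) \<and> diameter (U i) \<le> \<delta>)}.
        (\<Sum>i. hausdorff_weight a (U i)))"

text \<open>
  The premeasure increases as \<open>\<delta>\<close> decreases, so the limit for \<open>\<delta> \<rightarrow> 0\<close> is a supremum.  As usual,
  the resulting outer measure is defined on arbitrary sets.
\<close>
definition hausdorff_measure :: "real \<Rightarrow> 'a::metric_space set \<Rightarrow> ennreal" where
  "hausdorff_measure a A = (SUP \<delta>\<in>{0<..}. hausdorff_premeasure a \<delta> A)"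

text \<open>
  Functions on \<open>\<Omega>\<close> are represented by total functions whose values outside \<open>\<Omega>\<close> are irrelevant;
  they are not identified when equal almost everywhere.
\<close>
definition Lp_on :: "real \<Rightarrow> 'a::euclidean_space set \<Rightarrow> ('a \<Rightarrow> real) set" where
  "Lp_on p \<Omega> =
     {f \<in> borel_measurable (lebesgue_on \<Omega>). integrable (lebesgue_on \<Omega>) (\<lambda>x. \<bar>f x\<bar> powr p)}"

definition fractional_sobolev :: "real \<Rightarrow> real \<Rightarrow> 'a::euclidean_space set \<Rightarrow> ('a \<Rightarrow> real) set" where
  "fractional_sobolev s p \<Omega> =
     {f \<in> Lp_on p \<Omega>.
        (\<integral>\<^sup>+ y. (\<integral>\<^sup>+ z. ennreal (\<bar>f y - f z\<bar> powr p / norm (y - z) powr (s * p + real DIM('a)))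
           \<partial>lebesgue_on \<Omega>) \<partial>lebesgue_on \<Omega>) < \<infinity>}"

definition ball_average :: "('a::euclidean_space \<Rightarrow> real) \<Rightarrow> 'a \<Rightarrow> real \<Rightarrow> real" where
  "ball_average f x r = (LINT z:ball x r|lebesgue. f z) / measure lebesgue (ball x r)"

text \<open>
  Lower and upper limits are taken in the extended reals.  For open \<open>\<Omega>\<close> and \<open>x \<in> \<Omega>\<close> they only
  involve balls contained in \<open>\<Omega>\<close>, and hence only the values of \<open>f\<close> on \<open>\<Omega>\<close>.
\<close>
definition level_set :: "'a::euclidean_space set \<Rightarrow> ('a \<Rightarrow> real) \<Rightarrow> real \<Rightarrow> 'a set" where
  "level_set \<Omega> f y =
     {x \<in> \<Omega>. Liminf (at_right 0) (\<lambda>r. ereal (ball_average f x r)) \<le> ereal y \<and>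
             ereal y \<le> Limsup (at_right 0) (\<lambda>r. ereal (ball_average f x r))}"

end

theory Submission
  imports Defs
begin

text \<open>
  Cover the level set at scale \<open>2\<^sup>-\<^sup>k\<close>.  Let \<open>v\<close> be the average of \<open>f\<close> over the dyadic cube of
  level \<open>k\<close> containing \<open>x\<close>.  The points whose \<open>v\<close> is within \<open>h\<close> of \<open>y\<close> are covered by cubes of
  level \<open>k\<close>; integrated over \<open>y\<close> this costs \<open>2\<^bsup>ks\<^esup> \<integral> 2h\<close>.  For a remaining point with \<open>d = y - v > h\<close>,
  the dyadic averages of the truncation of \<open>f - v\<close> to heights between \<open>d/2\<close> and \<open>d\<close> climb by a
  fixed fraction of \<open>d\<close>, so the oscillations of the truncation over the smaller cubes at \<open>x\<close> add
  up to at least a multiple of \<open>d\<close>.  These oscillations form a fractional cover of the remaining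
  points by dyadic cubes, whose cost is at most \<open>d\<^bsup>-p\<^esup>\<close> times the fractional energy of the
  truncation near the diagonal.  Integrated over \<open>y\<close>, the truncated energies add up to at most
  \<open>h\<^bsup>1-p\<^esup>\<close> times the energy of \<open>f\<close>, because a given height lies between \<open>d/2\<close> and \<open>d\<close> only on a
  bounded logarithmic range of \<open>d\<close>.  With \<open>h\<close> of the order of \<open>\<eta> 2\<^bsup>-ks\<^esup>\<close> plus the mean oscillation of
  \<open>f\<close>, the total is \<open>O(\<eta> + \<eta>\<^bsup>1-p\<^esup> E\<^sub>k)\<close>, where \<open>E\<^sub>k\<close> is the energy of \<open>f\<close> over pairs of points at
  distance \<open>O(2\<^sup>-\<^sup>k)\<close> and tends to \<open>0\<close>.
\<close>

section \<open>Hausdorff content and dyadic cubes\<close>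

text \<open>The estimates control integrals over \<open>y\<close>, not single levels. Measurability
  of the premeasure as a function of \<open>y\<close> is never established; a Borel majorant is
  integrated in its place, and Fatou's lemma makes the lower limit of such majorants vanish for
  almost every \<open>y\<close>. The case \<open>p = 1\<close> shapes the argument:
  \<open>d^(-p)\<close> is then not integrable over \<open>d > h\<close>, and truncation removes
  this logarithmic divergence. The exponents are forced. A cube of level \<open>i\<close> costs
  \<open>2^(i s)\<close> per unit of volume, which fixes the factor \<open>2^(-k s)\<close> in
  \<open>h\<close>; an error budget decaying like \<open>2^(-s j)\<close> over the levels
  \<open>k + j\<close> turns that cost into exactly the weight \<open>|a - b|^(-(s p + n))\<close>
  of the seminorm. Comparing balls with cubes, and truncations of averages with averages of
  truncations, requires the mean oscillation at \<open>x\<close> to tend to \<open>0\<close>. The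
  points where it does not form a set of \<open>(n - s)\<close>-measure zero, by the same covering
  argument and for all \<open>y\<close> at once. Points with \<open>y < v\<close> are handled
  through \<open>-f\<close> and \<open>-y\<close>.\<close>

lemma hausdorff_premeasure_mono:
  "A \<subseteq> B \<Longrightarrow> hausdorff_premeasure a \<delta> A \<le> hausdorff_premeasure a \<delta> B"
  unfolding hausdorff_premeasure_def by (rule INF_superset_mono) auto

lemma hausdorff_premeasure_le:
  assumes "A \<subseteq> (\<Union>i. U i)" "\<And>i. bounded (U i)" "\<And>i. diameter (U i) \<le> \<delta>"
  shows "hausdorff_premeasure a \<delta> A \<le> (\<Sum>i. hausdorff_weight a (U i))"
  unfolding hausdorff_premeasure_def by (rule INF_lower) (use assms in auto)

lemma hausdorff_premeasure_UN:
  fixes A :: "nat \<Rightarrow> 'a::metric_space set"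
  shows "hausdorff_premeasure a \<delta> (\<Union>j. A j) \<le> (\<Sum>j. hausdorff_premeasure a \<delta> (A j))"
proof (cases "(\<Sum>j. hausdorff_premeasure a \<delta> (A j)) = \<infinity>")
  case False
  show ?thesis
  proof (rule ennreal_le_epsilon)
    fix e :: real assume e: "0 < e"
    have fin: "hausdorff_premeasure a \<delta> (A j) \<noteq> \<infinity>" for j
    proof
      assume "hausdorff_premeasure a \<delta> (A j) = \<infinity>"
      moreover have "hausdorff_premeasure a \<delta> (A j) \<le> (\<Sum>j. hausdorff_premeasure a \<delta> (A j))"
        using sum_le_suminf[of "\<lambda>j. hausdorff_premeasure a \<delta> (A j)" "{j}"] by auto
      ultimately show False using False by (simp add: top_unique)
    qed
    have "\<exists>U. A j \<subseteq> (\<Union>i. U i) \<and> (\<forall>i. bounded (U i) \<and> diameter (U i) \<le> \<delta>) \<and>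
        (\<Sum>i. hausdorff_weight a (U i)) < hausdorff_premeasure a \<delta> (A j) + ennreal (e * (1/2)^Suc j)" for j
    proof -
      have "hausdorff_premeasure a \<delta> (A j) < hausdorff_premeasure a \<delta> (A j) + ennreal (e * (1/2)^Suc j)"
        using fin[of j] e by (simp add: ennreal_less_zero_iff less_top)
      then show ?thesis
        by (subst (asm) (1) hausdorff_premeasure_def) (auto simp: INF_less_iff)
    qed
    then obtain U where U: "\<And>j. A j \<subseteq> (\<Union>i. U j i)"
      "\<And>j i. bounded (U j i) \<and> diameter (U j i) \<le> \<delta>"
      "\<And>j. (\<Sum>i. hausdorff_weight a (U j i)) < hausdorff_premeasure a \<delta> (A j) + ennreal (e * (1/2)^Suc j)"
      by metis
    have "hausdorff_premeasure a \<delta> (\<Union>j. A j)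
        \<le> (\<Sum>m. hausdorff_weight a (U (fst (prod_decode m)) (snd (prod_decode m))))"
    proof (rule hausdorff_premeasure_le)
      show "(\<Union>j. A j) \<subseteq> (\<Union>m. U (fst (prod_decode m)) (snd (prod_decode m)))"
      proof
        fix x assume "x \<in> (\<Union>j. A j)"
        then obtain j i where "x \<in> U j i" using U(1) by blast
        then show "x \<in> (\<Union>m. U (fst (prod_decode m)) (snd (prod_decode m)))"
          by (intro UN_I[of "prod_encode (j, i)"]) auto
      qed
    qed (use U(2) in simp_all)
    also have "\<dots> = (\<Sum>m. (\<lambda>(j, i). hausdorff_weight a (U j i)) (prod_decode m))"
      by (simp add: case_prod_beta)
    also have "\<dots> = (\<Sum>j. \<Sum>i. hausdorff_weight a (U j i))"
      by (rule suminf_ennreal_2dimen) auto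
    also have "\<dots> \<le> (\<Sum>j. hausdorff_premeasure a \<delta> (A j) + ennreal (e * (1/2)^Suc j))"
      by (intro suminf_le less_imp_le U(3)) auto
    also have "\<dots> = (\<Sum>j. hausdorff_premeasure a \<delta> (A j)) + (\<Sum>j. ennreal (e * (1/2)^Suc j))"
      by (rule suminf_add[symmetric]) auto
    also have "(\<Sum>j. ennreal (e * (1/2)^Suc j)) = ennreal e"
    proof -
      have "(\<lambda>j. e * (1/2)^Suc j) sums (e * 1)"
        by (intro sums_mult power_half_series)
      then show ?thesis using e by (intro suminf_ennreal_eq) auto
    qed
    finally show "hausdorff_premeasure a \<delta> (\<Union>j. A j)
      \<le> (\<Sum>j. hausdorff_premeasure a \<delta> (A j)) + ennreal e" .
  qed
qed simp

lemma hausdorff_premeasure_Un: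
  "hausdorff_premeasure a \<delta> (A \<union> B) \<le> hausdorff_premeasure a \<delta> A + hausdorff_premeasure a \<delta> B"
  if "0 \<le> \<delta>"
proof -
  have e: "hausdorff_premeasure a \<delta> {} = 0"
    using hausdorff_premeasure_le[of "{}" "\<lambda>_::nat. {}" \<delta> a] that by (simp add: hausdorff_weight_def)
  have "hausdorff_premeasure a \<delta> (A \<union> B) \<le> (\<Sum>j. hausdorff_premeasure a \<delta> (binaryset A B j))"
    using hausdorff_premeasure_UN[of a \<delta> "binaryset A B"] by (simp add: UN_binaryset_eq)
  also have "\<dots> = hausdorff_premeasure a \<delta> A + hausdorff_premeasure a \<delta> B"
    by (rule suminf_binaryset_eq) (rule e)
  finally show ?thesis .
qed

lemma hausdorff_measure_eq_0_iff:
  "hausdorff_measure a A = 0 \<longleftrightarrow> (\<forall>\<delta>>0. hausdorff_premeasure a \<delta> A = 0)"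
  unfolding hausdorff_measure_def bot_ennreal[symmetric] SUP_bot_conv by auto

lemma hausdorff_measure_UN_eq_0:
  fixes A :: "nat \<Rightarrow> 'a::metric_space set"
  assumes "\<And>j. hausdorff_measure a (A j) = 0"
  shows "hausdorff_measure a (\<Union>j. A j) = 0"
  unfolding hausdorff_measure_eq_0_iff
proof (intro allI impI)
  fix \<delta> :: real assume "\<delta> > 0"
  then have "(\<Sum>j. hausdorff_premeasure a \<delta> (A j)) = 0"
    using assms by (simp add: hausdorff_measure_eq_0_iff)
  with hausdorff_premeasure_UN[of a \<delta> A] show "hausdorff_premeasure a \<delta> (\<Union>j. A j) = 0"
    by simp
qed

lemma hausdorff_measure_null_mono:
  "hausdorff_measure a B = 0 \<Longrightarrow> A \<subseteq> B \<Longrightarrow> hausdorff_measure a A = 0"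
  unfolding hausdorff_measure_eq_0_iff using hausdorff_premeasure_mono[of A B a] by (metis le_zero_eq)

section \<open>Dyadic cubes and sets that are unions of them\<close>

text \<open>Half-open cubes of side \<open>2^(-i)\<close>, named by any of their points. Equality of
  integer parts is an equivalence relation, so the cubes of one level partition the space without
  boundary cases, point and cube can be exchanged under Fubini, and the relation between
  \<open>x\<close> and \<open>z\<close> is jointly measurable.\<close>

definition dcube :: "nat \<Rightarrow> 'a::euclidean_space \<Rightarrow> 'a set" where
  "dcube i x = {z. \<forall>b\<in>Basis. \<lfloor>2^i * (z \<bullet> b)\<rfloor> = \<lfloor>2^i * (x \<bullet> b)\<rfloor>}"

lemma dcube_self [simp]: "x \<in> dcube i x"
  by (simp add: dcube_def)

lemma dcube_sym: "z \<in> dcube i x \<longleftrightarrow> x \<in> dcube i z"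
  by (auto simp: dcube_def)

lemma dcube_eq: "z \<in> dcube i x \<Longrightarrow> dcube i z = dcube i x"
  by (auto simp: dcube_def)

lemma dcube_Suc: "dcube (Suc i) x \<subseteq> dcube i x"
proof
  fix z assume z: "z \<in> dcube (Suc i) x"
  have *: "\<lfloor>2 * t\<rfloor> div 2 = \<lfloor>t\<rfloor>" for t :: real
    using floor_divide_real_eq_div[of 2 "2*t"] by simp
  show "z \<in> dcube i x"
    unfolding dcube_def mem_Collect_eq
  proof
    fix b :: 'a assume "b \<in> Basis"
    then have "\<lfloor>2 * (2^i * (z \<bullet> b))\<rfloor> = \<lfloor>2 * (2^i * (x \<bullet> b))\<rfloor>"
      using z by (simp add: dcube_def mult.assoc)
    then show "\<lfloor>2^i * (z \<bullet> b)\<rfloor> = \<lfloor>2^i * (x \<bullet> b)\<rfloor>"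
      by (metis *)
  qed
qed

lemma dcube_antimono: "i \<le> j \<Longrightarrow> dcube j x \<subseteq> dcube i x"
  using lift_Suc_antimono_le[of "\<lambda>i. dcube i x" i j] dcube_Suc by blast

lemma dcube_inner_diff:
  assumes "z \<in> dcube i x" "b \<in> Basis" shows "\<bar>z \<bullet> b - x \<bullet> b\<bar> < (1/2)^i"
proof -
  have "\<lfloor>2^i * (z \<bullet> b)\<rfloor> = \<lfloor>2^i * (x \<bullet> b)\<rfloor>" using assms by (simp add: dcube_def)
  then have "\<bar>2^i * (z \<bullet> b) - 2^i * (x \<bullet> b)\<bar> < 1" by linarith
  then have "2^i * \<bar>z \<bullet> b - x \<bullet> b\<bar> < 1"
    by (simp add: abs_mult right_diff_distrib[symmetric])
  then show ?thesis by (simp add: field_simps power_one_over)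
qed

lemma dcube_dist:
  fixes x :: "'a::euclidean_space"
  assumes "z \<in> dcube i x" shows "dist z x \<le> real DIM('a) * (1/2)^i"
proof -
  have "norm (z - x) \<le> (\<Sum>b\<in>Basis. \<bar>(z - x) \<bullet> b\<bar>)" by (rule norm_le_l1)
  also have "\<dots> \<le> (\<Sum>b\<in>(Basis::'a set). (1/2)^i)"
    using dcube_inner_diff[OF assms] by (intro sum_mono) (auto simp: inner_diff_left intro: less_imp_le)
  finally show ?thesis by (simp add: dist_norm)
qed

lemma bounded_dcube: "bounded (dcube i x)"
  unfolding bounded_def by (metis dcube_dist dist_commute)

lemma diameter_dcube: "diameter (dcube i (x::'a::euclidean_space)) \<le> real DIM('a) * (1/2)^i"
proof (rule diameter_le)
  show "norm (y - z) \<le> real DIM('a) * (1/2)^i" if "y \<in> dcube i x" "z \<in> dcube i x" for y z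
    using dcube_dist[of y i z] dcube_eq[OF that(2)] that(1) by (simp add: dist_norm)
qed simp

lemma dcube_in_borel [measurable]: "dcube i x \<in> sets borel"
  unfolding dcube_def by measurable

lemma dcube_pred_measurable [measurable (raw)]:
  fixes f g :: "'b \<Rightarrow> 'a::euclidean_space"
  assumes [measurable]: "f \<in> borel_measurable M" "g \<in> borel_measurable M"
  shows "Measurable.pred M (\<lambda>x. g x \<in> dcube i (f x))"
  unfolding dcube_def mem_Collect_eq by measurable

text \<open>The half-open cube lies between the open and the closed box with corners
  \<open>l\<close> and \<open>u\<close>. Both have the same volume, so the faces never have to be
  examined.\<close>

lemma emeasure_dcube:
  "emeasure lborel (dcube i (x::'a::euclidean_space)) = ennreal (2 powr (- (real i * real DIM('a))))"
proof -
  define l where "l = (\<Sum>b\<in>Basis. (of_int \<lfloor>2^i * (x \<bullet> b)\<rfloor> / 2^i) *\<^sub>R b)"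
  define u where "u = (\<Sum>b\<in>Basis. ((of_int \<lfloor>2^i * (x \<bullet> b)\<rfloor> + 1) / 2^i) *\<^sub>R b)"
  have lb: "l \<bullet> b = of_int \<lfloor>2^i * (x \<bullet> b)\<rfloor> / 2^i" "u \<bullet> b = (of_int \<lfloor>2^i * (x \<bullet> b)\<rfloor> + 1) / 2^i"
    if "b \<in> Basis" for b
    using that by (simp_all add: l_def u_def inner_sum_left inner_Basis if_distrib cong: if_cong)
  have prod: "(\<Prod>b\<in>Basis. (u - l) \<bullet> b) = 2 powr (- (real i * real DIM('a)))"
  proof -
    have "(\<Prod>b\<in>Basis. (u - l) \<bullet> b) = (\<Prod>b\<in>(Basis::'a set). 2 powr (- real i))"
      by (intro prod.cong) (auto simp: inner_diff_left lb powr_minus powr_realpow field_simps)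
    also have "\<dots> = 2 powr (- (real i * real DIM('a)))"
      by (simp add: powr_powr flip: powr_realpow)
    finally show ?thesis .
  qed
  have 1: "box l u \<subseteq> dcube i x"
    by (auto simp: dcube_def mem_box lb floor_eq_iff field_simps) (auto simp: less_imp_le)
  have 2: "dcube i x \<subseteq> cbox l u"
  proof
    fix z assume "z \<in> dcube i x"
    then have *: "\<lfloor>2^i * (z \<bullet> b)\<rfloor> = \<lfloor>2^i * (x \<bullet> b)\<rfloor>" if "b \<in> Basis" for b
      using that by (auto simp: dcube_def)
    show "z \<in> cbox l u"
      unfolding mem_box
    proof (intro ballI)
      fix b :: 'a assume b: "b \<in> Basis"
      have "of_int \<lfloor>2^i * (x \<bullet> b)\<rfloor> \<le> 2^i * (z \<bullet> b)" "2^i * (z \<bullet> b) \<le> of_int \<lfloor>2^i * (x \<bullet> b)\<rfloor> + 1"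
        using *[OF b] by linarith+
      then show "l \<bullet> b \<le> z \<bullet> b \<and> z \<bullet> b \<le> u \<bullet> b"
        by (simp add: lb[OF b] field_simps)
    qed
  qed
  have le: "l \<bullet> b \<le> u \<bullet> b" if "b \<in> Basis" for b using that by (simp add: lb field_simps)
  show ?thesis
  proof (rule antisym)
    show "emeasure lborel (dcube i x) \<le> ennreal (2 powr (- (real i * real DIM('a))))"
      using emeasure_mono[OF 2, of lborel] le by (simp add: emeasure_lborel_cbox_eq prod)
    show "ennreal (2 powr (- (real i * real DIM('a)))) \<le> emeasure lborel (dcube i x)"
      using emeasure_mono[OF 1, of lborel] le by (simp add: emeasure_lborel_box_eq prod)
  qed
qed

lemma measure_dcube:
  "measure lborel (dcube i (x::'a::euclidean_space)) = 2 powr (- (real i * real DIM('a)))"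
  by (simp add: measure_def emeasure_dcube)

lemma countable_dcubes: "countable (range (dcube i :: 'a::euclidean_space \<Rightarrow> 'a set))"
proof -
  have "range (dcube i :: 'a \<Rightarrow> 'a set) \<subseteq>
      (\<lambda>h. {z. \<forall>b\<in>Basis. \<lfloor>2^i * (z \<bullet> b)\<rfloor> = h b}) ` (PiE Basis (\<lambda>_. UNIV :: int set))"
  proof
    fix Q :: "'a set" assume "Q \<in> range (dcube i)"
    then obtain x where "Q = dcube i x" by auto
    then have "Q = {z. \<forall>b\<in>Basis. \<lfloor>2^i * (z \<bullet> b)\<rfloor> = restrict (\<lambda>b. \<lfloor>2^i * (x \<bullet> b)\<rfloor>) Basis b}"
      by (auto simp: dcube_def)
    then show "Q \<in> (\<lambda>h. {z. \<forall>b\<in>Basis. \<lfloor>2^i * (z \<bullet> b)\<rfloor> = h b}) ` (PiE Basis (\<lambda>_. UNIV :: int set))"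
      by (intro image_eqI[where x = "restrict (\<lambda>b. \<lfloor>2^i * (x \<bullet> b)\<rfloor>) Basis"]) (simp_all add: restrict_PiE)
  qed
  moreover have "countable (PiE (Basis::'a set) (\<lambda>_. UNIV :: int set))"
    by (intro countable_PiE) auto
  ultimately show ?thesis by (blast intro: countable_subset[OF _ countable_image])
qed

text \<open>Such an \<open>X\<close> is a union of cubes of level \<open>i\<close>, whose number is
  the volume times \<open>2^(i n)\<close>. The cost of covering it can thus be read off from its
  Lebesgue measure, which is how integrals enter bounds for
  \<open>hausdorff_premeasure\<close>.\<close>

definition saturated :: "nat \<Rightarrow> 'a::euclidean_space set \<Rightarrow> bool" where
  "saturated i X \<longleftrightarrow> (\<forall>x\<in>X. dcube i x \<subseteq> X)"

lemma saturated_antimono: "saturated i X \<Longrightarrow> i \<le> j \<Longrightarrow> saturated j X"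
  unfolding saturated_def using dcube_antimono by blast

lemma saturated_dcube: "saturated i (dcube i x)"
  unfolding saturated_def using dcube_eq by blast

text \<open>The constant comes from covering by cubes of level \<open>i\<close>, whose diameter is at most \<open>n 2\<^sup>-\<^sup>i\<close>.\<close>

definition cover_const :: "real \<Rightarrow> real \<Rightarrow> real" where
  "cover_const n a = unit_ball_vol a * (n / 2) powr a"

lemma cover_const_nonneg: "0 \<le> a \<Longrightarrow> 0 \<le> cover_const n a"
  by (simp add: cover_const_def)

text \<open>Each cube of level \<open>i\<close> has volume \<open>2^(-i n)\<close> and costs at most
  a constant times \<open>2^(-i a)\<close>, hence \<open>2^(i (n - a))\<close> per unit of volume.
  With \<open>a = n - s\<close> this is the factor \<open>2^(i s)\<close> that recurs below.\<close>

lemma hausdorff_premeasure_saturated: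
  fixes W :: "'a::euclidean_space set"
  assumes W: "saturated i W" and a: "0 < a" and \<delta>: "real DIM('a) * (1/2)^i \<le> \<delta>"
  shows "hausdorff_premeasure a \<delta> W \<le>
    ennreal (cover_const DIM('a) a * 2 powr (real i * (real DIM('a) - a))) * emeasure lborel W"
proof -
  define \<W> where "\<W> = dcube i ` W"
  have cW: "countable \<W>" unfolding \<W>_def
    by (rule countable_subset[OF _ countable_dcubes[of i]]) auto
  \<comment> \<open>Indices that number no cube get the empty set, which costs nothing: on a finite
    family \<open>from_nat_into\<close> repeats a member there, which would destroy
    disjointness.\<close>
  define U where "U = (\<lambda>j. if j \<in> to_nat_on \<W> ` \<W> then from_nat_into \<W> j else {})"
  have U: "U j = {} \<or> U j \<in> \<W>" for j
    using cW by (auto simp: U_def)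
  have UW: "(\<Union>j. U j) = W"
  proof
    show "(\<Union>j. U j) \<subseteq> W" using U W unfolding \<W>_def saturated_def by fastforce
    show "W \<subseteq> (\<Union>j. U j)"
    proof
      fix x assume "x \<in> W"
      then have "dcube i x \<in> \<W>" by (simp add: \<W>_def)
      then have "U (to_nat_on \<W> (dcube i x)) = dcube i x" using cW by (simp add: U_def)
      then show "x \<in> (\<Union>j. U j)" using dcube_self by blast
    qed
  qed
  have disj: "disjoint_family U"
    unfolding disjoint_family_on_def
  proof (intro ballI impI)
    fix j l :: nat assume jl: "j \<noteq> l"
    show "U j \<inter> U l = {}"
    proof (rule ccontr)
      assume ne: "U j \<inter> U l \<noteq> {}"
      then obtain z where z: "z \<in> U j" "z \<in> U l" by auto
      have "U m = dcube i z" if "z \<in> U m" for m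
        using U[of m] that dcube_eq unfolding \<W>_def by blast
      with z have "U j = dcube i z" "U l = dcube i z"
        by blast+
      moreover obtain Q Q' where "Q \<in> \<W>" "j = to_nat_on \<W> Q" "Q' \<in> \<W>" "l = to_nat_on \<W> Q'"
        using z by (auto simp: U_def split: if_splits)
      ultimately show False using cW jl by (auto simp: U_def)
    qed
  qed
  have Ub: "U j \<in> sets lborel" for j
    using U[of j] by (auto simp: \<W>_def)
  have w: "hausdorff_weight a (U j) \<le>
      ennreal (cover_const DIM('a) a * 2 powr (real i * (real DIM('a) - a))) * emeasure lborel (U j)" for j
  proof (cases "U j = {}")
    case False
    then obtain x where x: "U j = dcube i x" using U[of j] by (auto simp: \<W>_def)
    have "0 \<le> diameter (dcube i x)" by (rule diameter_ge_0[OF bounded_dcube])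
    then have "(diameter (dcube i x) / 2) powr a \<le> (real DIM('a) / 2 * 2 powr (- real i)) powr a"
      using diameter_dcube[of i x] a
      by (intro powr_mono2) (auto simp: powr_minus powr_realpow power_one_over field_simps)
    also have "\<dots> = (real DIM('a) / 2) powr a * 2 powr (- real i * a)"
      by (subst powr_mult) (auto simp: powr_powr)
    finally have "hausdorff_weight a (U j) \<le> ennreal (unit_ball_vol a * ((real DIM('a) / 2) powr a * 2 powr (- real i * a)))"
      using a False unfolding hausdorff_weight_def x by (auto intro!: ennreal_leI mult_left_mono)
    also have "\<dots> = ennreal (cover_const DIM('a) a * 2 powr (real i * (real DIM('a) - a))) * emeasure lborel (U j)"
      unfolding x emeasure_dcube
      by (subst ennreal_mult''[symmetric])
         (auto simp: cover_const_def powr_add[symmetric] mult.assoc algebra_simps)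
    finally show ?thesis .
  qed (simp add: hausdorff_weight_def)
  have "hausdorff_premeasure a \<delta> W \<le> (\<Sum>j. hausdorff_weight a (U j))"
  proof (rule hausdorff_premeasure_le)
    have "0 \<le> \<delta>" using \<delta> by (smt (verit) of_nat_0_le_iff zero_le_mult_iff zero_le_power divide_nonneg_nonneg)
    fix j show "bounded (U j)" using U[of j] by (auto simp: \<W>_def bounded_dcube)
    show "diameter (U j) \<le> \<delta>" using U[of j] \<delta> \<open>0 \<le> \<delta>\<close>
      by (auto simp: \<W>_def intro: order_trans[OF diameter_dcube])
  qed (simp add: UW)
  also have "\<dots> \<le> (\<Sum>j. ennreal (cover_const DIM('a) a * 2 powr (real i * (real DIM('a) - a))) * emeasure lborel (U j))"
    by (intro suminf_le w) auto
  also have "\<dots> = ennreal (cover_const DIM('a) a * 2 powr (real i * (real DIM('a) - a))) * emeasure lborel W"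
    using suminf_emeasure[of U lborel] Ub disj by (simp add: UW image_subset_iff)
  finally show ?thesis .
qed

section \<open>Fractional covers\<close>

text \<open>The thresholds at which a cube with weight \<open>c\<close> and earlier partial sum
  \<open>u\<close> is picked lie in an interval of length \<open>c\<close>. If \<open>u\<close> is
  infinite there are none.\<close>

lemma threshold_measure_le:
  fixes u c :: ennreal
  shows "(\<integral>\<^sup>+t. indicator {0<..<1} t * indicator {t. u < ennreal t \<and> ennreal t \<le> u + c} t \<partial>lborel) \<le> c"
proof (cases "u = \<infinity> \<or> c = \<infinity>")
  case True
  then show ?thesis by (auto simp: top_unique)
next
  case False
  then obtain u' c' where uc: "u = ennreal u'" "0 \<le> u'" "c = ennreal c'" "0 \<le> c'"
    by (metis ennreal_cases infinity_ennreal_def)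
  have "(\<integral>\<^sup>+t. indicator {0<..<1} t * indicator {t. u < ennreal t \<and> ennreal t \<le> u + c} t \<partial>lborel)
      \<le> (\<integral>\<^sup>+t. indicator {u'..u' + c'} t \<partial>lborel)"
    by (intro nn_integral_mono)
       (auto simp: uc indicator_def ennreal_less_iff simp flip: ennreal_plus)
  also have "\<dots> = c" by (simp add: uc)
  finally show ?thesis .
qed

text \<open>
  A fractional cover by dyadic cubes can be rounded to a cover: for a threshold \<open>t\<close> pick the
  cubes at which the partial sum crosses \<open>t\<close>.  Averaged over \<open>t \<in> (0,1)\<close>, a cube is picked with
  probability at most its weight.
\<close>

lemma hausdorff_premeasure_fractional_cover:
  fixes c :: "nat \<Rightarrow> 'a::euclidean_space \<Rightarrow> ennreal"
  assumes X: "saturated k X" and [measurable]: "X \<in> sets borel"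
    and a: "0 < a" and \<delta>: "real DIM('a) * (1/2)^k \<le> \<delta>"
    and [measurable]: "\<And>j. c j \<in> borel_measurable borel"
    and const: "\<And>j x z. z \<in> dcube (k + j) x \<Longrightarrow> c j z = c j x"
    and E: "E \<subseteq> X" "\<And>x. x \<in> E \<Longrightarrow> 1 \<le> (\<Sum>j. c j x)"
  shows "hausdorff_premeasure a \<delta> E \<le>
    (\<Sum>j. ennreal (cover_const DIM('a) a * 2 powr (real (k + j) * (real DIM('a) - a))) * (\<integral>\<^sup>+x\<in>X. c j x \<partial>lborel))"
proof -
  define K where "K j = ennreal (cover_const DIM('a) a * 2 powr (real (k + j) * (real DIM('a) - a)))" for j
  define S where "S j x = (\<Sum>l<j. c l x)" for j x
  \<comment> \<open>The points whose partial sums pass \<open>t\<close> with the term of index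
    \<open>j\<close>; the strict and the weak inequality match the least \<open>m\<close> with
    \<open>ennreal t \<le> S m x\<close>, where \<open>m = Suc j\<close>.\<close>
  define W where "W j t = {x\<in>X. S j x < ennreal t \<and> ennreal t \<le> S j x + c j x}" for j and t :: real
  have Sm [measurable]: "S j \<in> borel_measurable borel" for j unfolding S_def by measurable
  have Wm [measurable]: "W j t \<in> sets borel" for j t unfolding W_def by measurable
  have main: "hausdorff_premeasure a \<delta> E \<le> (\<Sum>j. K j * emeasure lborel (W j t))" if t: "0 < t" "t < 1" for t
  proof -
    have "E \<subseteq> (\<Union>j. W j t)"
    proof
      fix x assume x: "x \<in> E"
      have "ennreal t < 1" using t by (simp add: ennreal_less_one_iff)
      also have "1 \<le> (SUP n. \<Sum>l<n. c l x)" using E(2)[OF x] by (simp add: suminf_eq_SUP)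
      finally obtain n where n: "ennreal t < S n x" by (auto simp: less_SUP_iff S_def)
      define m where "m = (LEAST n. ennreal t \<le> S n x)"
      have m: "ennreal t \<le> S m x" unfolding m_def by (rule LeastI[of _ n]) (use n in auto)
      have "m \<noteq> 0"
      proof
        assume "m = 0"
        with m t show False by (simp add: S_def ennreal_eq_0_iff)
      qed
      then obtain l where l: "m = Suc l" by (cases m) auto
      have "\<not> ennreal t \<le> S l x" using not_less_Least[of l "\<lambda>n. ennreal t \<le> S n x"] l m_def by auto
      with m l x E(1) have "x \<in> W l t" by (auto simp: W_def S_def)
      then show "x \<in> (\<Union>j. W j t)" by blast
    qed
    then have "hausdorff_premeasure a \<delta> E \<le> (\<Sum>j. hausdorff_premeasure a \<delta> (W j t))"
      using hausdorff_premeasure_mono hausdorff_premeasure_UN order_trans by blast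
    also have "\<dots> \<le> (\<Sum>j. K j * emeasure lborel (W j t))"
    proof (intro suminf_le)
      fix j
      \<comment> \<open>Terms of lower index are constant on larger cubes, so everything that
        decides membership in \<open>W j t\<close> is constant on cubes of level
        \<open>k + j\<close>.\<close>
      have sc: "S j z = S j x" "c j z = c j x" if "z \<in> dcube (k + j) x" for x z
      proof -
        show "S j z = S j x" unfolding S_def
        proof (rule sum.cong)
          fix l assume "l \<in> {..<j}"
          then have "z \<in> dcube (k + l) x" using that dcube_antimono[of "k + l" "k + j" x] by auto
          then show "c l z = c l x" by (rule const)
        qed simp
        show "c j z = c j x" using that const by auto
      qed
      have "saturated (k + j) (W j t)"
        unfolding saturated_def
      proof (intro ballI subsetI)
        fix x z assume xz: "x \<in> W j t" "z \<in> dcube (k + j) x"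
        then have "z \<in> X" using saturated_antimono[OF X, of "k + j"] by (auto simp: saturated_def W_def)
        with xz sc[OF xz(2)] show "z \<in> W j t" by (simp add: W_def)
      qed
      then show "hausdorff_premeasure a \<delta> (W j t) \<le> K j * emeasure lborel (W j t)"
        unfolding K_def
      proof (rule hausdorff_premeasure_saturated[OF _ a])
        have "(1/2::real)^(k + j) \<le> (1/2)^k" by (intro power_decreasing) auto
        then show "real DIM('a) * (1/2)^(k + j) \<le> \<delta>"
          using \<delta> by (smt (verit) mult_left_mono of_nat_0_le_iff)
      qed
    qed auto
    finally show ?thesis .
  qed
  \<comment> \<open>The left side does not depend on \<open>t\<close>, so it equals its own average
    over \<open>(0,1)\<close>. On the right, swapping the integrals leaves for each \<open>x\<close>
    the length of an interval of thresholds.\<close>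
  have "hausdorff_premeasure a \<delta> E = (\<integral>\<^sup>+t. hausdorff_premeasure a \<delta> E * indicator {0<..<1::real} t \<partial>lborel)"
    by (simp add: nn_integral_cmult)
  also have "\<dots> \<le> (\<integral>\<^sup>+t. (\<Sum>j. K j * (\<integral>\<^sup>+x. indicator {0<..<1} t * indicator (W j t) x \<partial>lborel)) \<partial>lborel)"
  proof (intro nn_integral_mono)
    fix t :: real
    show "hausdorff_premeasure a \<delta> E * indicator {0<..<1} t
      \<le> (\<Sum>j. K j * (\<integral>\<^sup>+x. indicator {0<..<1} t * indicator (W j t) x \<partial>lborel))"
      using main[of t] by (cases "t \<in> {0<..<1}") simp_all
  qed
  also have "\<dots> = (\<Sum>j. K j * (\<integral>\<^sup>+t. (\<integral>\<^sup>+x. indicator {0<..<1} t * indicator (W j t) x \<partial>lborel) \<partial>lborel))"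
    unfolding W_def by (simp add: nn_integral_suminf nn_integral_cmult)
  also have "\<dots> \<le> (\<Sum>j. K j * (\<integral>\<^sup>+x\<in>X. c j x \<partial>lborel))"
  proof (intro suminf_le mult_left_mono)
    fix j
    have "(\<integral>\<^sup>+t. (\<integral>\<^sup>+x. indicator {0<..<1} t * indicator (W j t) x \<partial>lborel) \<partial>lborel)
       = (\<integral>\<^sup>+x. (\<integral>\<^sup>+t. indicator {0<..<1::real} t * indicator (W j t) x \<partial>lborel) \<partial>lborel)"
      unfolding W_def by (rule lborel_pair.Fubini') measurable
    also have "\<dots> \<le> (\<integral>\<^sup>+x\<in>X. c j x \<partial>lborel)"
    proof (rule nn_integral_mono)
      fix x
      show "(\<integral>\<^sup>+t. indicator {0<..<1::real} t * indicator (W j t) x \<partial>lborel) \<le> c j x * indicator X x"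
        using threshold_measure_le[of "S j x" "c j x"]
        by (cases "x \<in> X") (auto simp: W_def indicator_def)
    qed
    finally show "(\<integral>\<^sup>+t. (\<integral>\<^sup>+x. indicator {0<..<1} t * indicator (W j t) x \<partial>lborel) \<partial>lborel)
       \<le> (\<integral>\<^sup>+x\<in>X. c j x \<partial>lborel)" .
  qed auto
  finally show ?thesis by (simp add: K_def)
qed

section \<open>From fractional covers to fractional energies\<close>

text \<open>Averaging over cubes preserves the integral over a union of cubes: by Fubini and the
  symmetry of \<open>z \<in> dcube i x\<close>, each point \<open>a\<close> is counted on a set of
  measure \<open>2^(-i n)\<close>, which the prefactor cancels.\<close>

lemma nn_integral_dcube_average:
  fixes \<phi> :: "'a::euclidean_space \<Rightarrow> ennreal"
  assumes X: "saturated i X" and [measurable]: "X \<in> sets borel" "\<phi> \<in> borel_measurable borel"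
  shows "(\<integral>\<^sup>+x\<in>X. ennreal (2 powr (real i * real DIM('a))) * (\<integral>\<^sup>+a\<in>dcube i x. \<phi> a \<partial>lborel) \<partial>lborel)
    = (\<integral>\<^sup>+x\<in>X. \<phi> x \<partial>lborel)"
proof -
  have XX: "x \<in> X \<longleftrightarrow> a \<in> X" if "a \<in> dcube i x" for x a
    using X that dcube_sym[of a i x] unfolding saturated_def by blast
  have "(\<integral>\<^sup>+x\<in>X. ennreal (2 powr (real i * real DIM('a))) * (\<integral>\<^sup>+a\<in>dcube i x. \<phi> a \<partial>lborel) \<partial>lborel)
     = (\<integral>\<^sup>+x. (\<integral>\<^sup>+a. ennreal (2 powr (real i * real DIM('a))) * \<phi> a * indicator (dcube i x) a * indicator X x \<partial>lborel) \<partial>lborel)"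
  proof (intro nn_integral_cong)
    fix x :: 'a
    show "ennreal (2 powr (real i * real DIM('a))) * (\<integral>\<^sup>+a\<in>dcube i x. \<phi> a \<partial>lborel) * indicator X x
      = (\<integral>\<^sup>+a. ennreal (2 powr (real i * real DIM('a))) * \<phi> a * indicator (dcube i x) a * indicator X x \<partial>lborel)"
      by (cases "x \<in> X") (simp_all add: nn_integral_cmult mult.assoc)
  qed
  also have "\<dots> = (\<integral>\<^sup>+a. (\<integral>\<^sup>+x. ennreal (2 powr (real i * real DIM('a))) * \<phi> a * indicator (dcube i x) a * indicator X x \<partial>lborel) \<partial>lborel)"
    by (rule lborel_pair.Fubini') measurable
  also have "\<dots> = (\<integral>\<^sup>+a. (\<integral>\<^sup>+x. (ennreal (2 powr (real i * real DIM('a))) * \<phi> a * indicator X a) * indicator (dcube i a) x \<partial>lborel) \<partial>lborel)"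
  proof (intro nn_integral_cong)
    fix a x :: 'a
    have "indicator (dcube i x) a = (indicator (dcube i a) x :: ennreal)"
      using dcube_sym[of a i x] by (simp add: indicator_def)
    moreover have "x \<in> dcube i a \<Longrightarrow> indicator X x = (indicator X a :: ennreal)"
      using XX[of x a] by (simp add: indicator_def)
    ultimately show "ennreal (2 powr (real i * real DIM('a))) * \<phi> a * indicator (dcube i x) a * indicator X x
      = (ennreal (2 powr (real i * real DIM('a))) * \<phi> a * indicator X a) * indicator (dcube i a) x"
      by (cases "x \<in> dcube i a") simp_all
  qed
  also have "\<dots> = (\<integral>\<^sup>+a. \<phi> a * indicator X a \<partial>lborel)"
  proof (intro nn_integral_cong)
    fix a :: 'a
    have "ennreal (2 powr (real i * real DIM('a))) * ennreal (2 powr (- (real i * real DIM('a)))) = 1"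
      by (subst ennreal_mult''[symmetric]) (auto simp: powr_add[symmetric])
    then have "(ennreal (2 powr (real i * real DIM('a))) * \<phi> a * indicator X a) * ennreal (2 powr (- (real i * real DIM('a))))
      = \<phi> a * indicator X a"
      by (metis (no_types, opaque_lifting) mult.assoc mult.commute mult.left_neutral)
    then show "(\<integral>\<^sup>+x. (ennreal (2 powr (real i * real DIM('a))) * \<phi> a * indicator X a) * indicator (dcube i a) x \<partial>lborel)
      = \<phi> a * indicator X a"
      by (subst nn_integral_cmult) (auto simp: emeasure_dcube)
  qed
  finally show ?thesis .
qed

text \<open>The active scales are those with \<open>2^(k + j) < \<rho> / r\<close>. A geometric sum
  is comparable with its largest term, here at most a power of \<open>\<rho> / r\<close>. In this
  way a sum over dyadic scales becomes the singular kernel \<open>r powr (- q)\<close>.\<close>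

lemma scale_sum_le:
  fixes r \<rho> q :: real
  assumes "0 < r" "0 < \<rho>" "0 < q"
  shows "(\<Sum>j. ennreal (2 powr (real (k + j) * q)) * indicator {..<\<rho> * (1/2)^(k + j)} r)
    \<le> ennreal (\<rho> powr q / (1 - 2 powr (- q)) / r powr q) * indicator {..<\<rho> * (1/2)^k} r"
proof -
  define c where "c = 1 - 2 powr (- q)"
  have c: "0 < c" "c < 1" using assms powr_less_mono[of "-q" 0 2] by (auto simp: c_def)
  have part: "(\<Sum>j<N. 2 powr (real (k + j) * q)) \<le> 2 powr ((real (k + N) - 1) * q) / c" for N
  proof (induction N)
    case (Suc N)
    have e: "2 powr ((real (k + N) - 1) * q) = 2 powr (real (k + N) * q) * (1 - c)"
      by (simp add: c_def powr_add[symmetric] algebra_simps)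
    have "(\<Sum>j<Suc N. 2 powr (real (k + j) * q)) \<le> 2 powr (real (k + N) * q) * (1 - c) / c + 2 powr (real (k + N) * q)"
      using Suc e by simp
    also have "\<dots> = 2 powr (real (k + N) * q) / c" using c by (simp add: field_simps)
    finally show ?case by simp
  qed (use c in auto)
  show ?thesis
  proof (cases "r < \<rho> * (1/2)^k")
    case False
    have "(1/2::real)^(k + j) \<le> (1/2)^k" for j by (intro power_decreasing) auto
    then have "\<rho> * (1/2)^(k + j) \<le> \<rho> * (1/2)^k" for j using assms by (intro mult_left_mono) auto
    then have z: "indicator {..<\<rho> * (1/2)^(k + j)} r = (0::ennreal)" for j
      using False by (smt (verit) indicator_simps(2) lessThan_iff)
    show ?thesis unfolding z by simp
  next
    case True
    \<comment> \<open>If scale \<open>N\<close> is active, its term dominates the whole geometric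
      sum, with every indicator replaced by \<open>1\<close>; if it is inactive, the previous bound
      carries over.\<close>
    have "(\<Sum>j<N. ennreal (2 powr (real (k + j) * q)) * indicator {..<\<rho> * (1/2)^(k + j)} r)
      \<le> ennreal (\<rho> powr q / c / r powr q)" for N
    proof (induction N)
      case (Suc N)
      show ?case
      proof (cases "r < \<rho> * (1/2)^(k + N)")
        case True
        have "2 powr real (k + N) = 2^(k + N)" by (rule powr_realpow) simp
        then have "2 powr real (k + N) < \<rho> / r"
          using True assms by (simp add: field_simps power_one_over)
        then have "(2 powr real (k + N)) powr q \<le> (\<rho> / r) powr q"
          using assms by (intro powr_mono2) auto
        then have le: "2 powr (real (k + N) * q) \<le> \<rho> powr q / r powr q"
          using assms by (simp add: powr_powr powr_divide)
        have "(\<Sum>j<Suc N. ennreal (2 powr (real (k + j) * q)) * indicator {..<\<rho> * (1/2)^(k + j)} r)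
          \<le> (\<Sum>j<Suc N. ennreal (2 powr (real (k + j) * q)))"
          by (intro sum_mono) (auto simp: indicator_def)
        also have "\<dots> = ennreal (\<Sum>j<Suc N. 2 powr (real (k + j) * q))" by (intro sum_ennreal) auto
        also have "\<dots> \<le> ennreal (2 powr (real (k + N) * q) / c)"
          using part[of "Suc N"] by (intro ennreal_leI) (simp add: algebra_simps)
        also have "\<dots> \<le> ennreal (\<rho> powr q / c / r powr q)"
          using divide_right_mono[OF le, of c] c by (intro ennreal_leI) (simp add: field_simps)
        finally show ?thesis .
      qed (use Suc in simp)
    qed simp
    then show ?thesis using True unfolding c_def[symmetric]
      by (auto simp: suminf_eq_SUP intro!: SUP_least)
  qed
qed

lemma ball_pred_measurable [measurable (raw)]:
  fixes f g :: "'b \<Rightarrow> 'a::euclidean_space"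
  assumes [measurable]: "f \<in> borel_measurable M" "g \<in> borel_measurable M" "h \<in> borel_measurable M"
  shows "Measurable.pred M (\<lambda>x. g x \<in> ball (f x) (h x))"
  unfolding mem_ball by measurable

lemma mult_regroup_inner:
  fixes x y :: "'b::comm_semiring_1"
  assumes "x * y = u * v"
  shows "x * (y * (h * i) * z) = u * (h * z) * (v * i)"
proof -
  have "x * (y * (h * i) * z) = (x * y) * (h * i * z)" by (simp only: mult_ac)
  then show ?thesis by (simp only: assms mult_ac)
qed

lemma mult_regroup_outer:
  fixes x y :: "'b::comm_semiring_1"
  assumes "x * y = u * v"
  shows "x * (h * z) * (y * i) = u * (h * v * i * z)"
proof -
  have "x * (h * z) * (y * i) = (x * y) * (h * i * z)" by (simp only: mult_ac)
  then show ?thesis by (simp only: assms mult_ac)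
qed

text \<open>The price of covering by cubes times the constant of \<open>scale_sum_le\<close>, with
  \<open>\<rho> = n + 1\<close> the radius factor of the neighbourhoods and
  \<open>q = s p + n\<close> the exponent of the seminorm.\<close>

definition frac_const :: "real \<Rightarrow> real \<Rightarrow> real \<Rightarrow> real" where
  "frac_const n s p = cover_const n (n - s) * ((n + 1) powr (s * p + n) / (1 - 2 powr (- (s * p + n))))"

lemma frac_const_nonneg: "s \<le> n \<Longrightarrow> 0 < s * p + n \<Longrightarrow> 0 \<le> n \<Longrightarrow> 0 \<le> frac_const n s p"
  using powr_less_mono[of "- (s * p + n)" 0 2]
  by (auto simp: frac_const_def intro!: mult_nonneg_nonneg cover_const_nonneg divide_nonneg_nonneg)

text \<open>The hypothesis on \<open>E\<close> is a fractional cover by weighted double averages of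
  \<open>H\<close> at the scales \<open>k + j\<close>. The averaging over cubes disappears under
  integration, and the sum over scales turns the growing weights into the kernel of the seminorm.
  \<open>H\<close> is kept abstract because it serves twice: for plain differences of
  \<open>f\<close>, and for truncated ones whose truncation depends on the cube of
  \<open>a\<close>.\<close>

lemma hausdorff_premeasure_frac_energy:
  fixes H :: "'a::euclidean_space \<Rightarrow> 'a \<Rightarrow> ennreal"
  assumes s: "0 < s" "s < 1" and p: "1 \<le> p"
    and X: "saturated k X" and Xm [measurable]: "X \<in> sets borel"
    and \<delta>: "real DIM('a) * (1/2)^k \<le> \<delta>"
    and Hm [measurable]: "(\<lambda>(a, b). H a b) \<in> borel_measurable (borel \<Otimes>\<^sub>M borel)"
    and H0: "\<And>a. H a a = 0"
    and E: "E \<subseteq> X" "\<And>x. x \<in> E \<Longrightarrow>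
      1 \<le> (\<Sum>j. ennreal (2 powr (real (k + j) * real DIM('a))) *
        (\<integral>\<^sup>+a\<in>dcube (k + j) x. ennreal (2 powr (s * (p - 1) * real j + real (k + j) * real DIM('a))) *
          (\<integral>\<^sup>+b\<in>ball a ((real DIM('a) + 1) * (1/2)^(k + j)). H a b \<partial>lborel) \<partial>lborel))"
  shows "hausdorff_premeasure (real DIM('a) - s) \<delta> E \<le>
    ennreal (frac_const DIM('a) s p * 2 powr (- (s * (p - 1) * real k))) *
    (\<integral>\<^sup>+a\<in>X. (\<integral>\<^sup>+b\<in>ball a ((real DIM('a) + 1) * (1/2)^k).
        H a b * ennreal (1 / norm (a - b) powr (s * p + real DIM('a))) \<partial>lborel) \<partial>lborel)"
proof -
  define n where "n = real DIM('a)"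
  define \<rho> where "\<rho> = n + 1"
  define q where "q = s * p + n"
  define C where "C = cover_const n (n - s)"
  have n1: "1 \<le> n" using DIM_positive[where 'a='a] by (simp add: n_def)
  have q: "0 < q" using s p n1 by (simp add: q_def add_nonneg_pos)
  have \<rho>: "0 < \<rho>" using n1 by (simp add: \<rho>_def)
  have C: "0 \<le> C" unfolding C_def using n1 s by (intro cover_const_nonneg) auto
  define \<phi> where "\<phi> j a = ennreal (2 powr (s * (p - 1) * real j + real (k + j) * n)) *
          (\<integral>\<^sup>+b\<in>ball a (\<rho> * (1/2)^(k + j)). H a b \<partial>lborel)" for j a
  define c where "c j x = ennreal (2 powr (real (k + j) * n)) * (\<integral>\<^sup>+a\<in>dcube (k + j) x. \<phi> j a \<partial>lborel)" for j x
  have \<phi>m [measurable]: "\<phi> j \<in> borel_measurable borel" for j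
    unfolding \<phi>_def by measurable
  have cm [measurable]: "c j \<in> borel_measurable borel" for j
    unfolding c_def by measurable
  have "hausdorff_premeasure (n - s) \<delta> E \<le>
    (\<Sum>j. ennreal (C * 2 powr (real (k + j) * (n - (n - s)))) * (\<integral>\<^sup>+x\<in>X. c j x \<partial>lborel))"
    unfolding n_def C_def
  proof (rule hausdorff_premeasure_fractional_cover[OF X Xm _ \<delta> cm _ E(1)])
    show "0 < real DIM('a) - s" using n1 s by (fold n_def) linarith
    show "c j z = c j x" if "z \<in> dcube (k + j) x" for j x z
      unfolding c_def using dcube_eq[OF that] by simp
    show "1 \<le> (\<Sum>j. c j x)" if "x \<in> E" for x
      using E(2)[OF that] by (simp add: c_def \<phi>_def n_def \<rho>_def)
  qed
  also have "\<dots> = (\<Sum>j. ennreal (C * 2 powr (real (k + j) * s)) * (\<integral>\<^sup>+x\<in>X. \<phi> j x \<partial>lborel))"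
    unfolding c_def n_def
    by (subst nn_integral_dcube_average) (use saturated_antimono[OF X] in auto)
  also have "\<dots> = (\<Sum>j. (\<integral>\<^sup>+a. (\<integral>\<^sup>+b. ennreal (C * 2 powr (real (k + j) * s)) * (ennreal (2 powr (s * (p - 1) * real j + real (k + j) * n)) *
       (H a b * indicator (ball a (\<rho> * (1/2)^(k + j))) b) * indicator X a) \<partial>lborel) \<partial>lborel))"
    unfolding \<phi>_def by (simp add: nn_integral_cmult nn_integral_multc)
  also have "\<dots> = (\<integral>\<^sup>+a. (\<integral>\<^sup>+b. (\<Sum>j. ennreal (C * 2 powr (real (k + j) * s)) * (ennreal (2 powr (s * (p - 1) * real j + real (k + j) * n)) *
       (H a b * indicator (ball a (\<rho> * (1/2)^(k + j))) b) * indicator X a)) \<partial>lborel) \<partial>lborel)"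
    by (simp add: nn_integral_suminf)
  also have "\<dots> \<le> (\<integral>\<^sup>+a. (\<integral>\<^sup>+b. ennreal (frac_const n s p * 2 powr (- (s * (p - 1) * real k))) *
      ((H a b * ennreal (1 / norm (a - b) powr q) * indicator (ball a (\<rho> * (1/2)^k)) b) * indicator X a) \<partial>lborel) \<partial>lborel)"
  proof (intro nn_integral_mono)
    fix a b :: 'a
    show "(\<Sum>j. ennreal (C * 2 powr (real (k + j) * s)) * (ennreal (2 powr (s * (p - 1) * real j + real (k + j) * n)) *
       (H a b * indicator (ball a (\<rho> * (1/2)^(k + j))) b) * indicator X a))
      \<le> ennreal (frac_const n s p * 2 powr (- (s * (p - 1) * real k))) *
      ((H a b * ennreal (1 / norm (a - b) powr q) * indicator (ball a (\<rho> * (1/2)^k)) b) * indicator X a)"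
    \<comment> \<open>On the diagonal the kernel takes the value \<open>1 / 0 = 0\<close>, and both
      sides vanish by \<open>H0\<close>.\<close>
    proof (cases "a = b")
      case False
      then have r: "0 < norm (a - b)" by simp
      have "ennreal (C * 2 powr (real (k + j) * s)) * (ennreal (2 powr (s * (p - 1) * real j + real (k + j) * n)) *
         (H a b * indicator (ball a (\<rho> * (1/2)^(k + j))) b) * indicator X a)
        = (ennreal (C * 2 powr (- (s * (p - 1) * real k))) * (H a b * indicator X a)) *
          (ennreal (2 powr (real (k + j) * q)) * indicator {..<\<rho> * (1/2)^(k + j)} (norm (a - b)))" for j
      proof -
        \<comment> \<open>The exponents satisfy \<open>(k + j) s + s (p - 1) j + (k + j) n = (k + j)
          (s p + n) - s (p - 1) k\<close>, and the last term does not involve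
          \<open>j\<close>.\<close>
        have "ennreal (C * 2 powr (real (k + j) * s)) * ennreal (2 powr (s * (p - 1) * real j + real (k + j) * n))
          = ennreal (C * 2 powr (- (s * (p - 1) * real k))) * ennreal (2 powr (real (k + j) * q))"
          using C by (simp add: ennreal_mult''[symmetric] powr_add[symmetric] q_def mult.assoc) (simp add: algebra_simps)
        moreover have "indicator (ball a (\<rho> * (1/2)^(k + j))) b = (indicator {..<\<rho> * (1/2)^(k + j)} (norm (a - b)) :: ennreal)"
          by (simp add: indicator_def dist_norm)
        ultimately show ?thesis by (simp only: mult_regroup_inner)
      qed
      then have "(\<Sum>j. ennreal (C * 2 powr (real (k + j) * s)) * (ennreal (2 powr (s * (p - 1) * real j + real (k + j) * n)) *
         (H a b * indicator (ball a (\<rho> * (1/2)^(k + j))) b) * indicator X a))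
        = (ennreal (C * 2 powr (- (s * (p - 1) * real k))) * (H a b * indicator X a)) *
          (\<Sum>j. ennreal (2 powr (real (k + j) * q)) * indicator {..<\<rho> * (1/2)^(k + j)} (norm (a - b)))"
        by simp
      also have "\<dots> \<le> (ennreal (C * 2 powr (- (s * (p - 1) * real k))) * (H a b * indicator X a)) *
         (ennreal (\<rho> powr q / (1 - 2 powr (- q)) / norm (a - b) powr q) * indicator {..<\<rho> * (1/2)^k} (norm (a - b)))"
        by (intro mult_left_mono scale_sum_le r \<rho> q) auto
      also have "\<dots> = ennreal (frac_const n s p * 2 powr (- (s * (p - 1) * real k))) *
      ((H a b * ennreal (1 / norm (a - b) powr q) * indicator (ball a (\<rho> * (1/2)^k)) b) * indicator X a)"
      proof -
        have "ennreal (C * 2 powr (- (s * (p - 1) * real k))) * ennreal (\<rho> powr q / (1 - 2 powr (- q)) / norm (a - b) powr q)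
          = ennreal (frac_const n s p * 2 powr (- (s * (p - 1) * real k))) * ennreal (1 / norm (a - b) powr q)"
        proof -
          have "2 powr (- q) < 1" using q powr_less_mono[of "- q" 0 2] by simp
          then show ?thesis
            by (subst (1 2) ennreal_mult''[symmetric]) (simp_all add: frac_const_def C_def \<rho>_def q_def mult_ac)
        qed
        moreover have "indicator (ball a (\<rho> * (1/2)^k)) b = (indicator {..<\<rho> * (1/2)^k} (norm (a - b)) :: ennreal)"
          by (simp add: indicator_def dist_norm)
        ultimately show ?thesis by (simp only: mult_regroup_outer)
      qed
      finally show ?thesis .
    qed (simp add: H0)
  qed
  also have "\<dots> = ennreal (frac_const n s p * 2 powr (- (s * (p - 1) * real k))) *
    (\<integral>\<^sup>+a\<in>X. (\<integral>\<^sup>+b\<in>ball a (\<rho> * (1/2)^k). H a b * ennreal (1 / norm (a - b) powr q) \<partial>lborel) \<partial>lborel)"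
    by (simp add: nn_integral_cmult nn_integral_multc)
  finally show ?thesis by (simp add: n_def \<rho>_def q_def)
qed

section \<open>Mean oscillation and local energy\<close>

text \<open>The radius exceeds the diameter bound \<open>n 2^(-i)\<close> of a cube by
  \<open>2^(-i)\<close>. About any point \<open>a\<close> of a cube it therefore holds the cube
  itself and every ball of radius at most \<open>2^(-i)\<close> centred at another point of the
  cube.\<close>

abbreviation nbhd :: "nat \<Rightarrow> 'a::euclidean_space \<Rightarrow> 'a set" where
  "nbhd i a \<equiv> ball a ((real DIM('a) + 1) * (1/2)^i)"

lemma dcube_subset_nbhd: "a \<in> dcube i x \<Longrightarrow> dcube i x \<subseteq> nbhd i (a::'a::euclidean_space)"
proof
  fix z assume a: "a \<in> dcube i x" and "z \<in> dcube i x"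
  then have "z \<in> dcube i a" using dcube_eq by blast
  from dcube_dist[OF this] have "dist a z \<le> real DIM('a) * (1/2)^i" by (simp add: dist_commute)
  also have "\<dots> < (real DIM('a) + 1) * (1/2)^i" by simp
  finally show "z \<in> nbhd i a" by simp
qed

lemma ball_subset_nbhd:
  fixes a :: "'a::euclidean_space"
  assumes a: "a \<in> dcube i x" and r: "r \<le> (1/2)^i"
  shows "ball x r \<subseteq> nbhd i a"
proof
  fix z assume z: "z \<in> ball x r"
  have "dist a z \<le> dist a x + dist x z" by (rule dist_triangle)
  also have "\<dots> < real DIM('a) * (1/2)^i + (1/2)^i"
    using dcube_dist[OF a] z r by (auto simp: mem_ball)
  finally show "z \<in> nbhd i a" by (simp add: algebra_simps)
qed

definition nbhd_vol :: "nat \<Rightarrow> real" where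
  "nbhd_vol n = unit_ball_vol (real n) * (real n + 1)^n"

lemma nbhd_vol_pos: "0 < nbhd_vol n"
  by (simp add: nbhd_vol_def)

lemma half_power_powr: "((1/2)^i)^n = (2::real) powr (- (real i * real n))"
  by (simp add: powr_minus powr_realpow[symmetric] power_one_over powr_powr field_simps
      flip: power_mult of_nat_mult)

lemma emeasure_nbhd:
  "emeasure lborel (nbhd i (a::'a::euclidean_space)) = ennreal (nbhd_vol DIM('a) * 2 powr (- (real i * real DIM('a))))"
  by (simp add: emeasure_ball nbhd_vol_def power_mult_distrib half_power_powr mult.assoc)

text \<open>The splitting \<open>t \<le> \<kappa> + \<kappa>\<^bsup>1-p\<^esup> t\<^sup>p\<close> replaces Hoelder's inequality throughout.\<close>

lemma le_plus_powr:
  fixes t \<kappa> p :: real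
  assumes "0 \<le> t" "0 < \<kappa>" "1 \<le> p"
  shows "t \<le> \<kappa> + \<kappa> powr (1 - p) * t powr p"
proof (cases "t \<le> \<kappa>")
  case False
  then have "t powr (1 - p) \<le> \<kappa> powr (1 - p)"
    using assms by (intro powr_mono2') auto
  then have "t powr (1 - p) * t powr p \<le> \<kappa> powr (1 - p) * t powr p"
    by (intro mult_right_mono) auto
  moreover have "t powr (1 - p) * t powr p = t" using False assms by (simp flip: powr_add)
  ultimately show ?thesis using assms by simp
qed (use assms in \<open>auto intro: add_increasing2\<close>)

text \<open>Up to a constant, the average of \<open>\<bar>f a - f b\<bar>\<close> over
  \<open>a\<close> in the cube and \<open>b\<close> near \<open>a\<close>. As an
  \<open>ennreal\<close> integral of differences it makes sense without integrability of
  \<open>f\<close>, depends only on the cube and is the same for \<open>-f\<close>. Since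
  \<open>b\<close> may leave the cube, it also controls averages over balls.\<close>

definition mean_osc :: "nat \<Rightarrow> ('a::euclidean_space \<Rightarrow> real) \<Rightarrow> 'a \<Rightarrow> ennreal" where
  "mean_osc i f x = ennreal (2 powr (2 * real i * real DIM('a))) *
    (\<integral>\<^sup>+a\<in>dcube i x. (\<integral>\<^sup>+b\<in>nbhd i a. ennreal \<bar>f a - f b\<bar> \<partial>lborel) \<partial>lborel)"

definition power_osc :: "real \<Rightarrow> nat \<Rightarrow> ('a::euclidean_space \<Rightarrow> real) \<Rightarrow> 'a \<Rightarrow> ennreal" where
  "power_osc p i f x = ennreal (2 powr (2 * real i * real DIM('a))) *
    (\<integral>\<^sup>+a\<in>dcube i x. (\<integral>\<^sup>+b\<in>nbhd i a. ennreal (\<bar>f a - f b\<bar> powr p) \<partial>lborel) \<partial>lborel)"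

text \<open>The Gagliardo seminorm restricted to pairs at distance \<open>O(2^(-k))\<close>. Only
  \<open>a\<close> is confined to \<open>X\<close>; in the application \<open>X\<close> is chosen so
  that the neighbourhoods of its points stay in \<Omega>.\<close>

definition local_energy :: "real \<Rightarrow> real \<Rightarrow> 'a::euclidean_space set \<Rightarrow> ('a \<Rightarrow> real) \<Rightarrow> nat \<Rightarrow> ennreal" where
  "local_energy s p X f k = (\<integral>\<^sup>+a\<in>X. (\<integral>\<^sup>+b\<in>nbhd k a.
     ennreal (\<bar>f a - f b\<bar> powr p) * ennreal (1 / norm (a - b) powr (s * p + real DIM('a))) \<partial>lborel) \<partial>lborel)"

lemma mean_osc_measurable [measurable]:
  assumes [measurable]: "f \<in> borel_measurable borel"
  shows "mean_osc i f \<in> borel_measurable borel"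
  unfolding mean_osc_def by measurable

lemma nn_integral_nbhd_le:
  fixes f :: "'a::euclidean_space \<Rightarrow> real"
  assumes [measurable]: "f \<in> borel_measurable borel" and l: "0 < \<kappa>" and p: "1 \<le> p"
  shows "(\<integral>\<^sup>+b\<in>nbhd i a. ennreal \<bar>f a - f b\<bar> \<partial>lborel) \<le>
    ennreal (\<kappa> * nbhd_vol DIM('a) * 2 powr (- (real i * real DIM('a)))) +
    ennreal (\<kappa> powr (1 - p)) * (\<integral>\<^sup>+b\<in>nbhd i a. ennreal (\<bar>f a - f b\<bar> powr p) \<partial>lborel)"
proof -
  have "(\<integral>\<^sup>+b\<in>nbhd i a. ennreal \<bar>f a - f b\<bar> \<partial>lborel) \<le>
    (\<integral>\<^sup>+b. ennreal \<kappa> * indicator (nbhd i a) b +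
       ennreal (\<kappa> powr (1 - p)) * (ennreal (\<bar>f a - f b\<bar> powr p) * indicator (nbhd i a) b) \<partial>lborel)"
    using l le_plus_powr[OF _ l p]
    by (intro nn_integral_mono)
       (auto simp: indicator_def ennreal_mult'[symmetric] ennreal_plus[symmetric] simp del: ennreal_plus intro!: ennreal_leI)
  also have "\<dots> = ennreal \<kappa> * emeasure lborel (nbhd i a) +
    ennreal (\<kappa> powr (1 - p)) * (\<integral>\<^sup>+b\<in>nbhd i a. ennreal (\<bar>f a - f b\<bar> powr p) \<partial>lborel)"
    by (simp add: nn_integral_add nn_integral_cmult)
  also have "ennreal \<kappa> * emeasure lborel (nbhd i a) = ennreal (\<kappa> * nbhd_vol DIM('a) * 2 powr (- (real i * real DIM('a))))"
    using l by (simp add: emeasure_nbhd ennreal_mult'[symmetric] mult.assoc)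
  finally show ?thesis .
qed

lemma mean_osc_le:
  fixes f :: "'a::euclidean_space \<Rightarrow> real"
  assumes [measurable]: "f \<in> borel_measurable borel" and l: "0 < \<kappa>" and p: "1 \<le> p"
  shows "mean_osc i f x \<le> ennreal (\<kappa> * nbhd_vol DIM('a)) + ennreal (\<kappa> powr (1 - p)) * power_osc p i f x"
proof -
  let ?n = "real DIM('a)"
  have "mean_osc i f x \<le> ennreal (2 powr (2 * real i * ?n)) *
    (\<integral>\<^sup>+a. (ennreal (\<kappa> * nbhd_vol DIM('a) * 2 powr (- (real i * ?n))) +
    ennreal (\<kappa> powr (1 - p)) * (\<integral>\<^sup>+b\<in>nbhd i a. ennreal (\<bar>f a - f b\<bar> powr p) \<partial>lborel)) * indicator (dcube i x) a \<partial>lborel)"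
    unfolding mean_osc_def
    by (intro mult_left_mono nn_integral_mono mult_right_mono nn_integral_nbhd_le assms) auto
  also have "\<dots> = ennreal (2 powr (2 * real i * ?n)) * (ennreal (\<kappa> * nbhd_vol DIM('a) * 2 powr (- (real i * ?n))) * emeasure lborel (dcube i x)
      + ennreal (\<kappa> powr (1 - p)) * (\<integral>\<^sup>+a\<in>dcube i x. (\<integral>\<^sup>+b\<in>nbhd i a. ennreal (\<bar>f a - f b\<bar> powr p) \<partial>lborel) \<partial>lborel))"
    by (simp add: distrib_right nn_integral_add nn_integral_cmult mult.assoc)
  also have "\<dots> = ennreal (2 powr (2 * real i * ?n)) * (ennreal (\<kappa> * nbhd_vol DIM('a) * 2 powr (- (real i * ?n))) * emeasure lborel (dcube i x))
      + ennreal (\<kappa> powr (1 - p)) * power_osc p i f x"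
    by (simp add: power_osc_def distrib_left mult_ac)
  also have "ennreal (2 powr (2 * real i * ?n)) * (ennreal (\<kappa> * nbhd_vol DIM('a) * 2 powr (- (real i * ?n))) * emeasure lborel (dcube i x))
     = ennreal (\<kappa> * nbhd_vol DIM('a))"
    using l nbhd_vol_pos[of "DIM('a)"]
    by (simp add: emeasure_dcube ennreal_mult'[symmetric] mult_ac powr_add[symmetric])
  finally show ?thesis .
qed

text \<open>For \<open>b\<close> in \<open>nbhd i a\<close> the distance is below
  \<open>(n + 1) 2^(-i)\<close>, so inserting the kernel costs only
  \<open>(n + 1)^q 2^(-i q)\<close> with \<open>q = s p + n\<close>; the normalisation consumes
  \<open>2^(-i n)\<close> and \<open>2^(-s p i)\<close> remains. The two terms balance for
  \<open>\<kappa>\<close> of order \<open>2^(-s i)\<close>, which is the scaling of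
  \<open>h\<close>.\<close>

lemma nn_integral_mean_osc_le:
  fixes f :: "'a::euclidean_space \<Rightarrow> real"
  assumes [measurable]: "f \<in> borel_measurable borel" and l: "0 < \<kappa>" and p: "1 \<le> p" and s: "0 < s"
    and X: "saturated i X" and [measurable]: "X \<in> sets borel"
  shows "(\<integral>\<^sup>+x\<in>X. mean_osc i f x \<partial>lborel) \<le> ennreal (\<kappa> * nbhd_vol DIM('a)) * emeasure lborel X +
    ennreal (\<kappa> powr (1 - p) * ((real DIM('a) + 1) powr (s * p + real DIM('a)) * 2 powr (- (s * p * real i)))) *
    local_energy s p X f i"
proof -
  let ?n = "real DIM('a)"
  define q where "q = s * p + ?n"
  have q: "0 < q" using s p by (simp add: q_def add_pos_pos)
  have "(\<integral>\<^sup>+x\<in>X. mean_osc i f x \<partial>lborel) =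
    (\<integral>\<^sup>+x\<in>X. ennreal (2 powr (real i * ?n)) * (\<integral>\<^sup>+a\<in>dcube i x.
       ennreal (2 powr (real i * ?n)) * (\<integral>\<^sup>+b\<in>nbhd i a. ennreal \<bar>f a - f b\<bar> \<partial>lborel) \<partial>lborel) \<partial>lborel)"
    unfolding mean_osc_def
    by (simp add: nn_integral_cmult mult.assoc)
       (simp add: mult.assoc[symmetric] ennreal_mult'[symmetric] powr_add[symmetric])
  also have "\<dots> = (\<integral>\<^sup>+a\<in>X. ennreal (2 powr (real i * ?n)) * (\<integral>\<^sup>+b\<in>nbhd i a. ennreal \<bar>f a - f b\<bar> \<partial>lborel) \<partial>lborel)"
    by (rule nn_integral_dcube_average[OF X]) measurable
  also have "\<dots> \<le> (\<integral>\<^sup>+a. (ennreal (\<kappa> * nbhd_vol DIM('a)) + ennreal (\<kappa> powr (1 - p) * ((?n + 1) powr q * 2 powr (- (s * p * real i)))) *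
      (\<integral>\<^sup>+b\<in>nbhd i a. ennreal (\<bar>f a - f b\<bar> powr p) * ennreal (1 / norm (a - b) powr q) \<partial>lborel)) * indicator X a \<partial>lborel)"
  proof (intro nn_integral_mono mult_right_mono)
    fix a
    have "ennreal (2 powr (real i * ?n)) * (\<integral>\<^sup>+b\<in>nbhd i a. ennreal \<bar>f a - f b\<bar> \<partial>lborel)
      \<le> ennreal (2 powr (real i * ?n)) * (ennreal (\<kappa> * nbhd_vol DIM('a) * 2 powr (- (real i * ?n))) +
    ennreal (\<kappa> powr (1 - p)) * (\<integral>\<^sup>+b\<in>nbhd i a. ennreal (\<bar>f a - f b\<bar> powr p) \<partial>lborel))"
      by (intro mult_left_mono nn_integral_nbhd_le assms) auto
    also have "\<dots> = ennreal (\<kappa> * nbhd_vol DIM('a)) + (\<integral>\<^sup>+b\<in>nbhd i a. ennreal (2 powr (real i * ?n) * \<kappa> powr (1 - p)) * ennreal (\<bar>f a - f b\<bar> powr p) \<partial>lborel)"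
      using l nbhd_vol_pos[of "DIM('a)"]
      by (simp add: distrib_left nn_integral_cmult mult.assoc)
         (simp add: ennreal_mult'[symmetric] mult_ac powr_add[symmetric] flip: mult.assoc)
    also have "\<dots> \<le> ennreal (\<kappa> * nbhd_vol DIM('a)) + (\<integral>\<^sup>+b\<in>nbhd i a. ennreal (\<kappa> powr (1 - p) * ((?n + 1) powr q * 2 powr (- (s * p * real i)))) *
       (ennreal (\<bar>f a - f b\<bar> powr p) * ennreal (1 / norm (a - b) powr q)) \<partial>lborel)"
    proof (intro add_left_mono nn_integral_mono)
      fix b
      show "ennreal (2 powr (real i * ?n) * \<kappa> powr (1 - p)) * ennreal (\<bar>f a - f b\<bar> powr p) * indicator (nbhd i a) b
        \<le> ennreal (\<kappa> powr (1 - p) * ((?n + 1) powr q * 2 powr (- (s * p * real i)))) *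
       (ennreal (\<bar>f a - f b\<bar> powr p) * ennreal (1 / norm (a - b) powr q)) * indicator (nbhd i a) b"
      proof (cases "b \<in> nbhd i a \<and> a \<noteq> b")
        case True
        then have r: "0 < norm (a - b)" "norm (a - b) \<le> (?n + 1) * 2 powr (- real i)"
          by (auto simp: dist_norm powr_minus powr_realpow power_one_over field_simps)
        then have "norm (a - b) powr q \<le> ((?n + 1) * 2 powr (- real i)) powr q"
          using q by (intro powr_mono2) auto
        also have "\<dots> = (?n + 1) powr q * 2 powr (- real i * q)"
          by (simp add: powr_mult powr_powr)
        finally have "2 powr (real i * ?n) * norm (a - b) powr q \<le> 2 powr (real i * ?n) * ((?n + 1) powr q * 2 powr (- real i * q))"
          by (intro mult_left_mono) auto
        also have "\<dots> = (?n + 1) powr q * 2 powr (- (s * p * real i))"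
          by (simp add: mult.left_commute[of "2 powr _"] powr_add[symmetric]) (simp add: q_def algebra_simps)
        finally have "2 powr (real i * ?n) \<le> (?n + 1) powr q * 2 powr (- (s * p * real i)) * (1 / norm (a - b) powr q)"
          using r by (simp add: field_simps)
        then have "(\<kappa> powr (1 - p) * \<bar>f a - f b\<bar> powr p) * 2 powr (real i * ?n)
          \<le> (\<kappa> powr (1 - p) * \<bar>f a - f b\<bar> powr p) * ((?n + 1) powr q * 2 powr (- (s * p * real i)) * (1 / norm (a - b) powr q))"
          by (intro mult_left_mono) auto
        then show ?thesis using True
          by (simp add: ennreal_mult'[symmetric] mult_ac)
      qed (use p in auto)
    qed
    also have "\<dots> = ennreal (\<kappa> * nbhd_vol DIM('a)) + ennreal (\<kappa> powr (1 - p) * ((?n + 1) powr q * 2 powr (- (s * p * real i)))) *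
      (\<integral>\<^sup>+b\<in>nbhd i a. ennreal (\<bar>f a - f b\<bar> powr p) * ennreal (1 / norm (a - b) powr q) \<partial>lborel)"
      by (simp add: nn_integral_cmult mult.assoc)
    finally show "ennreal (2 powr (real i * ?n)) * (\<integral>\<^sup>+b\<in>nbhd i a. ennreal \<bar>f a - f b\<bar> \<partial>lborel)
      \<le> ennreal (\<kappa> * nbhd_vol DIM('a)) + ennreal (\<kappa> powr (1 - p) * ((?n + 1) powr q * 2 powr (- (s * p * real i)))) *
      (\<integral>\<^sup>+b\<in>nbhd i a. ennreal (\<bar>f a - f b\<bar> powr p) * ennreal (1 / norm (a - b) powr q) \<partial>lborel)" .
  qed auto
  also have "\<dots> = ennreal (\<kappa> * nbhd_vol DIM('a)) * emeasure lborel X +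
    ennreal (\<kappa> powr (1 - p) * ((?n + 1) powr q * 2 powr (- (s * p * real i)))) * local_energy s p X f i"
    unfolding local_energy_def q_def
    by (simp add: distrib_right nn_integral_add nn_integral_cmult mult.assoc)
  finally show ?thesis by (simp add: q_def)
qed

text \<open>The neighbourhoods shrink to the diagonal, where \<open>1 / 0 = 0\<close> makes the
  integrand vanish, and the integrand at level \<open>k0\<close> dominates. This decay is what
  yields measure zero in place of a finite bound.\<close>

lemma local_energy_tendsto_0:
  fixes f :: "'a::euclidean_space \<Rightarrow> real"
  assumes [measurable]: "f \<in> borel_measurable borel" "X \<in> sets borel"
    and fin: "local_energy s p X f k0 < \<infinity>"
  shows "(\<lambda>k. local_energy s p X f k) \<longlonglongrightarrow> 0"
proof -
  define u where "u k = (\<lambda>(a, b). ennreal (\<bar>f a - f b\<bar> powr p) * ennreal (1 / norm (a - b) powr (s * p + real DIM('a)))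
    * indicator (nbhd k a) b * indicator X a)" for k
  have um [measurable]: "u k \<in> borel_measurable (lborel \<Otimes>\<^sub>M lborel)" for k unfolding u_def by measurable
  have e: "local_energy s p X f k = (\<integral>\<^sup>+z. u k z \<partial>(lborel \<Otimes>\<^sub>M lborel))" for k
  proof -
    have "(\<integral>\<^sup>+z. u k z \<partial>(lborel \<Otimes>\<^sub>M lborel)) = (\<integral>\<^sup>+a. (\<integral>\<^sup>+b. u k (a, b) \<partial>lborel) \<partial>lborel)"
      by (rule lborel.nn_integral_fst[symmetric]) measurable
    also have "\<dots> = local_energy s p X f k"
      unfolding u_def local_energy_def by (simp add: nn_integral_multc)
    finally show ?thesis by simp
  qed
  have "(\<lambda>k. \<integral>\<^sup>+z. u (k + k0) z \<partial>(lborel \<Otimes>\<^sub>M lborel)) \<longlonglongrightarrow> (\<integral>\<^sup>+z. 0 \<partial>((lborel :: 'a measure) \<Otimes>\<^sub>M (lborel :: 'a measure)))"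
  proof (rule nn_integral_dominated_convergence[where w = "u k0"])
    show "(\<integral>\<^sup>+z. u k0 z \<partial>(lborel \<Otimes>\<^sub>M lborel)) < \<infinity>" using fin e by simp
    show "AE z in lborel \<Otimes>\<^sub>M lborel. u (k + k0) z \<le> u k0 z" for k
    proof (rule AE_I2)
      fix z :: "'a \<times> 'a"
      have "(1/2::real)^(k + k0) \<le> (1/2)^k0" by (intro power_decreasing) auto
      then have "nbhd (k + k0) (fst z) \<subseteq> nbhd k0 (fst z)"
        by (intro subset_ball mult_left_mono) auto
      then show "u (k + k0) z \<le> u k0 z"
        by (cases z) (auto simp: u_def indicator_def)
    qed
    show "AE z in lborel \<Otimes>\<^sub>M lborel. (\<lambda>k. u (k + k0) z) \<longlonglongrightarrow> 0"
    proof (rule AE_I2)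
      fix z :: "'a \<times> 'a"
      obtain a b where z: "z = (a, b)" by (cases z)
      show "(\<lambda>k. u (k + k0) z) \<longlonglongrightarrow> 0"
      proof (cases "a = b")
        case False
        have "(\<lambda>k. (real DIM('a) + 1) * (1/2::real)^(k + k0)) \<longlonglongrightarrow> (real DIM('a) + 1) * 0"
          by (intro tendsto_mult tendsto_const LIMSEQ_ignore_initial_segment LIMSEQ_realpow_zero) auto
        then have "\<forall>\<^sub>F k in sequentially. (real DIM('a) + 1) * (1/2::real)^(k + k0) < dist a b"
          by (rule order_tendstoD) (use False in auto)
        then have "\<forall>\<^sub>F k in sequentially. u (k + k0) z = 0"
          by eventually_elim (auto simp: u_def z)
        then show ?thesis by (rule tendsto_eventually)
      qed (simp add: z u_def)
    qed
  qed measurable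
  then have "(\<lambda>k. local_energy s p X f (k + k0)) \<longlonglongrightarrow> 0" by (simp add: e)
  then show ?thesis by (rule LIMSEQ_offset)
qed

text \<open>If the oscillation exceeds a fixed size at arbitrarily small scales, then beyond any
  \<open>k\<close> a single term of the fractional cover already reaches \<open>1\<close>. The cost
  is a fixed multiple of the energy at level \<open>k\<close>, which tends to
  \<open>0\<close>.\<close>

lemma mean_osc_null:
  fixes f :: "'a::euclidean_space \<Rightarrow> real"
  assumes s: "0 < s" "s < 1" and p: "1 \<le> p" and fm [measurable]: "f \<in> borel_measurable borel"
    and X: "saturated k0 X" and Xm [measurable]: "X \<in> sets borel"
    and fin: "local_energy s p X f k0 < \<infinity>"
  shows "hausdorff_measure (real DIM('a) - s) {x\<in>X. \<not> (\<lambda>i. mean_osc i f x) \<longlonglongrightarrow> 0} = 0"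
proof -
  let ?n = "real DIM('a)" and ?w = "nbhd_vol DIM('a)"
  have w: "0 < ?w" by (rule nbhd_vol_pos)
  \<comment> \<open>The threshold is twice the first term of \<open>mean_osc_le\<close> for
    \<open>\<kappa> = 1 / Suc m\<close>, so half of it is left for the \<open>p\<close>-th
    powers.\<close>
  define N where "N m = {x\<in>X. \<forall>k. \<exists>i\<ge>k. ennreal (2 * (?w * (1 / real (Suc m)))) < mean_osc i f x}" for m
  have N0: "hausdorff_measure (?n - s) (N m) = 0" for m
    unfolding hausdorff_measure_eq_0_iff
  proof (intro allI impI)
    fix \<delta> :: real assume \<delta>: "0 < \<delta>"
    define \<kappa> where "\<kappa> = 1 / real (Suc m)"
    have l: "0 < \<kappa>" by (simp add: \<kappa>_def)
    define C where "C = \<kappa> powr (- p) / ?w"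
    have C: "0 < C" using l w by (simp add: C_def)
    have bound: "hausdorff_premeasure (?n - s) \<delta> (N m) \<le> ennreal (frac_const ?n s p * C) * local_energy s p X f k"
      if k: "k0 \<le> k" "?n * (1/2)^k \<le> \<delta>" for k
    proof -
      define H where "H a b = ennreal C * ennreal (\<bar>f a - f b\<bar> powr p)" for a b
      have Hm [measurable]: "(\<lambda>(a, b). H a b) \<in> borel_measurable (borel \<Otimes>\<^sub>M borel)"
        unfolding H_def by measurable
      have "hausdorff_premeasure (?n - s) \<delta> (N m) \<le>
        ennreal (frac_const ?n s p * 2 powr (- (s * (p - 1) * real k))) *
        (\<integral>\<^sup>+a\<in>X. (\<integral>\<^sup>+b\<in>nbhd k a. H a b * ennreal (1 / norm (a - b) powr (s * p + ?n)) \<partial>lborel) \<partial>lborel)"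
      proof (rule hausdorff_premeasure_frac_energy[OF s p saturated_antimono[OF X k(1)] Xm k(2) Hm])
        show "H a a = 0" for a using p by (simp add: H_def)
        show "N m \<subseteq> X" by (auto simp: N_def)
        fix x assume "x \<in> N m"
        then obtain i where i: "k \<le> i" "ennreal (2 * (?w * \<kappa>)) < mean_osc i f x"
          unfolding N_def \<kappa>_def by blast
        then obtain j where j: "i = k + j" using le_Suc_ex by blast
        have "ennreal (2 * (?w * \<kappa>)) \<le> ennreal (\<kappa> * ?w) + ennreal (\<kappa> powr (1 - p)) * power_osc p i f x"
          using i(2) mean_osc_le[OF fm l p, of i x] by simp
        moreover have "ennreal (2 * (?w * \<kappa>)) = ennreal (\<kappa> * ?w) + ennreal (\<kappa> * ?w)"
          using w l by (simp add: mult.commute flip: ennreal_plus)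
        ultimately have "ennreal (\<kappa> * ?w) \<le> ennreal (\<kappa> powr (1 - p)) * power_osc p i f x"
          by (simp add: ennreal_add_left_cancel_le)
        then have "ennreal (1 / (\<kappa> * ?w)) * ennreal (\<kappa> * ?w) \<le> ennreal (1 / (\<kappa> * ?w)) * (ennreal (\<kappa> powr (1 - p)) * power_osc p i f x)"
          by (rule mult_left_mono) simp
        moreover have "ennreal (1 / (\<kappa> * ?w)) * ennreal (\<kappa> * ?w) = 1"
          using w l by (simp add: ennreal_mult'[symmetric])
        moreover have "ennreal (1 / (\<kappa> * ?w)) * (ennreal (\<kappa> powr (1 - p)) * power_osc p i f x) = ennreal C * power_osc p i f x"
        proof -
          have "1 / (\<kappa> * ?w) * \<kappa> powr (1 - p) = C"
            using l w by (simp add: C_def powr_diff powr_minus field_simps)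
          then show ?thesis using w l by (simp add: mult.assoc[symmetric] ennreal_mult'[symmetric])
        qed
        ultimately have "1 \<le> ennreal C * power_osc p i f x" by simp
        also have "\<dots> = ennreal (2 powr (real i * ?n)) * (\<integral>\<^sup>+a\<in>dcube i x. ennreal (2 powr (real i * ?n)) *
            (\<integral>\<^sup>+b\<in>nbhd i a. H a b \<partial>lborel) \<partial>lborel)"
        proof -
          have sq: "ennreal (2 powr (2 * real i * ?n)) = ennreal (2 powr (real i * ?n)) * ennreal (2 powr (real i * ?n))"
            by (simp add: ennreal_mult'[symmetric] powr_add[symmetric] mult.assoc)
          define J where "J a = (\<integral>\<^sup>+b\<in>nbhd i a. ennreal (\<bar>f a - f b\<bar> powr p) \<partial>lborel)" for a
          have [measurable]: "J \<in> borel_measurable borel" unfolding J_def by measurable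
          have "(\<integral>\<^sup>+b\<in>nbhd i a. H a b \<partial>lborel) = ennreal C * J a" for a
            by (simp add: H_def J_def mult.assoc nn_integral_cmult)
          then have "(\<integral>\<^sup>+a\<in>dcube i x. ennreal (2 powr (real i * ?n)) * (\<integral>\<^sup>+b\<in>nbhd i a. H a b \<partial>lborel) \<partial>lborel)
            = (\<integral>\<^sup>+a. (ennreal (2 powr (real i * ?n)) * ennreal C) * (J a * indicator (dcube i x) a) \<partial>lborel)"
            by (simp add: mult.assoc)
          also have "\<dots> = (ennreal (2 powr (real i * ?n)) * ennreal C) * (\<integral>\<^sup>+a\<in>dcube i x. J a \<partial>lborel)"
            by (rule nn_integral_cmult) measurable
          finally show ?thesis
            unfolding power_osc_def J_def[symmetric] sq by (simp only: mult_ac)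
        qed
        \<comment> \<open>Inserting the weight \<open>2^(s (p - 1) j)\<close>, which is at least
          \<open>1\<close>, gives the shape of one term of the series; the series bounds that
          term.\<close>
        also have "\<dots> \<le> ennreal (2 powr (real i * ?n)) * (\<integral>\<^sup>+a\<in>dcube i x. ennreal (2 powr (s * (p - 1) * real j + real i * ?n)) *
            (\<integral>\<^sup>+b\<in>nbhd i a. H a b \<partial>lborel) \<partial>lborel)"
          using s p by (intro mult_left_mono nn_integral_mono mult_right_mono ennreal_leI powr_mono) auto
        also have "\<dots> \<le> (\<Sum>j. ennreal (2 powr (real (k + j) * ?n)) * (\<integral>\<^sup>+a\<in>dcube (k + j) x. ennreal (2 powr (s * (p - 1) * real j + real (k + j) * ?n)) *
            (\<integral>\<^sup>+b\<in>nbhd (k + j) a. H a b \<partial>lborel) \<partial>lborel))"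
          unfolding j using sum_le_suminf[of "\<lambda>j. ennreal (2 powr (real (k + j) * ?n)) * (\<integral>\<^sup>+a\<in>dcube (k + j) x. ennreal (2 powr (s * (p - 1) * real j + real (k + j) * ?n)) *
            (\<integral>\<^sup>+b\<in>nbhd (k + j) a. H a b \<partial>lborel) \<partial>lborel)" "{j}"] by simp
        finally show "1 \<le> \<dots>" .
      qed
      also have "\<dots> = ennreal (frac_const ?n s p * 2 powr (- (s * (p - 1) * real k))) * (ennreal C * local_energy s p X f k)"
        unfolding H_def local_energy_def by (simp add: nn_integral_cmult mult.assoc)
      also have "\<dots> = ennreal (frac_const ?n s p * 2 powr (- (s * (p - 1) * real k)) * C) * local_energy s p X f k"
        using C by (simp add: ennreal_mult'' mult.assoc)
      also have "\<dots> \<le> ennreal (frac_const ?n s p * C) * local_energy s p X f k"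
      proof (rule mult_right_mono[OF ennreal_leI])
        have "0 \<le> frac_const ?n s p"
          using s p DIM_positive[where 'a='a] by (intro frac_const_nonneg add_pos_pos) (auto intro: order_trans[of s 1])
        moreover have "2 powr (- (s * (p - 1) * real k)) \<le> 2 powr 0"
          using s p by (intro powr_mono) auto
        ultimately show "frac_const ?n s p * 2 powr (- (s * (p - 1) * real k)) * C \<le> frac_const ?n s p * C"
          using C by (intro mult_right_mono) (auto intro: mult_left_le)
      qed auto
      finally show ?thesis .
    qed
    have "(\<lambda>k. ennreal (frac_const ?n s p * C) * local_energy s p X f k) \<longlonglongrightarrow> ennreal (frac_const ?n s p * C) * 0"
      by (intro ennreal_tendsto_cmult local_energy_tendsto_0[OF fm Xm fin]) simp
    moreover have "\<forall>\<^sub>F k in sequentially. hausdorff_premeasure (?n - s) \<delta> (N m) \<le> ennreal (frac_const ?n s p * C) * local_energy s p X f k"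
    proof -
      have "(\<lambda>k. ?n * (1/2::real)^k) \<longlonglongrightarrow> ?n * 0"
        by (intro tendsto_mult tendsto_const LIMSEQ_realpow_zero) auto
      then have "\<forall>\<^sub>F k in sequentially. ?n * (1/2::real)^k < \<delta>"
        by (rule order_tendstoD) (use \<delta> in auto)
      then show ?thesis using eventually_ge_at_top[of k0]
        by eventually_elim (intro bound; simp)
    qed
    ultimately have "hausdorff_premeasure (?n - s) \<delta> (N m) \<le> ennreal (frac_const ?n s p * C) * 0"
      by (intro tendsto_lowerbound[of _ _ sequentially]) auto
    then show "hausdorff_premeasure (?n - s) \<delta> (N m) = 0" by simp
  qed
  have "{x\<in>X. \<not> (\<lambda>i. mean_osc i f x) \<longlonglongrightarrow> 0} \<subseteq> (\<Union>m. N m)"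
  proof
    fix x assume x: "x \<in> {x\<in>X. \<not> (\<lambda>i. mean_osc i f x) \<longlonglongrightarrow> 0}"
    show "x \<in> (\<Union>m. N m)"
    proof (rule ccontr)
      assume no: "x \<notin> (\<Union>m. N m)"
      have "(\<lambda>i. mean_osc i f x) \<longlonglongrightarrow> 0"
      proof (rule order_tendstoI)
        fix e :: ennreal assume e: "0 < e"
        obtain e' where e': "0 < e'" "ennreal e' < e"
          using e by (metis dense ennreal_cases ennreal_less_zero_iff less_top_ennreal not_less_iff_gr_or_eq order_less_imp_not_less top.not_eq_extremum)
        obtain m where m: "1 / real (Suc m) < e' / (2 * ?w)"
          using nat_approx_posE[of "e' / (2 * ?w)"] e' w by (auto simp: divide_pos_pos)
        have "x \<notin> N m" using no by blast
        then obtain k where k: "\<And>i. k \<le> i \<Longrightarrow> mean_osc i f x \<le> ennreal (2 * (?w * (1 / real (Suc m))))"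
          using x unfolding N_def by (auto simp: not_less)
        have "2 * (?w * (1 / real (Suc m))) \<le> e'" using m w by (simp add: field_simps)
        then have "ennreal (2 * (?w * (1 / real (Suc m)))) \<le> ennreal e'" by (rule ennreal_leI)
        with k e' have "\<And>i. k \<le> i \<Longrightarrow> mean_osc i f x < e" by (meson le_less_trans)
        then show "\<forall>\<^sub>F i in sequentially. mean_osc i f x < e"
          unfolding eventually_sequentially by blast
      qed simp
      with x show False by simp
    qed
  qed
  then show ?thesis using hausdorff_measure_UN_eq_0[of _ N] N0 hausdorff_measure_null_mono by blast
qed

section \<open>Dyadic averages at a point of a level set\<close>

definition avg :: "('a::euclidean_space \<Rightarrow> real) \<Rightarrow> 'a set \<Rightarrow> real" where
  "avg g A = (LINT z:A|lborel. g z) / measure lborel A"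

lemma avg_dist_le:
  assumes g: "set_integrable lborel B g" and B: "B \<in> sets lborel"
    and m: "emeasure lborel B = ennreal m" "0 < m"
  shows "ennreal \<bar>c - avg g B\<bar> \<le> ennreal (1 / m) * (\<integral>\<^sup>+b\<in>B. ennreal \<bar>c - g b\<bar> \<partial>lborel)"
proof -
  have mm: "measure lborel B = m" using m by (simp add: measure_def)
  have ci: "set_integrable lborel B (\<lambda>_. c)"
    unfolding set_integrable_def using B m by (intro integrable_scaleR_left integrable_real_indicator) auto
  have i: "set_integrable lborel B (\<lambda>b. c - g b)" by (rule set_integral_diff(1)[OF ci g])
  have "c - avg g B = (1 / m) * (LINT b:B|lborel. c - g b)"
  proof -
    have "(LINT b:B|lborel. c) = c * m"
      unfolding set_lebesgue_integral_def using B mm by simp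
    then show ?thesis
      using m by (simp add: avg_def mm set_integral_diff(2)[OF ci g] field_simps)
  qed
  then have "ennreal \<bar>c - avg g B\<bar> = ennreal (1 / m) * ennreal \<bar>LINT b:B|lborel. c - g b\<bar>"
    using m by (simp add: abs_mult ennreal_mult'[symmetric])
  also have "ennreal \<bar>LINT b:B|lborel. c - g b\<bar> \<le> (\<integral>\<^sup>+b. ennreal (norm (indicator B b *\<^sub>R (c - g b))) \<partial>lborel)"
    using integral_norm_bound_ennreal[OF i[unfolded set_integrable_def]]
    by (simp add: set_lebesgue_integral_def)
  also have "\<dots> = (\<integral>\<^sup>+b\<in>B. ennreal \<bar>c - g b\<bar> \<partial>lborel)"
    by (intro nn_integral_cong) (auto simp: indicator_def)
  finally show ?thesis by (simp add: mult_left_mono)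
qed

lemma avg_avg_le:
  fixes g :: "'a::euclidean_space \<Rightarrow> real"
  assumes gm [measurable]: "g \<in> borel_measurable borel"
    and A: "set_integrable lborel A g" "A \<in> sets borel" "emeasure lborel A = ennreal m" "0 < m"
    and B: "set_integrable lborel B g" "B \<in> sets borel" "emeasure lborel B = ennreal l" "0 < l"
  shows "ennreal \<bar>avg g A - avg g B\<bar> \<le>
    ennreal (1 / (m * l)) * (\<integral>\<^sup>+a\<in>A. (\<integral>\<^sup>+b\<in>B. ennreal \<bar>g a - g b\<bar> \<partial>lborel) \<partial>lborel)"
proof -
  have [measurable]: "A \<in> sets borel" "B \<in> sets borel" using A B by auto
  have "ennreal \<bar>avg g B - avg g A\<bar> \<le> ennreal (1 / m) * (\<integral>\<^sup>+a\<in>A. ennreal \<bar>avg g B - g a\<bar> \<partial>lborel)"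
    by (rule avg_dist_le) (use A in auto)
  also have "\<dots> \<le> ennreal (1 / m) * (\<integral>\<^sup>+a\<in>A. ennreal (1 / l) * (\<integral>\<^sup>+b\<in>B. ennreal \<bar>g a - g b\<bar> \<partial>lborel) \<partial>lborel)"
  proof (intro mult_left_mono nn_integral_mono mult_right_mono)
    fix a
    have "ennreal \<bar>g a - avg g B\<bar> \<le> ennreal (1 / l) * (\<integral>\<^sup>+b\<in>B. ennreal \<bar>g a - g b\<bar> \<partial>lborel)"
      by (rule avg_dist_le) (use B in auto)
    then show "ennreal \<bar>avg g B - g a\<bar> \<le> ennreal (1 / l) * (\<integral>\<^sup>+b\<in>B. ennreal \<bar>g a - g b\<bar> \<partial>lborel)"
      by (simp add: abs_minus_commute)
  qed auto
  also have "\<dots> = ennreal (1 / (m * l)) * (\<integral>\<^sup>+a\<in>A. (\<integral>\<^sup>+b\<in>B. ennreal \<bar>g a - g b\<bar> \<partial>lborel) \<partial>lborel)"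
    using A B by (simp add: nn_integral_cmult mult.assoc)
      (simp add: mult.assoc[symmetric] ennreal_mult'[symmetric])
  finally show ?thesis by (simp add: abs_minus_commute)
qed

lemma avg_osc_le:
  fixes f :: "'a::euclidean_space \<Rightarrow> real"
  assumes [measurable]: "f \<in> borel_measurable borel" and i: "set_integrable lborel (dcube i x) f"
  shows "ennreal (2 powr (real i * real DIM('a))) *
    (\<integral>\<^sup>+b\<in>dcube i x. ennreal \<bar>avg f (dcube i x) - f b\<bar> \<partial>lborel) \<le> mean_osc i f x"
proof -
  let ?t = "2 powr (real i * real DIM('a))"
  have "(\<integral>\<^sup>+b\<in>dcube i x. ennreal \<bar>avg f (dcube i x) - f b\<bar> \<partial>lborel) \<le>
    (\<integral>\<^sup>+b. ennreal ?t * ((\<integral>\<^sup>+a\<in>nbhd i b. ennreal \<bar>f b - f a\<bar> \<partial>lborel) * indicator (dcube i x) b) \<partial>lborel)"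
  proof (intro nn_integral_mono)
    fix b
    show "ennreal \<bar>avg f (dcube i x) - f b\<bar> * indicator (dcube i x) b \<le>
      ennreal ?t * ((\<integral>\<^sup>+a\<in>nbhd i b. ennreal \<bar>f b - f a\<bar> \<partial>lborel) * indicator (dcube i x) b)"
    proof (cases "b \<in> dcube i x")
      case True
      have "ennreal \<bar>f b - avg f (dcube i x)\<bar> \<le> ennreal (1 / 2 powr (- (real i * real DIM('a)))) *
          (\<integral>\<^sup>+a\<in>dcube i x. ennreal \<bar>f b - f a\<bar> \<partial>lborel)"
        by (rule avg_dist_le[OF i]) (auto simp: emeasure_dcube)
      also have "\<dots> \<le> ennreal ?t * (\<integral>\<^sup>+a\<in>nbhd i b. ennreal \<bar>f b - f a\<bar> \<partial>lborel)"
        using dcube_subset_nbhd[OF True]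
        by (intro mult_mono nn_integral_mono) (auto simp: powr_minus field_simps indicator_def)
      finally show ?thesis using True by (simp add: abs_minus_commute)
    qed simp
  qed
  also have "\<dots> = ennreal ?t * (\<integral>\<^sup>+b\<in>dcube i x. (\<integral>\<^sup>+a\<in>nbhd i b. ennreal \<bar>f b - f a\<bar> \<partial>lborel) \<partial>lborel)"
    by (rule nn_integral_cmult) measurable
  finally have "ennreal ?t * (\<integral>\<^sup>+b\<in>dcube i x. ennreal \<bar>avg f (dcube i x) - f b\<bar> \<partial>lborel) \<le> ennreal ?t * \<dots>"
    by (rule mult_left_mono) simp
  also have "\<dots> = mean_osc i f x"
    unfolding mean_osc_def
    by (simp add: mult.assoc[symmetric] ennreal_mult'[symmetric] powr_add[symmetric])
  finally show ?thesis .
qed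

text \<open>Ball and cube have comparable volume: \<open>r \<ge> 2^(-i - 1)\<close> gives the ball
  at least \<open>\<omega> 2^(-n) 2^(-i n)\<close>, with \<open>\<omega>\<close> the volume of the
  unit ball. Hence the constant \<open>2^n / \<omega>\<close>.\<close>

lemma avg_ball_dcube_le:
  fixes f :: "'a::euclidean_space \<Rightarrow> real"
  assumes [measurable]: "f \<in> borel_measurable borel" and i: "set_integrable lborel (dcube i x) f"
    "set_integrable lborel (ball x r) f" and r: "(1/2)^Suc i \<le> r" "r \<le> (1/2)^i"
  shows "ennreal \<bar>avg f (ball x r) - avg f (dcube i x)\<bar> \<le>
    ennreal (2^DIM('a) / unit_ball_vol DIM('a)) * mean_osc i f x"
proof -
  let ?n = "real DIM('a)" and ?\<omega> = "unit_ball_vol (real DIM('a))"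
  have r0: "0 < r" using r(1) by (rule less_le_trans[rotated]) simp
  have "ennreal \<bar>avg f (dcube i x) - avg f (ball x r)\<bar> \<le>
    ennreal (1 / (2 powr (- (real i * ?n)) * (?\<omega> * r^DIM('a)))) *
      (\<integral>\<^sup>+a\<in>dcube i x. (\<integral>\<^sup>+b\<in>ball x r. ennreal \<bar>f a - f b\<bar> \<partial>lborel) \<partial>lborel)"
    by (rule avg_avg_le) (use i r0 in \<open>auto simp: emeasure_dcube emeasure_ball\<close>)
  also have "\<dots> \<le> ennreal (2^DIM('a) / ?\<omega> * 2 powr (2 * real i * ?n)) *
      (\<integral>\<^sup>+a\<in>dcube i x. (\<integral>\<^sup>+b\<in>nbhd i a. ennreal \<bar>f a - f b\<bar> \<partial>lborel) \<partial>lborel)"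
  proof (rule mult_mono[OF ennreal_leI nn_integral_mono])
    have "((1/2)^Suc i)^DIM('a) \<le> r^DIM('a)" using r by (intro power_mono) auto
    moreover have "((1/2::real)^Suc i)^DIM('a) = ((1/2)^i)^DIM('a) / 2^DIM('a)"
      by (simp add: power_mult_distrib power_one_over)
    ultimately have "2 powr (- (real i * ?n)) / 2^DIM('a) \<le> r^DIM('a)"
      by (simp only: half_power_powr)
    then have "?\<omega> * (2 powr (- (real i * ?n)) * (2 powr (- (real i * ?n)) / 2^DIM('a))) \<le> ?\<omega> * (2 powr (- (real i * ?n)) * r^DIM('a))"
      by (intro mult_left_mono) auto
    moreover have "2 powr (- (real i * ?n)) * 2 powr (- (real i * ?n)) = 1 / 2 powr (2 * real i * ?n)"
      by (simp add: powr_add[symmetric] powr_minus[symmetric] divide_inverse mult.assoc)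
    ultimately have "?\<omega> / (2^DIM('a) * 2 powr (2 * real i * ?n)) \<le> 2 powr (- (real i * ?n)) * (?\<omega> * r^DIM('a))"
      by (simp add: mult_ac)
    then have "1 / (2 powr (- (real i * ?n)) * (?\<omega> * r^DIM('a))) \<le> 1 / (?\<omega> / (2^DIM('a) * 2 powr (2 * real i * ?n)))"
      by (rule divide_left_mono) (use r0 in auto)
    then show "1 / (2 powr (- (real i * ?n)) * (?\<omega> * r^DIM('a))) \<le> 2^DIM('a) / ?\<omega> * 2 powr (2 * real i * ?n)"
      by simp
    show "(\<integral>\<^sup>+b\<in>ball x r. ennreal \<bar>f a - f b\<bar> \<partial>lborel) * indicator (dcube i x) a
      \<le> (\<integral>\<^sup>+b\<in>nbhd i a. ennreal \<bar>f a - f b\<bar> \<partial>lborel) * indicator (dcube i x) a" for a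
    proof (cases "a \<in> dcube i x")
      case True
      show ?thesis using ball_subset_nbhd[OF True r(2)]
        by (intro mult_right_mono nn_integral_mono) (auto simp: indicator_def)
    qed simp
  qed auto
  also have "\<dots> = ennreal (2^DIM('a) / ?\<omega>) * mean_osc i f x"
    unfolding mean_osc_def by (simp add: mult.assoc[symmetric] ennreal_mult'[symmetric])
  finally show ?thesis by (simp add: abs_minus_commute)
qed

section \<open>Chaining averages through nested cubes\<close>

text \<open>Differences are split at a free size \<open>\<kappa>\<close>, to be chosen level by
  level. The \<open>\<kappa>\<close> term keeps the smaller cube as its domain and so returns
  exactly \<open>\<kappa>\<close>; only the \<open>p\<close>-th powers are enlarged to
  \<open>nbhd i a\<close>. The factor \<open>2^n\<close> is the volume ratio of the two
  cubes.\<close>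

lemma avg_dcube_step:
  fixes g :: "'a::euclidean_space \<Rightarrow> real"
  assumes gm [measurable]: "g \<in> borel_measurable borel" and i: "set_integrable lborel (dcube i x) g"
    and \<kappa>: "0 < \<kappa>" and p: "1 \<le> p"
  shows "ennreal \<bar>avg g (dcube (Suc i) x) - avg g (dcube i x)\<bar> \<le>
    ennreal \<kappa> + ennreal (2^DIM('a) * \<kappa> powr (1 - p)) * power_osc p i g x"
proof -
  let ?n = "real DIM('a)"
  define m where "m = 2 powr (- (real i * ?n))"
  define l where "l = 2 powr (- (real (Suc i) * ?n))"
  have ml: "0 < m" "0 < l" by (auto simp: m_def l_def)
  have i': "set_integrable lborel (dcube (Suc i) x) g"
    by (rule set_integrable_subset[OF i]) (use dcube_Suc in auto)
  have "ennreal \<bar>avg g (dcube i x) - avg g (dcube (Suc i) x)\<bar> \<le>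
    ennreal (1 / (m * l)) * (\<integral>\<^sup>+a\<in>dcube i x. (\<integral>\<^sup>+b\<in>dcube (Suc i) x. ennreal \<bar>g a - g b\<bar> \<partial>lborel) \<partial>lborel)"
    by (rule avg_avg_le) (use i i' in \<open>auto simp: emeasure_dcube m_def l_def\<close>)
  also have "\<dots> \<le> ennreal (1 / (m * l)) * (\<integral>\<^sup>+a. ennreal (\<kappa> * l) * indicator (dcube i x) a +
     ennreal (\<kappa> powr (1 - p)) * ((\<integral>\<^sup>+b\<in>nbhd i a. ennreal (\<bar>g a - g b\<bar> powr p) \<partial>lborel) * indicator (dcube i x) a) \<partial>lborel)"
  proof (intro mult_left_mono nn_integral_mono)
    fix a
    show "(\<integral>\<^sup>+b\<in>dcube (Suc i) x. ennreal \<bar>g a - g b\<bar> \<partial>lborel) * indicator (dcube i x) a \<le>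
      ennreal (\<kappa> * l) * indicator (dcube i x) a +
     ennreal (\<kappa> powr (1 - p)) * ((\<integral>\<^sup>+b\<in>nbhd i a. ennreal (\<bar>g a - g b\<bar> powr p) \<partial>lborel) * indicator (dcube i x) a)"
    proof (cases "a \<in> dcube i x")
      case True
      have sub: "dcube (Suc i) x \<subseteq> nbhd i a" using dcube_Suc dcube_subset_nbhd[OF True] by blast
      have "(\<integral>\<^sup>+b\<in>dcube (Suc i) x. ennreal \<bar>g a - g b\<bar> \<partial>lborel) \<le>
        (\<integral>\<^sup>+b. ennreal \<kappa> * indicator (dcube (Suc i) x) b + ennreal (\<kappa> powr (1 - p)) * (ennreal (\<bar>g a - g b\<bar> powr p) * indicator (nbhd i a) b) \<partial>lborel)"
      proof (intro nn_integral_mono)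
        fix b
        show "ennreal \<bar>g a - g b\<bar> * indicator (dcube (Suc i) x) b \<le>
          ennreal \<kappa> * indicator (dcube (Suc i) x) b + ennreal (\<kappa> powr (1 - p)) * (ennreal (\<bar>g a - g b\<bar> powr p) * indicator (nbhd i a) b)"
          using sub \<kappa> le_plus_powr[OF _ \<kappa> p, of "\<bar>g a - g b\<bar>"]
          by (cases "b \<in> dcube (Suc i) x")
             (auto simp: indicator_def ennreal_mult'[symmetric] ennreal_plus[symmetric] simp del: ennreal_plus intro!: ennreal_leI)
      qed
      also have "\<dots> = ennreal \<kappa> * emeasure lborel (dcube (Suc i) x) + ennreal (\<kappa> powr (1 - p)) * (\<integral>\<^sup>+b\<in>nbhd i a. ennreal (\<bar>g a - g b\<bar> powr p) \<partial>lborel)"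
        by (simp add: nn_integral_add nn_integral_cmult)
      also have "ennreal \<kappa> * emeasure lborel (dcube (Suc i) x) = ennreal (\<kappa> * l)"
        using \<kappa> by (simp add: emeasure_dcube l_def ennreal_mult'[symmetric])
      finally show ?thesis using True by simp
    qed simp
  qed auto
  also have "\<dots> = ennreal (1 / (m * l)) * (ennreal (\<kappa> * l) * emeasure lborel (dcube i x) +
     ennreal (\<kappa> powr (1 - p)) * (\<integral>\<^sup>+a\<in>dcube i x. (\<integral>\<^sup>+b\<in>nbhd i a. ennreal (\<bar>g a - g b\<bar> powr p) \<partial>lborel) \<partial>lborel))"
    by (simp add: nn_integral_add nn_integral_cmult)
  also have "\<dots> = ennreal (1 / (m * l)) * ennreal (\<kappa> * l * m) +
     ennreal (1 / (m * l) * \<kappa> powr (1 - p)) * (\<integral>\<^sup>+a\<in>dcube i x. (\<integral>\<^sup>+b\<in>nbhd i a. ennreal (\<bar>g a - g b\<bar> powr p) \<partial>lborel) \<partial>lborel)"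
    using ml \<kappa> unfolding distrib_left
    by (simp add: emeasure_dcube m_def[symmetric] ennreal_mult'[symmetric] flip: mult.assoc)
  also have "ennreal (1 / (m * l)) * ennreal (\<kappa> * l * m) = ennreal \<kappa>"
    using ml \<kappa> by (simp add: ennreal_mult'[symmetric])
  also have "1 / (m * l) = 2^DIM('a) * 2 powr (2 * real i * ?n)"
  proof -
    have "l = m / 2^DIM('a)"
    proof -
      have "- (real (Suc i) * ?n) = - (real i * ?n) - ?n" by (simp add: algebra_simps)
      then show ?thesis unfolding l_def m_def by (simp only: powr_diff) (simp add: powr_realpow)
    qed
    moreover have "m * m = 1 / 2 powr (2 * real i * ?n)"
      by (simp add: m_def powr_add[symmetric] powr_minus[symmetric] divide_inverse mult.assoc)
    ultimately show ?thesis by simp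
  qed
  also have "ennreal (2^DIM('a) * 2 powr (2 * real i * ?n) * \<kappa> powr (1 - p)) * (\<integral>\<^sup>+a\<in>dcube i x. (\<integral>\<^sup>+b\<in>nbhd i a. ennreal (\<bar>g a - g b\<bar> powr p) \<partial>lborel) \<partial>lborel)
     = ennreal (2^DIM('a) * \<kappa> powr (1 - p)) * power_osc p i g x"
  proof -
    have "ennreal (2^DIM('a) * 2 powr (2 * real i * ?n) * \<kappa> powr (1 - p)) = ennreal (2^DIM('a) * \<kappa> powr (1 - p)) * ennreal (2 powr (2 * real i * ?n))"
      by (simp add: ennreal_mult''[symmetric] mult_ac)
    then show ?thesis unfolding power_osc_def by (simp only: mult.assoc)
  qed
  finally show ?thesis by (simp add: abs_minus_commute)
qed

lemma avg_dcube_chain: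
  fixes g :: "'a::euclidean_space \<Rightarrow> real"
  assumes gm: "g \<in> borel_measurable borel" and i: "set_integrable lborel (dcube k x) g"
    and \<kappa>: "\<And>j. 0 < \<kappa> j" and p: "1 \<le> p"
  shows "ennreal \<bar>avg g (dcube (k + m) x) - avg g (dcube k x)\<bar> \<le>
    (\<Sum>j<m. ennreal (\<kappa> j) + ennreal (2^DIM('a) * \<kappa> j powr (1 - p)) * power_osc p (k + j) g x)"
proof (induction m)
  case (Suc m)
  have i': "set_integrable lborel (dcube (k + m) x) g"
    by (rule set_integrable_subset[OF i]) (use dcube_antimono[of k "k + m"] in auto)
  have "ennreal \<bar>avg g (dcube (k + Suc m) x) - avg g (dcube k x)\<bar> \<le>
    ennreal \<bar>avg g (dcube (k + m) x) - avg g (dcube k x)\<bar> + ennreal \<bar>avg g (dcube (Suc (k + m)) x) - avg g (dcube (k + m) x)\<bar>"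
    unfolding ennreal_plus[OF abs_ge_zero abs_ge_zero, symmetric] by (rule ennreal_leI) simp
  also have "\<dots> \<le> (\<Sum>j<m. ennreal (\<kappa> j) + ennreal (2^DIM('a) * \<kappa> j powr (1 - p)) * power_osc p (k + j) g x) +
     (ennreal (\<kappa> m) + ennreal (2^DIM('a) * \<kappa> m powr (1 - p)) * power_osc p (k + m) g x)"
    by (intro add_mono Suc avg_dcube_step gm i' \<kappa> p)
  finally show ?case by simp
qed simp

text \<open>The factor \<open>2^n\<close> comes from one step of the chain,
  \<open>(1 - 2 powr (- s)) / 8\<close> normalises the geometric error budget, and \<open>4\<close>
  belongs to the part \<open>d / 4\<close> of the jump that the budget leaves.\<close>

definition chain_const :: "nat \<Rightarrow> real \<Rightarrow> real \<Rightarrow> real" where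
  "chain_const n s p = 4 * 2^n * ((1 - 2 powr (- s)) / 8) powr (1 - p)"

text \<open>The budget \<open>\<kappa> j\<close> decays like \<open>2^(-s j)\<close> and adds up to
  at most \<open>d / 8\<close>, so at least \<open>d / 4\<close> of the jump is due to
  \<open>p\<close>-th power oscillations. The price \<open>\<kappa> j powr (1 - p)\<close> grows
  like \<open>2^(s (p - 1) j)\<close>, exactly the weight in
  \<open>hausdorff_premeasure_frac_energy\<close>.\<close>

lemma avg_dcube_jump:
  fixes g :: "'a::euclidean_space \<Rightarrow> real"
  assumes gm: "g \<in> borel_measurable borel" and i: "set_integrable lborel (dcube k x) g"
    and s: "0 < s" and p: "1 \<le> p" and d: "0 < d"
    and jump: "3 * d / 8 \<le> \<bar>avg g (dcube (k + m) x) - avg g (dcube k x)\<bar>"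
  shows "1 \<le> (\<Sum>j. ennreal (chain_const DIM('a) s p * d powr (- p) * 2 powr (s * (p - 1) * real j)) * power_osc p (k + j) g x)"
proof -
  define \<theta> where "\<theta> = 2 powr (- s)"
  have \<theta>: "0 < \<theta>" "\<theta> < 1" using s powr_less_mono[of "-s" 0 2] by (auto simp: \<theta>_def)
  define c where "c = (1 - \<theta>) / 8"
  have c: "0 < c" using \<theta> by (simp add: c_def)
  define \<kappa> where "\<kappa> j = d * c * \<theta>^j" for j
  have \<kappa>: "0 < \<kappa> j" for j using d c \<theta> by (simp add: \<kappa>_def)
  have \<kappa>sum: "(\<Sum>j<m. \<kappa> j) \<le> d / 8"
  proof -
    have "(\<Sum>j<m. \<kappa> j) = (d * c) * (\<Sum>j<m. \<theta>^j)"
      by (simp add: \<kappa>_def sum_distrib_left)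
    also have "\<dots> = d / 8 * ((1 - \<theta>) * (\<Sum>j<m. \<theta>^j))"
      by (simp add: c_def)
    also have "\<dots> = d / 8 * (1 - \<theta>^m)" by (simp add: one_diff_power_eq)
    also have "\<dots> \<le> d / 8 * 1" using \<theta> d by (intro mult_left_mono) auto
    finally show ?thesis by simp
  qed
  define P where "P = (\<Sum>j. ennreal (2^DIM('a) * \<kappa> j powr (1 - p)) * power_osc p (k + j) g x)"
  have "ennreal (d / 8) + ennreal (d / 4) = ennreal (3 * d / 8)"
    using d by (simp add: field_simps flip: ennreal_plus)
  also have "\<dots> \<le> ennreal \<bar>avg g (dcube (k + m) x) - avg g (dcube k x)\<bar>"
    using jump by (rule ennreal_leI)
  also have "\<dots> \<le> (\<Sum>j<m. ennreal (\<kappa> j) + ennreal (2^DIM('a) * \<kappa> j powr (1 - p)) * power_osc p (k + j) g x)"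
    by (rule avg_dcube_chain[OF gm i \<kappa> p])
  also have "\<dots> = ennreal (\<Sum>j<m. \<kappa> j) + (\<Sum>j<m. ennreal (2^DIM('a) * \<kappa> j powr (1 - p)) * power_osc p (k + j) g x)"
    using \<kappa> by (simp add: sum.distrib sum_ennreal less_imp_le)
  also have "\<dots> \<le> ennreal (d / 8) + P"
    unfolding P_def by (intro add_mono ennreal_leI \<kappa>sum sum_le_suminf) auto
  finally have "ennreal (d / 4) \<le> P"
    by (simp add: ennreal_add_left_cancel_le)
  then have "ennreal (4 / d) * ennreal (d / 4) \<le> ennreal (4 / d) * P" by (rule mult_left_mono) simp
  moreover have "ennreal (4 / d) * ennreal (d / 4) = 1"
    using d by (simp add: ennreal_mult'[symmetric])
  moreover have "ennreal (4 / d) * P = (\<Sum>j. ennreal (chain_const DIM('a) s p * d powr (- p) * 2 powr (s * (p - 1) * real j)) * power_osc p (k + j) g x)"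
    unfolding P_def ennreal_suminf_cmult[symmetric]
  proof (intro arg_cong[where f = suminf] ext)
    fix j
    have "\<kappa> j powr (1 - p) = d powr (1 - p) * c powr (1 - p) * 2 powr (s * (p - 1) * real j)"
      using d c by (simp add: \<kappa>_def \<theta>_def powr_mult powr_realpow[symmetric] powr_powr algebra_simps)
    moreover have "d powr (1 - p) = d * d powr (- p)" using d by (simp add: powr_diff powr_minus field_simps)
    ultimately have "4 / d * (2^DIM('a) * \<kappa> j powr (1 - p)) = chain_const DIM('a) s p * d powr (- p) * 2 powr (s * (p - 1) * real j)"
      using d by (simp add: chain_const_def c_def \<theta>_def)
    then show "ennreal (4 / d) * (ennreal (2^DIM('a) * \<kappa> j powr (1 - p)) * power_osc p (k + j) g x) =
      ennreal (chain_const DIM('a) s p * d powr (- p) * 2 powr (s * (p - 1) * real j)) * power_osc p (k + j) g x"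
      using d by (simp add: mult.assoc[symmetric] ennreal_mult'[symmetric])
  qed
  ultimately show ?thesis by simp
qed

text \<open>
  Keeping only the part of the function between height \<open>d/2\<close> and \<open>d\<close> (Maz'ya's truncation)
  is what makes the energies of the different heights summable.
\<close>

definition trunc :: "real \<Rightarrow> real \<Rightarrow> real" where
  "trunc d t = min (max (t - d / 2) 0) (d / 2)"

lemma trunc_measurable [measurable (raw)]:
  assumes [measurable]: "d \<in> borel_measurable M" "t \<in> borel_measurable M"
  shows "(\<lambda>x. trunc (d x) (t x)) \<in> borel_measurable M"
  unfolding trunc_def by measurable

lemma trunc_diff_le: "\<bar>trunc d t - trunc d u\<bar> \<le> \<bar>t - u\<bar>"
  unfolding trunc_def by linarith

lemma trunc_bounds: "0 \<le> d \<Longrightarrow> 0 \<le> trunc d t" "trunc d t \<le> d / 2"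
  unfolding trunc_def by linarith+

text \<open>The truncation of \<open>f - v\<close> has average near \<open>0\<close> at level
  \<open>k\<close>, where \<open>f\<close> averages to \<open>v\<close>. The upper limit supplies
  small balls on which \<open>f\<close> averages nearly \<open>y\<close> or more, hence fine cubes
  on which the truncation averages almost \<open>d / 2\<close>. Oscillation of the truncated
  function along the chain must account for the difference.\<close>

lemma level_point_chain:
  fixes f :: "'a::euclidean_space \<Rightarrow> real"
  assumes fm [measurable]: "f \<in> borel_measurable borel" and s: "0 < s" and p: "1 \<le> p"
    and int: "set_integrable lborel (nbhd k x) f"
    and osc: "(\<lambda>i. mean_osc i f x) \<longlonglongrightarrow> 0"
    and lim: "ereal y \<le> Limsup (at_right 0) (\<lambda>r. ereal (avg f (ball x r)))"
    and v: "v = avg f (dcube k x)" and d: "d = y - v" "0 < d"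
    and small: "mean_osc k f x \<le> ennreal (d / 16)"
  shows "1 \<le> (\<Sum>j. ennreal (chain_const DIM('a) s p * d powr (- p) * 2 powr (s * (p - 1) * real j)) *
    power_osc p (k + j) (\<lambda>z. trunc d (f z - v)) x)"
proof -
  let ?n = "real DIM('a)"
  define g where "g z = trunc d (f z - v)" for z
  have gm [measurable]: "g \<in> borel_measurable borel" unfolding g_def by measurable
  have fi: "set_integrable lborel (dcube (k + j) x) f" for j
    by (rule set_integrable_subset[OF int])
       (use dcube_antimono[of k "k + j" x] dcube_subset_nbhd[OF dcube_self, of k x] in auto)
  have gi: "set_integrable lborel (dcube (k + j) x) g" for j
    unfolding set_integrable_def
  proof (rule Bochner_Integration.integrable_bound[where f = "\<lambda>z. indicator (dcube (k + j) x) z * (d / 2)"])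
    show "integrable lborel (\<lambda>z. indicator (dcube (k + j) x) z * (d / 2))"
      by (intro integrable_mult_left integrable_real_indicator) (auto simp: emeasure_dcube)
  qed (use d trunc_bounds[of d] in \<open>auto simp: g_def indicator_def intro!: AE_I2 abs_leI order_trans[OF _ trunc_bounds(1)]\<close>)
  \<comment> \<open>Truncation is 1-Lipschitz, so truncating the average and averaging the
    truncation differ by at most the mean oscillation.\<close>
  have gavg: "ennreal \<bar>trunc d (avg f (dcube (k + j) x) - v) - avg g (dcube (k + j) x)\<bar> \<le> mean_osc (k + j) f x" for j
  proof -
    have "ennreal \<bar>trunc d (avg f (dcube (k + j) x) - v) - avg g (dcube (k + j) x)\<bar> \<le>
      ennreal (1 / 2 powr (- (real (k + j) * ?n))) * (\<integral>\<^sup>+b\<in>dcube (k + j) x. ennreal \<bar>trunc d (avg f (dcube (k + j) x) - v) - g b\<bar> \<partial>lborel)"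
      by (rule avg_dist_le[OF gi]) (auto simp: emeasure_dcube)
    also have "\<dots> \<le> ennreal (2 powr (real (k + j) * ?n)) * (\<integral>\<^sup>+b\<in>dcube (k + j) x. ennreal \<bar>avg f (dcube (k + j) x) - f b\<bar> \<partial>lborel)"
      unfolding g_def
      by (intro mult_mono nn_integral_mono mult_right_mono ennreal_leI order_trans[OF trunc_diff_le])
         (auto simp: powr_minus divide_inverse)
    also have "\<dots> \<le> mean_osc (k + j) f x" by (rule avg_osc_le[OF fm fi])
    finally show ?thesis .
  qed
  have low: "\<bar>avg g (dcube k x)\<bar> \<le> d / 16"
  proof -
    have "trunc d (avg f (dcube (k + 0) x) - v) = 0" using d by (simp add: v trunc_def)
    then have "ennreal \<bar>avg g (dcube k x)\<bar> \<le> mean_osc k f x" using gavg[of 0] by simp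
    then have "ennreal \<bar>avg g (dcube k x)\<bar> \<le> ennreal (d / 16)" using small by (rule order_trans)
    then show ?thesis using d by (simp add: ennreal_le_iff)
  qed
  define c where "c = 2^DIM('a) / unit_ball_vol ?n"
  have c: "0 < c" by (simp add: c_def)
  \<comment> \<open>Small enough for two errors of \<open>d / 48\<close>: the mean oscillation
    itself, and the comparison of ball and cube, which carries the factor \<open>c\<close>.\<close>
  define e where "e = d / 48 / (1 + c)"
  have e: "0 < e" "e \<le> d / 48" "c * e \<le> d / 48" using c d by (auto simp: e_def field_simps)
  have "\<forall>\<^sub>F i in sequentially. mean_osc i f x < ennreal e"
    by (rule order_tendstoD(2)[OF osc]) (use e in simp)
  then obtain i0 where i0: "\<And>i. i0 \<le> i \<Longrightarrow> mean_osc i f x < ennreal e"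
    unfolding eventually_sequentially by blast
  define i1 where "i1 = max i0 k"
  \<comment> \<open>Only a strict inequality passes from the upper limit to arbitrarily small radii;
    this costs \<open>d / 48\<close>.\<close>
  have "ereal (y - d / 48) < Limsup (at_right 0) (\<lambda>r. ereal (avg f (ball x r)))"
    by (rule less_le_trans[OF _ lim]) (use d in simp)
  then have "\<exists>\<^sub>F r in at_right 0. ereal (y - d / 48) < ereal (avg f (ball x r))"
  proof (rule contrapos_pp)
    assume "\<not> (\<exists>\<^sub>F r in at_right 0. ereal (y - d / 48) < ereal (avg f (ball x r)))"
    then have "\<forall>\<^sub>F r in at_right 0. ereal (avg f (ball x r)) \<le> ereal (y - d / 48)"
      by (simp only: not_frequently not_less)
    then have "Limsup (at_right 0) (\<lambda>r. ereal (avg f (ball x r))) \<le> ereal (y - d / 48)"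
      by (rule Limsup_bounded)
    then show "\<not> ereal (y - d / 48) < Limsup (at_right 0) (\<lambda>r. ereal (avg f (ball x r)))"
      by (simp only: not_less)
  qed
  moreover have "\<forall>\<^sub>F r in at_right (0::real). r \<in> {0<..<(1/2)^i1}"
    by (rule eventually_at_right_real) simp
  ultimately have "\<exists>\<^sub>F r in at_right 0. ereal (y - d / 48) < ereal (avg f (ball x r)) \<and> r \<in> {0<..<(1/2)^i1}"
    by (rule frequently_eventually_frequently)
  then obtain r where r: "y - d / 48 < avg f (ball x r)" "0 < r" "r < (1/2)^i1"
    by (auto dest: frequently_ex)
  \<comment> \<open>The dyadic level of \<open>r\<close>. Since \<open>r < 2^(-i1)\<close>, it is at
    least \<open>i1\<close>, hence at least \<open>k\<close> and far enough along for the mean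
    oscillation to be below \<open>e\<close>.\<close>
  obtain j where j: "i1 \<le> k + j" "(1/2)^Suc (k + j) \<le> r" "r \<le> (1/2)^(k + j)"
  proof -
    have ex: "\<exists>N. (1/2)^N < r" using real_arch_pow_inv[of r "1/2"] r by auto
    define N where "N = (LEAST N. (1/2)^N < r)"
    have N: "(1/2)^N < r" "\<And>N'. N' < N \<Longrightarrow> \<not> (1/2)^N' < r"
      using LeastI_ex[OF ex] not_less_Least[of _ "\<lambda>N. (1/2)^N < r"] unfolding N_def by blast+
    have "i1 < N"
    proof (rule ccontr)
      assume "\<not> i1 < N"
      then have "(1/2::real)^i1 \<le> (1/2)^N" by (intro power_decreasing) auto
      with N r show False by simp
    qed
    then obtain i where i: "N = Suc i" "i1 \<le> i" by (cases N) auto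
    moreover have "k \<le> i" using i by (simp add: i1_def)
    ultimately show thesis using that[of "i - k"] N(1) N(2)[of i] by simp
  qed
  have bi: "set_integrable lborel (ball x r) f"
  proof (rule set_integrable_subset[OF int])
    have "(1/2::real)^(k + j) \<le> (1/2)^k" by (intro power_decreasing) auto
    with j(3) have "r \<le> (1/2)^k" by (rule order_trans)
    then show "ball x r \<subseteq> nbhd k x" by (intro ball_subset_nbhd) auto
  qed auto
  have oj: "mean_osc (k + j) f x \<le> ennreal e" using i0[of "k + j"] j by (simp add: i1_def)
  have fj: "\<bar>avg f (ball x r) - avg f (dcube (k + j) x)\<bar> \<le> d / 48"
  proof -
    have "ennreal \<bar>avg f (ball x r) - avg f (dcube (k + j) x)\<bar> \<le> ennreal c * mean_osc (k + j) f x"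
      unfolding c_def by (rule avg_ball_dcube_le[OF fm fi bi j(2,3)])
    also have "\<dots> \<le> ennreal c * ennreal e" by (intro mult_left_mono oj) simp
    also have "\<dots> = ennreal (c * e)" using c by (simp add: ennreal_mult')
    also have "\<dots> \<le> ennreal (d / 48)" by (intro ennreal_leI e)
    finally show ?thesis using d by (simp add: ennreal_le_iff)
  qed
  have gj: "\<bar>trunc d (avg f (dcube (k + j) x) - v) - avg g (dcube (k + j) x)\<bar> \<le> d / 48"
  proof -
    have "ennreal \<bar>trunc d (avg f (dcube (k + j) x) - v) - avg g (dcube (k + j) x)\<bar> \<le> ennreal (d / 48)"
      using order_trans[OF gavg order_trans[OF oj ennreal_leI[OF e(2)]]] .
    then show ?thesis using d by (simp add: ennreal_le_iff)
  qed
  have "d / 2 - d / 24 \<le> trunc d (avg f (dcube (k + j) x) - v)"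
  proof -
    have "d - d / 24 \<le> avg f (dcube (k + j) x) - v" using fj r(1) d(1) by argo
    then show ?thesis unfolding trunc_def using d(2) by linarith
  qed
  \<comment> \<open>In units of \<open>d / 48\<close>: the truncated value is at least
    \<open>24 - 2\<close>, the errors at the two ends are at most \<open>1\<close> and
    \<open>3\<close>, and the remaining \<open>18\<close> units are \<open>3 d / 8\<close>.\<close>
  with gj low have "3 * d / 8 \<le> \<bar>avg g (dcube (k + j) x) - avg g (dcube k x)\<bar>"
    using d by linarith
  from avg_dcube_jump[OF gm gi[of 0, simplified] s p d(2) this]
  show ?thesis by (simp add: g_def[abs_def])
qed

section \<open>Integration over the levels\<close>

lemma avg_dcube_measurable [measurable]:
  assumes [measurable]: "f \<in> borel_measurable borel"
  shows "(\<lambda>a. avg f (dcube k a)) \<in> borel_measurable borel"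
  unfolding avg_def measure_dcube set_lebesgue_integral_def by measurable

lemma avg_dcube_cong: "a \<in> dcube k x \<Longrightarrow> avg f (dcube k a) = avg f (dcube k x)"
  by (simp add: dcube_eq)

definition trunc_kernel :: "real \<Rightarrow> real \<Rightarrow> real \<Rightarrow> real \<Rightarrow> real \<Rightarrow> real \<Rightarrow> real" where
  "trunc_kernel p h d v t u =
    (if h < d then d powr (- p) * \<bar>trunc d (t - v) - trunc d (u - v)\<bar> powr p else 0)"

text \<open>Both values are truncated relative to the average over the cube of \<open>a\<close>. No
  particular point of the level set is involved any more, so the expression can be integrated over
  \<open>y\<close>. The factor \<open>chain_const\<close> lets the fractional cover reach
  \<open>1\<close>.\<close>

definition trunc_energy ::
  "real \<Rightarrow> real \<Rightarrow> 'a::euclidean_space set \<Rightarrow> ('a \<Rightarrow> real) \<Rightarrow> nat \<Rightarrow> real \<Rightarrow> real \<Rightarrow> ennreal" where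
  "trunc_energy s p X f k h y = (\<integral>\<^sup>+a\<in>X. (\<integral>\<^sup>+b\<in>nbhd k a.
     ennreal (chain_const DIM('a) s p * trunc_kernel p h (y - avg f (dcube k a)) (avg f (dcube k a)) (f a) (f b)) *
     ennreal (1 / norm (a - b) powr (s * p + real DIM('a))) \<partial>lborel) \<partial>lborel)"

lemma trunc_kernel_measurable [measurable (raw)]:
  assumes [measurable]: "d \<in> borel_measurable M" "v \<in> borel_measurable M" "t \<in> borel_measurable M" "u \<in> borel_measurable M"
  shows "(\<lambda>x. trunc_kernel p h (d x) (v x) (t x) (u x)) \<in> borel_measurable M"
  unfolding trunc_kernel_def by measurable

lemma trunc_energy_measurable [measurable]:
  assumes [measurable]: "f \<in> borel_measurable borel" "X \<in> sets borel"
  shows "trunc_energy s p X f k h \<in> borel_measurable borel"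
  unfolding trunc_energy_def by measurable

lemma chain_const_nonneg: "0 \<le> chain_const n s p"
  by (simp add: chain_const_def)

text \<open>All smaller cubes at \<open>x\<close> lie in its cube of level \<open>k\<close>, on
  which the average \<open>v\<close> is constant. The truncation chosen for \<open>x\<close>
  therefore coincides with the one that the kernel assigns to each \<open>a\<close> in these
  cubes.\<close>

lemma hausdorff_premeasure_superlevel:
  fixes f :: "'a::euclidean_space \<Rightarrow> real"
  assumes fm [measurable]: "f \<in> borel_measurable borel" and s: "0 < s" "s < 1" and p: "1 \<le> p" and h: "0 < h"
    and X: "saturated k X" and Xm [measurable]: "X \<in> sets borel"
    and \<delta>: "real DIM('a) * (1/2)^k \<le> \<delta>"
    and int: "\<And>x. x \<in> X \<Longrightarrow> set_integrable lborel (nbhd k x) f"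
  shows "hausdorff_premeasure (real DIM('a) - s) \<delta>
     {x\<in>X. (\<lambda>i. mean_osc i f x) \<longlonglongrightarrow> 0 \<and> ereal y \<le> Limsup (at_right 0) (\<lambda>r. ereal (avg f (ball x r))) \<and>
        h < y - avg f (dcube k x) \<and> mean_osc k f x \<le> ennreal ((y - avg f (dcube k x)) / 16)} \<le>
    ennreal (frac_const DIM('a) s p * 2 powr (- (s * (p - 1) * real k))) * trunc_energy s p X f k h y"
    (is "hausdorff_premeasure _ _ ?E \<le> _")
  unfolding trunc_energy_def
proof (rule hausdorff_premeasure_frac_energy[OF s p X Xm \<delta>])
  let ?n = "real DIM('a)" and ?C = "chain_const DIM('a) s p" and ?v = "\<lambda>a. avg f (dcube k a)"
  show "(\<lambda>(a, b). ennreal (?C * trunc_kernel p h (y - ?v a) (?v a) (f a) (f b))) \<in> borel_measurable (borel \<Otimes>\<^sub>M borel)"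
    by measurable
  show "ennreal (?C * trunc_kernel p h (y - ?v a) (?v a) (f a) (f a)) = 0" for a
    using p by (simp add: trunc_kernel_def)
  show "?E \<subseteq> X" by auto
  fix x assume x: "x \<in> ?E"
  define v where "v = ?v x"
  define d where "d = y - v"
  define g where "g z = trunc d (f z - v)" for z
  have d: "h < d" "0 < d" using x h by (auto simp: d_def v_def)
  have [measurable]: "g \<in> borel_measurable borel" unfolding g_def by measurable
  have "1 \<le> (\<Sum>j. ennreal (?C * d powr (- p) * 2 powr (s * (p - 1) * real j)) * power_osc p (k + j) g x)"
    unfolding g_def
    by (rule level_point_chain[OF fm s(1) p int]) (use x d in \<open>auto simp: d_def v_def\<close>)
  also have "\<dots> = (\<Sum>j. ennreal (2 powr (real (k + j) * ?n)) *
     (\<integral>\<^sup>+a\<in>dcube (k + j) x. ennreal (2 powr (s * (p - 1) * real j + real (k + j) * ?n)) *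
     (\<integral>\<^sup>+b\<in>nbhd (k + j) a. ennreal (?C * trunc_kernel p h (y - ?v a) (?v a) (f a) (f b)) \<partial>lborel) \<partial>lborel))"
  proof (intro arg_cong[where f = suminf] ext)
    fix j
    define T where "T = ennreal (2 powr (real (k + j) * ?n))"
    define W where "W = ennreal (2 powr (s * (p - 1) * real j))"
    define D where "D = ennreal (?C * d powr (- p))"
    define J where "J a = (\<integral>\<^sup>+b\<in>nbhd (k + j) a. ennreal (\<bar>g a - g b\<bar> powr p) \<partial>lborel)" for a
    have [measurable]: "J \<in> borel_measurable borel" unfolding J_def by measurable
    have "(\<integral>\<^sup>+a\<in>dcube (k + j) x. ennreal (2 powr (s * (p - 1) * real j + real (k + j) * ?n)) *
     (\<integral>\<^sup>+b\<in>nbhd (k + j) a. ennreal (?C * trunc_kernel p h (y - ?v a) (?v a) (f a) (f b)) \<partial>lborel) \<partial>lborel)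
      = (\<integral>\<^sup>+a. (W * T * D) * (J a * indicator (dcube (k + j) x) a) \<partial>lborel)"
    proof (intro nn_integral_cong)
      fix a
      show "ennreal (2 powr (s * (p - 1) * real j + real (k + j) * ?n)) *
        (\<integral>\<^sup>+b\<in>nbhd (k + j) a. ennreal (?C * trunc_kernel p h (y - ?v a) (?v a) (f a) (f b)) \<partial>lborel) * indicator (dcube (k + j) x) a
        = (W * T * D) * (J a * indicator (dcube (k + j) x) a)"
      proof (cases "a \<in> dcube (k + j) x")
        case True
        then have "a \<in> dcube k x" using dcube_antimono[of k "k + j" x] by auto
        then have va: "?v a = v" unfolding v_def by (rule avg_dcube_cong)
        have "ennreal (?C * trunc_kernel p h (y - ?v a) (?v a) (f a) (f b)) = D * ennreal (\<bar>g a - g b\<bar> powr p)" for b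
          unfolding va D_def d_def[symmetric]
          using d chain_const_nonneg[of "DIM('a)" s p] by (simp add: trunc_kernel_def g_def ennreal_mult'[symmetric] mult.assoc)
        then have "(\<integral>\<^sup>+b\<in>nbhd (k + j) a. ennreal (?C * trunc_kernel p h (y - ?v a) (?v a) (f a) (f b)) \<partial>lborel) = D * J a"
          by (simp add: J_def mult.assoc nn_integral_cmult)
        moreover have "ennreal (2 powr (s * (p - 1) * real j + real (k + j) * ?n)) = W * T"
          by (simp add: W_def T_def powr_add ennreal_mult')
        ultimately show ?thesis using True by (simp add: mult.assoc)
      qed simp
    qed
    also have "\<dots> = (W * T * D) * (\<integral>\<^sup>+a\<in>dcube (k + j) x. J a \<partial>lborel)"
      by (rule nn_integral_cmult) measurable
    finally have 1: "T * (\<integral>\<^sup>+a\<in>dcube (k + j) x. ennreal (2 powr (s * (p - 1) * real j + real (k + j) * ?n)) *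
     (\<integral>\<^sup>+b\<in>nbhd (k + j) a. ennreal (?C * trunc_kernel p h (y - ?v a) (?v a) (f a) (f b)) \<partial>lborel) \<partial>lborel)
       = T * ((W * T * D) * (\<integral>\<^sup>+a\<in>dcube (k + j) x. J a \<partial>lborel))" by simp
    have "ennreal (2 powr (2 * real (k + j) * ?n)) = T * T"
    proof -
      have "2 * real (k + j) * ?n = real (k + j) * ?n + real (k + j) * ?n" by simp
      then show ?thesis unfolding T_def by (simp only: powr_add) (simp add: ennreal_mult')
    qed
    moreover have "ennreal (?C * d powr (- p) * 2 powr (s * (p - 1) * real j)) = D * W"
      by (simp add: D_def W_def ennreal_mult'')
    ultimately have "ennreal (?C * d powr (- p) * 2 powr (s * (p - 1) * real j)) * power_osc p (k + j) g x
      = T * ((W * T * D) * (\<integral>\<^sup>+a\<in>dcube (k + j) x. J a \<partial>lborel))"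
      unfolding power_osc_def J_def[symmetric] by (simp only: mult_ac)
    with 1 show "ennreal (?C * d powr (- p) * 2 powr (s * (p - 1) * real j)) * power_osc p (k + j) g x
      = ennreal (2 powr (real (k + j) * ?n)) *
     (\<integral>\<^sup>+a\<in>dcube (k + j) x. ennreal (2 powr (s * (p - 1) * real j + real (k + j) * ?n)) *
     (\<integral>\<^sup>+b\<in>nbhd (k + j) a. ennreal (?C * trunc_kernel p h (y - ?v a) (?v a) (f a) (f b)) \<partial>lborel) \<partial>lborel)"
      by (simp add: T_def)
  qed
  finally show "1 \<le> \<dots>" .
qed

section \<open>Integrating truncated differences over the height\<close>

text \<open>\<open>trunc d\<close> has slope \<open>1\<close> on \<open>[d/2, d]\<close> and is
  constant elsewhere, so only the part of \<open>[t, u]\<close> inside that interval counts.\<close>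

lemma trunc_diff_measure:
  assumes "t \<le> u" "0 < d"
  shows "ennreal \<bar>trunc d t - trunc d u\<bar> \<le> (\<integral>\<^sup>+w. indicator {t..u} w * indicator {d/2..d} w \<partial>lborel)"
proof -
  have "(\<integral>\<^sup>+w. indicator {t..u} w * indicator {d/2..d} w \<partial>lborel) = emeasure lborel {max t (d/2)..min u d}"
    by (simp flip: indicator_inter_arith)
  moreover have "\<bar>trunc d t - trunc d u\<bar> \<le> (if max t (d/2) \<le> min u d then min u d - max t (d/2) else 0)"
    using assms unfolding trunc_def by (auto simp: min_def max_def)
  ultimately show ?thesis
    by (simp add: emeasure_lborel_Icc_eq ennreal_leI split: if_splits)
qed

text \<open>The increment is bounded by an integral over heights \<open>w\<close>. For fixed
  \<open>w\<close> only \<open>d = y - v\<close> in \<open>[w, 2 w]\<close> contributes, and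
  \<open>1 / d \<le> 1 / w\<close> on this interval of length \<open>w\<close>; so each
  \<open>w\<close> between \<open>t\<close> and \<open>u\<close> counts at most \<open>1\<close>.
  Untruncated, \<open>1 / d\<close> would have a divergent integral.\<close>

lemma nn_integral_trunc_over_height:
  fixes t u v :: real
  shows "(\<integral>\<^sup>+y. ennreal (if v < y then \<bar>trunc (y - v) t - trunc (y - v) u\<bar> / (y - v) else 0) \<partial>lborel) \<le> ennreal \<bar>t - u\<bar>"
proof -
  have main: "(\<integral>\<^sup>+y. ennreal (if v < y then \<bar>trunc (y - v) t - trunc (y - v) u\<bar> / (y - v) else 0) \<partial>lborel) \<le> ennreal (u - t)"
    if tu: "t \<le> u" for t u
  proof -
    have "(\<integral>\<^sup>+y. ennreal (if v < y then \<bar>trunc (y - v) t - trunc (y - v) u\<bar> / (y - v) else 0) \<partial>lborel) \<le>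
      (\<integral>\<^sup>+y. (\<integral>\<^sup>+w. ennreal (if v < y then 1 / (y - v) else 0) *
          (indicator {t..u} w * indicator {w. (y - v) / 2 \<le> w \<and> w \<le> y - v} w) \<partial>lborel) \<partial>lborel)"
    proof (intro nn_integral_mono)
      fix y :: real
      show "ennreal (if v < y then \<bar>trunc (y - v) t - trunc (y - v) u\<bar> / (y - v) else 0) \<le>
        (\<integral>\<^sup>+w. ennreal (if v < y then 1 / (y - v) else 0) *
          (indicator {t..u} w * indicator {w. (y - v) / 2 \<le> w \<and> w \<le> y - v} w) \<partial>lborel)"
      proof (cases "v < y")
        case True
        have "ennreal (\<bar>trunc (y - v) t - trunc (y - v) u\<bar> / (y - v)) = ennreal (1 / (y - v)) * ennreal \<bar>trunc (y - v) t - trunc (y - v) u\<bar>"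
          using True by (simp add: ennreal_mult'[symmetric])
        also have "\<dots> \<le> ennreal (1 / (y - v)) * (\<integral>\<^sup>+w. indicator {t..u} w * indicator {(y - v) / 2..y - v} w \<partial>lborel)"
          using True by (intro mult_left_mono trunc_diff_measure tu) auto
        also have "\<dots> = (\<integral>\<^sup>+w. ennreal (1 / (y - v)) * (indicator {t..u} w * indicator {(y - v) / 2..y - v} w) \<partial>lborel)"
          by (rule nn_integral_cmult[symmetric]) measurable
        finally show ?thesis using True by (simp add: atLeastAtMost_def atLeast_def atMost_def Collect_conj_eq)
      qed simp
    qed
    also have "\<dots> = (\<integral>\<^sup>+w. (\<integral>\<^sup>+y. ennreal (if v < y then 1 / (y - v) else 0) *
          (indicator {t..u} w * indicator {w. (y - v) / 2 \<le> w \<and> w \<le> y - v} w) \<partial>lborel) \<partial>lborel)"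
      by (rule lborel_pair.Fubini') measurable
    also have "\<dots> \<le> (\<integral>\<^sup>+w. indicator {t..u} w \<partial>lborel)"
    proof (intro nn_integral_mono)
      fix w :: real
      show "(\<integral>\<^sup>+y. ennreal (if v < y then 1 / (y - v) else 0) *
          (indicator {t..u} w * indicator {w. (y - v) / 2 \<le> w \<and> w \<le> y - v} w) \<partial>lborel) \<le> indicator {t..u} w"
      proof (cases "0 < w \<and> w \<in> {t..u}")
        case True
        have "(\<integral>\<^sup>+y. ennreal (if v < y then 1 / (y - v) else 0) *
          (indicator {t..u} w * indicator {w. (y - v) / 2 \<le> w \<and> w \<le> y - v} w) \<partial>lborel)
          \<le> (\<integral>\<^sup>+y. ennreal (1 / w) * indicator {v + w..v + 2 * w} y \<partial>lborel)"
          using True by (intro nn_integral_mono) (auto simp: indicator_def field_simps intro!: ennreal_leI divide_left_mono)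
        also have "\<dots> = 1"
          using True by (simp add: nn_integral_cmult ennreal_mult'[symmetric])
        finally show ?thesis using True by simp
      next
        case False
        then have "(\<integral>\<^sup>+y. ennreal (if v < y then 1 / (y - v) else 0) *
          (indicator {t..u} w * indicator {w. (y - v) / 2 \<le> w \<and> w \<le> y - v} w) \<partial>lborel) = (\<integral>\<^sup>+y. 0 \<partial>(lborel :: real measure))"
          by (intro nn_integral_cong) (auto simp: indicator_def)
        then show ?thesis by simp
      qed
    qed
    also have "\<dots> = ennreal (u - t)" using tu by simp
    finally show ?thesis .
  qed
  show ?thesis
  proof (cases "t \<le> u")
    case True
    with main[OF True] show ?thesis by simp
  next
    case False
    then have "u \<le> t" by simp
    have "\<bar>trunc (y - v) t - trunc (y - v) u\<bar> = \<bar>trunc (y - v) u - trunc (y - v) t\<bar>" for y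
      by (rule abs_minus_commute)
    moreover have "\<bar>t - u\<bar> = t - u" using False by simp
    ultimately show ?thesis using main[OF \<open>u \<le> t\<close>] by (simp only:)
  qed
qed

text \<open>One factor of the truncated difference is kept for the integral over the height. The
  other \<open>p - 1\<close> are bounded by \<open>\<bar>t - u\<bar> powr (p - 1)\<close>, and the
  spare \<open>d powr (1 - p)\<close> by \<open>h powr (1 - p)\<close>, as only \<open>d > h\<close>
  occurs.\<close>

lemma nn_integral_trunc_kernel:
  assumes p: "1 \<le> p" and h: "0 < h"
  shows "(\<integral>\<^sup>+y. ennreal (trunc_kernel p h (y - v) v t u) \<partial>lborel) \<le> ennreal (h powr (1 - p) * \<bar>t - u\<bar> powr p)"
proof (cases "t = u")
  case True
  have "trunc_kernel p h d v u u = 0" for d using p by (auto simp: trunc_kernel_def)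
  then show ?thesis by (simp add: True)
next
  case False
  have "(\<integral>\<^sup>+y. ennreal (trunc_kernel p h (y - v) v t u) \<partial>lborel) \<le>
    (\<integral>\<^sup>+y. ennreal (h powr (1 - p) * \<bar>t - u\<bar> powr (p - 1)) *
       ennreal (if v < y then \<bar>trunc (y - v) (t - v) - trunc (y - v) (u - v)\<bar> / (y - v) else 0) \<partial>lborel)"
  proof (intro nn_integral_mono)
    fix y
    define d where "d = y - v"
    define z where "z = \<bar>trunc d (t - v) - trunc d (u - v)\<bar>"
    have z: "0 \<le> z" "z \<le> \<bar>t - u\<bar>" using trunc_diff_le[of d "t - v" "u - v"] by (auto simp: z_def)
    show "ennreal (trunc_kernel p h (y - v) v t u) \<le> ennreal (h powr (1 - p) * \<bar>t - u\<bar> powr (p - 1)) *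
       ennreal (if v < y then \<bar>trunc (y - v) (t - v) - trunc (y - v) (u - v)\<bar> / (y - v) else 0)"
    proof (cases "h < d \<and> 0 < z")
      case True
      then have d: "h < d" "0 < d" "v < y" using h by (auto simp: d_def)
      have "d powr (- p) = d powr (1 - p) / d" using d by (simp add: powr_diff powr_minus field_simps)
      moreover have "d powr (1 - p) \<le> h powr (1 - p)" using d h p by (intro powr_mono2') auto
      ultimately have 1: "d powr (- p) \<le> h powr (1 - p) / d" using d by (simp add: divide_right_mono)
      have "z powr p = z powr (p - 1) * z" using True by (simp add: powr_diff)
      also have "\<dots> \<le> \<bar>t - u\<bar> powr (p - 1) * z" using z p by (intro mult_right_mono powr_mono2) auto
      finally have "d powr (- p) * z powr p \<le> h powr (1 - p) / d * (\<bar>t - u\<bar> powr (p - 1) * z)"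
        using 1 d z by (intro mult_mono) auto
      then have "d powr (- p) * z powr p \<le> h powr (1 - p) * \<bar>t - u\<bar> powr (p - 1) * (z / d)"
        by (simp add: mult_ac)
      then show ?thesis using d z
        by (simp add: trunc_kernel_def d_def[symmetric] z_def[symmetric] ennreal_mult'[symmetric] ennreal_leI del: times_divide_eq_right)
    next
      case False
      then have "trunc_kernel p h (y - v) v t u = 0"
        using z p by (auto simp: trunc_kernel_def d_def[symmetric] z_def[symmetric])
      then show ?thesis by simp
    qed
  qed
  also have "\<dots> = ennreal (h powr (1 - p) * \<bar>t - u\<bar> powr (p - 1)) *
     (\<integral>\<^sup>+y. ennreal (if v < y then \<bar>trunc (y - v) (t - v) - trunc (y - v) (u - v)\<bar> / (y - v) else 0) \<partial>lborel)"
    by (rule nn_integral_cmult) measurable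
  also have "\<dots> \<le> ennreal (h powr (1 - p) * \<bar>t - u\<bar> powr (p - 1)) * ennreal \<bar>(t - v) - (u - v)\<bar>"
    by (intro mult_left_mono nn_integral_trunc_over_height) auto
  also have "\<dots> = ennreal (h powr (1 - p) * \<bar>t - u\<bar> powr p)"
    using False by (simp add: ennreal_mult'[symmetric] powr_diff)
  finally show ?thesis .
qed

lemma nn_integral_trunc_energy:
  fixes f :: "'a::euclidean_space \<Rightarrow> real"
  assumes [measurable]: "f \<in> borel_measurable borel" "X \<in> sets borel" and p: "1 \<le> p" and h: "0 < h"
  shows "(\<integral>\<^sup>+y. trunc_energy s p X f k h y \<partial>lborel) \<le>
    ennreal (chain_const DIM('a) s p * h powr (1 - p)) * local_energy s p X f k"
proof -
  let ?C = "chain_const DIM('a) s p" and ?v = "\<lambda>a. avg f (dcube k a)"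
  define w where "w a b = ennreal (1 / norm (a - b) powr (s * p + real DIM('a)))" for a b :: 'a
  define K where "K y a b = ennreal (?C * trunc_kernel p h (y - ?v a) (?v a) (f a) (f b))" for y a b
  have [measurable]: "(\<lambda>(a, b). w a b) \<in> borel_measurable (borel \<Otimes>\<^sub>M borel)"
    unfolding w_def by measurable
  have "(\<integral>\<^sup>+y. trunc_energy s p X f k h y \<partial>lborel) =
    (\<integral>\<^sup>+y. (\<integral>\<^sup>+a. (\<integral>\<^sup>+b. K y a b * w a b * indicator (nbhd k a) b \<partial>lborel) * indicator X a \<partial>lborel) \<partial>lborel)"
    unfolding trunc_energy_def K_def w_def ..
  also have "\<dots> = (\<integral>\<^sup>+a. (\<integral>\<^sup>+y. (\<integral>\<^sup>+b. K y a b * w a b * indicator (nbhd k a) b \<partial>lborel) * indicator X a \<partial>lborel) \<partial>lborel)"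
    unfolding K_def by (rule lborel_pair.Fubini') measurable
  also have "\<dots> = (\<integral>\<^sup>+a. (\<integral>\<^sup>+b. (\<integral>\<^sup>+y. K y a b * w a b * indicator (nbhd k a) b \<partial>lborel) \<partial>lborel) * indicator X a \<partial>lborel)"
  proof (intro nn_integral_cong)
    fix a
    have "(\<integral>\<^sup>+y. (\<integral>\<^sup>+b. K y a b * w a b * indicator (nbhd k a) b \<partial>lborel) \<partial>lborel)
      = (\<integral>\<^sup>+b. (\<integral>\<^sup>+y. K y a b * w a b * indicator (nbhd k a) b \<partial>lborel) \<partial>lborel)"
      unfolding K_def by (rule lborel_pair.Fubini') measurable
    moreover have "(\<lambda>y. (\<integral>\<^sup>+b. K y a b * w a b * indicator (nbhd k a) b \<partial>lborel)) \<in> borel_measurable lborel"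
      unfolding K_def by measurable
    ultimately show "(\<integral>\<^sup>+y. (\<integral>\<^sup>+b. K y a b * w a b * indicator (nbhd k a) b \<partial>lborel) * indicator X a \<partial>lborel)
      = (\<integral>\<^sup>+b. (\<integral>\<^sup>+y. K y a b * w a b * indicator (nbhd k a) b \<partial>lborel) \<partial>lborel) * indicator X a"
      by (simp add: nn_integral_multc)
  qed
  also have "\<dots> \<le> (\<integral>\<^sup>+a. (\<integral>\<^sup>+b. ennreal (?C * h powr (1 - p)) * (ennreal (\<bar>f a - f b\<bar> powr p) * w a b * indicator (nbhd k a) b) \<partial>lborel) * indicator X a \<partial>lborel)"
  proof (intro nn_integral_mono mult_right_mono)
    fix a b
    have "(\<integral>\<^sup>+y. K y a b * (w a b * indicator (nbhd k a) b) \<partial>lborel) = (\<integral>\<^sup>+y. K y a b \<partial>lborel) * (w a b * indicator (nbhd k a) b)"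
      unfolding K_def by (rule nn_integral_multc) measurable
    also have "(\<integral>\<^sup>+y. K y a b \<partial>lborel) = ennreal ?C * (\<integral>\<^sup>+y. ennreal (trunc_kernel p h (y - ?v a) (?v a) (f a) (f b)) \<partial>lborel)"
      unfolding K_def ennreal_mult'[OF chain_const_nonneg] by (rule nn_integral_cmult) measurable
    also have "\<dots> * (w a b * indicator (nbhd k a) b) \<le> ennreal ?C * ennreal (h powr (1 - p) * \<bar>f a - f b\<bar> powr p) * (w a b * indicator (nbhd k a) b)"
      by (intro mult_right_mono mult_left_mono nn_integral_trunc_kernel p h) auto
    also have "\<dots> = ennreal (?C * h powr (1 - p)) * (ennreal (\<bar>f a - f b\<bar> powr p) * w a b * indicator (nbhd k a) b)"
      using chain_const_nonneg[of "DIM('a)" s p] by (simp add: ennreal_mult' ennreal_mult'' mult.assoc)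
    finally show "(\<integral>\<^sup>+y. K y a b * w a b * indicator (nbhd k a) b \<partial>lborel) \<le>
      ennreal (?C * h powr (1 - p)) * (ennreal (\<bar>f a - f b\<bar> powr p) * w a b * indicator (nbhd k a) b)"
      by (simp add: mult.assoc)
  qed auto
  also have "\<dots> = ennreal (?C * h powr (1 - p)) * local_energy s p X f k"
    unfolding local_energy_def w_def by (simp add: nn_integral_cmult mult.assoc)
  finally show ?thesis .
qed


section \<open>Combining points with average close to the level and points far from it\<close>

text \<open>Off this set the margin \<open>d = \<bar>y - v\<bar>\<close> exceeds both
  \<open>h\<close> and \<open>16\<close> times the mean oscillation, which gives the hypotheses
  \<open>h < d\<close> and \<open>mean_osc \<le> d / 16\<close> of the chaining estimate. Membership
  depends on the cube of \<open>a\<close> only, so the set can be covered at level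
  \<open>k\<close>.\<close>

definition bad_set :: "'a::euclidean_space set \<Rightarrow> ('a \<Rightarrow> real) \<Rightarrow> nat \<Rightarrow> real \<Rightarrow> real \<Rightarrow> 'a set" where
  "bad_set X f k h y = {a\<in>X. ennreal \<bar>y - avg f (dcube k a)\<bar> \<le> ennreal h + 16 * mean_osc k f a}"

lemma bad_set_measurable [measurable]:
  assumes [measurable]: "f \<in> borel_measurable borel" "X \<in> sets borel"
  shows "bad_set X f k h y \<in> sets borel"
  unfolding bad_set_def by measurable

lemma saturated_bad_set: "saturated k X \<Longrightarrow> saturated k (bad_set X f k h y)"
  unfolding saturated_def bad_set_def mean_osc_def by (auto simp: dcube_eq subset_iff)

lemma emeasure_bad_set_measurable [measurable]:
  fixes f :: "'a::euclidean_space \<Rightarrow> real"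
  assumes [measurable]: "f \<in> borel_measurable borel" "X \<in> sets borel"
  shows "(\<lambda>y. emeasure lborel (bad_set X f k h y)) \<in> borel_measurable borel"
proof -
  have "(\<lambda>y. \<integral>\<^sup>+a. indicator (bad_set X f k h y) a \<partial>lborel) \<in> borel_measurable borel"
    unfolding bad_set_def by measurable
  then show ?thesis by simp
qed

lemma nn_integral_close_le:
  fixes T :: ennreal and v :: real
  shows "(\<integral>\<^sup>+y. indicator {y. ennreal \<bar>y - v\<bar> \<le> T} y \<partial>lborel) \<le> 2 * T"
proof (cases T)
  case (real t)
  have "(\<integral>\<^sup>+y. indicator {y. ennreal \<bar>y - v\<bar> \<le> T} y \<partial>lborel) \<le> (\<integral>\<^sup>+y. indicator {v - t..v + t} y \<partial>lborel)"
    using real by (intro nn_integral_mono) (auto simp: indicator_def ennreal_le_iff)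
  also have "\<dots> = ennreal (2 * t)" using real by simp
  also have "\<dots> = 2 * T" using real by (simp add: ennreal_mult')
  finally show ?thesis .
qed (simp add: ennreal_mult_top)

text \<open>For fixed \<open>a\<close> the levels in question lie within
  \<open>h + 16 mean_osc\<close> of the average, hence the factors \<open>2\<close> and
  \<open>32\<close>.\<close>

lemma nn_integral_bad_set:
  fixes f :: "'a::euclidean_space \<Rightarrow> real"
  assumes [measurable]: "f \<in> borel_measurable borel" "X \<in> sets borel" and h: "0 < h"
  shows "(\<integral>\<^sup>+y. emeasure lborel (bad_set X f k h y) \<partial>lborel) \<le>
    ennreal (2 * h) * emeasure lborel X + 32 * (\<integral>\<^sup>+x\<in>X. mean_osc k f x \<partial>lborel)"
proof -
  have "(\<integral>\<^sup>+y. emeasure lborel (bad_set X f k h y) \<partial>lborel) = (\<integral>\<^sup>+y. (\<integral>\<^sup>+a. indicator (bad_set X f k h y) a \<partial>lborel) \<partial>lborel)"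
    by simp
  also have "\<dots> = (\<integral>\<^sup>+a. (\<integral>\<^sup>+y. indicator (bad_set X f k h y) a \<partial>lborel) \<partial>lborel)"
    unfolding bad_set_def by (rule lborel_pair.Fubini') measurable
  also have "\<dots> \<le> (\<integral>\<^sup>+a. (ennreal (2 * h) + 32 * mean_osc k f a) * indicator X a \<partial>lborel)"
  proof (intro nn_integral_mono)
    fix a
    show "(\<integral>\<^sup>+y. indicator (bad_set X f k h y) a \<partial>lborel) \<le> (ennreal (2 * h) + 32 * mean_osc k f a) * indicator X a"
    proof (cases "a \<in> X")
      case True
      have "(\<integral>\<^sup>+y. indicator (bad_set X f k h y) a \<partial>lborel) =
        (\<integral>\<^sup>+y. indicator {y. ennreal \<bar>y - avg f (dcube k a)\<bar> \<le> ennreal h + 16 * mean_osc k f a} y \<partial>lborel)"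
        using True by (intro nn_integral_cong) (auto simp: bad_set_def indicator_def)
      also have "\<dots> \<le> 2 * (ennreal h + 16 * mean_osc k f a)" by (rule nn_integral_close_le)
      also have "\<dots> = ennreal (2 * h) + 32 * mean_osc k f a"
        using h by (simp add: distrib_left ennreal_mult' mult.assoc[symmetric])
      finally show ?thesis using True by simp
    qed (simp add: bad_set_def)
  qed
  also have "\<dots> = ennreal (2 * h) * emeasure lborel X + 32 * (\<integral>\<^sup>+x\<in>X. mean_osc k f x \<partial>lborel)"
    by (simp add: distrib_right nn_integral_add nn_integral_cmult mult.assoc)
  finally show ?thesis .
qed

definition avg_level_set :: "'a::euclidean_space set \<Rightarrow> ('a \<Rightarrow> real) \<Rightarrow> real \<Rightarrow> 'a set" where
  "avg_level_set X f y = {x\<in>X. Liminf (at_right 0) (\<lambda>r. ereal (avg f (ball x r))) \<le> ereal y \<and>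
     ereal y \<le> Limsup (at_right 0) (\<lambda>r. ereal (avg f (ball x r)))}"

lemma avg_uminus: "avg (\<lambda>z. - f z) A = - avg f A"
  by (simp add: avg_def set_lebesgue_integral_def)

lemma mean_osc_uminus: "mean_osc i (\<lambda>z. - f z) = mean_osc i f"
  by (simp add: mean_osc_def fun_eq_iff abs_minus_commute)

lemma local_energy_uminus: "local_energy s p X (\<lambda>z. - f z) k = local_energy s p X f k"
  by (simp add: local_energy_def abs_minus_commute)

text \<open>Off the bad set \<open>y\<close> lies above or below \<open>v\<close> by a definite
  margin. Above, the upper limit drives the chain upwards; below, passing to \<open>-f\<close> and
  \<open>-y\<close> turns the lower limit into an upper one and leaves mean oscillation and margin
  unchanged.\<close>

lemma hausdorff_premeasure_avg_level_set:
  fixes f :: "'a::euclidean_space \<Rightarrow> real"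
  assumes fm [measurable]: "f \<in> borel_measurable borel" and s: "0 < s" "s < 1" and p: "1 \<le> p" and h: "0 < h"
    and X: "saturated k X" and Xm [measurable]: "X \<in> sets borel"
    and \<delta>: "real DIM('a) * (1/2)^k \<le> \<delta>"
    and int: "\<And>x. x \<in> X \<Longrightarrow> set_integrable lborel (nbhd k x) f"
  shows "hausdorff_premeasure (real DIM('a) - s) \<delta> {x\<in>avg_level_set X f y. (\<lambda>i. mean_osc i f x) \<longlonglongrightarrow> 0} \<le>
    ennreal (cover_const DIM('a) (real DIM('a) - s) * 2 powr (s * real k)) * emeasure lborel (bad_set X f k h y) +
    (ennreal (frac_const DIM('a) s p * 2 powr (- (s * (p - 1) * real k))) * trunc_energy s p X f k h y +
     ennreal (frac_const DIM('a) s p * 2 powr (- (s * (p - 1) * real k))) * trunc_energy s p X (\<lambda>z. - f z) k h (- y))"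
proof -
  let ?n = "real DIM('a)" and ?v = "\<lambda>a. avg f (dcube k a)"
  define E where "E g y = {x\<in>X. (\<lambda>i. mean_osc i g x) \<longlonglongrightarrow> 0 \<and> ereal y \<le> Limsup (at_right 0) (\<lambda>r. ereal (avg g (ball x r))) \<and>
        h < y - avg g (dcube k x) \<and> mean_osc k g x \<le> ennreal ((y - avg g (dcube k x)) / 16)}" for g :: "'a \<Rightarrow> real" and y
  have \<delta>0: "0 \<le> \<delta>" by (rule order_trans[OF _ \<delta>]) simp
  have "{x\<in>avg_level_set X f y. (\<lambda>i. mean_osc i f x) \<longlonglongrightarrow> 0} \<subseteq> bad_set X f k h y \<union> (E f y \<union> E (\<lambda>z. - f z) (- y))"
  proof
    fix x assume x: "x \<in> {x\<in>avg_level_set X f y. (\<lambda>i. mean_osc i f x) \<longlonglongrightarrow> 0}"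
    then have xX: "x \<in> X" by (auto simp: avg_level_set_def)
    define d where "d = \<bar>y - ?v x\<bar>"
    show "x \<in> bad_set X f k h y \<union> (E f y \<union> E (\<lambda>z. - f z) (- y))"
    proof (cases "x \<in> bad_set X f k h y")
      case False
      then have big: "ennreal h + 16 * mean_osc k f x < ennreal d"
        using xX by (simp add: bad_set_def d_def)
      have "ennreal h < ennreal d" by (rule le_less_trans[OF _ big]) simp
      then have hd: "h < d" using h by (simp add: ennreal_less_iff)
      have "16 * mean_osc k f x \<le> ennreal d"
        by (rule order_trans[OF _ less_imp_le[OF big]]) simp
      then have "ennreal (1/16) * (16 * mean_osc k f x) \<le> ennreal (1/16) * ennreal d" by (rule mult_left_mono) simp
      moreover have "ennreal (1/16) * 16 = 1"
      proof -
        have "ennreal (1/16) * ennreal 16 = ennreal (1/16 * 16)" by (rule ennreal_mult'[symmetric]) simp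
        then show ?thesis by simp
      qed
      ultimately have md: "mean_osc k f x \<le> ennreal (d / 16)"
        by (simp add: mult.assoc[symmetric] ennreal_mult'[symmetric])
      show ?thesis
      proof (cases "?v x < y")
        case True
        then have "d = y - ?v x" by (simp add: d_def)
        with x xX hd md have "x \<in> E f y" by (simp add: E_def avg_level_set_def)
        then show ?thesis by blast
      next
        case False
        then have "d = - y - avg (\<lambda>z. - f z) (dcube k x)" by (simp add: d_def avg_uminus)
        moreover have "ereal (- y) \<le> Limsup (at_right 0) (\<lambda>r. ereal (avg (\<lambda>z. - f z) (ball x r)))"
        proof -
          have "Limsup (at_right 0) (\<lambda>r. ereal (avg (\<lambda>z. - f z) (ball x r))) = - Liminf (at_right 0) (\<lambda>r. ereal (avg f (ball x r)))"
            unfolding avg_uminus uminus_ereal.simps(1)[symmetric] by (rule ereal_Limsup_uminus)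
          moreover have "Liminf (at_right 0) (\<lambda>r. ereal (avg f (ball x r))) \<le> ereal y"
            using x by (simp add: avg_level_set_def)
          ultimately show ?thesis
            by (metis ereal_minus_le_minus uminus_ereal.simps(1))
        qed
        ultimately have "x \<in> E (\<lambda>z. - f z) (- y)"
          using x xX hd md by (simp add: E_def mean_osc_uminus)
        then show ?thesis by blast
      qed
    qed blast
  qed
  then have "hausdorff_premeasure (?n - s) \<delta> {x\<in>avg_level_set X f y. (\<lambda>i. mean_osc i f x) \<longlonglongrightarrow> 0}
    \<le> hausdorff_premeasure (?n - s) \<delta> (bad_set X f k h y \<union> (E f y \<union> E (\<lambda>z. - f z) (- y)))"
    by (rule hausdorff_premeasure_mono)
  also have "\<dots> \<le> hausdorff_premeasure (?n - s) \<delta> (bad_set X f k h y) +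
     (hausdorff_premeasure (?n - s) \<delta> (E f y) + hausdorff_premeasure (?n - s) \<delta> (E (\<lambda>z. - f z) (- y)))"
    by (rule order_trans[OF hausdorff_premeasure_Un[OF \<delta>0] add_left_mono[OF hausdorff_premeasure_Un[OF \<delta>0]]])
  also have "\<dots> \<le> ennreal (cover_const ?n (?n - s) * 2 powr (s * real k)) * emeasure lborel (bad_set X f k h y) +
    (ennreal (frac_const ?n s p * 2 powr (- (s * (p - 1) * real k))) * trunc_energy s p X f k h y +
     ennreal (frac_const ?n s p * 2 powr (- (s * (p - 1) * real k))) * trunc_energy s p X (\<lambda>z. - f z) k h (- y))"
  proof (intro add_mono)
    have "0 < ?n - s" using s DIM_positive[where 'a='a] by linarith
    from hausdorff_premeasure_saturated[OF saturated_bad_set[OF X] this \<delta>]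
    show "hausdorff_premeasure (?n - s) \<delta> (bad_set X f k h y) \<le> ennreal (cover_const ?n (?n - s) * 2 powr (s * real k)) * emeasure lborel (bad_set X f k h y)"
      by (simp add: mult.commute[of s])
    show "hausdorff_premeasure (?n - s) \<delta> (E f y) \<le> ennreal (frac_const ?n s p * 2 powr (- (s * (p - 1) * real k))) * trunc_energy s p X f k h y"
      unfolding E_def by (rule hausdorff_premeasure_superlevel[OF fm s p h X Xm \<delta> int])
    show "hausdorff_premeasure (?n - s) \<delta> (E (\<lambda>z. - f z) (- y)) \<le> ennreal (frac_const ?n s p * 2 powr (- (s * (p - 1) * real k))) * trunc_energy s p X (\<lambda>z. - f z) k h (- y)"
      unfolding E_def
    proof (rule hausdorff_premeasure_superlevel[OF _ s p h X Xm \<delta>])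
      show "set_integrable lborel (nbhd k x) (\<lambda>z. - f z)" if "x \<in> X" for x
        using int[OF that] by (simp add: set_integrable_def)
    qed measurable
  qed
  finally show ?thesis .
qed

section \<open>Level sets of fractional Sobolev functions\<close>

text \<open>The constants \<open>K1\<close> and \<open>K2\<close> are free of \<open>k\<close> and
  \<open>\<eta>\<close>, so \<open>\<eta>\<close> can be fixed before \<open>k\<close> is sent to
  infinity. The majorant is Borel in \<open>y\<close> and serves every
  \<open>\<delta> \<ge> n 2^(-k)\<close>.\<close>

lemma avg_level_set_majorant:
  fixes f :: "'a::euclidean_space \<Rightarrow> real"
  assumes fm [measurable]: "f \<in> borel_measurable borel" and s: "0 < s" "s < 1" and p: "1 \<le> p" and \<eta>: "0 < \<eta>"
    and X: "saturated k X" and Xm [measurable]: "X \<in> sets borel"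
    and int: "\<And>x. x \<in> X \<Longrightarrow> set_integrable lborel (nbhd k x) f"
  defines "C \<equiv> cover_const DIM('a) (real DIM('a) - s)"
  defines "K1 \<equiv> C * (2 + 32 * nbhd_vol DIM('a))"
  defines "K2 \<equiv> C * 32 * (real DIM('a) + 1) powr (s * p + real DIM('a)) + 2 * (frac_const DIM('a) s p * chain_const DIM('a) s p)"
  obtains F where "F \<in> borel_measurable borel"
    "\<And>y \<delta>. real DIM('a) * (1/2)^k \<le> \<delta> \<Longrightarrow>
      hausdorff_premeasure (real DIM('a) - s) \<delta> {x\<in>avg_level_set X f y. (\<lambda>i. mean_osc i f x) \<longlonglongrightarrow> 0} \<le> F y"
    "(\<integral>\<^sup>+y. F y \<partial>lborel) \<le> ennreal (K1 * \<eta>) * emeasure lborel X + ennreal (K2 * \<eta> powr (1 - p)) * local_energy s p X f k"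
proof
  let ?n = "real DIM('a)" and ?\<omega> = "nbhd_vol DIM('a)"
  define q where "q = s * p + ?n"
  \<comment> \<open>With this scaling all powers of \<open>2^k\<close> cancel:
    \<open>A h = C \<eta>\<close>, \<open>A h^(1 - p) 2^(-s p k) = C \<eta>^(1 - p)\<close>, and
    \<open>B h^(1 - p)\<close> is \<open>frac_const\<close> times
    \<open>\<eta>^(1 - p)\<close>.\<close>
  define h where "h = \<eta> * 2 powr (- (s * real k))"
  have h: "0 < h" using \<eta> by (simp add: h_def)
  define A where "A = C * 2 powr (s * real k)"
  define B where "B = frac_const ?n s p * 2 powr (- (s * (p - 1) * real k))"
  define F where "F y = ennreal A * emeasure lborel (bad_set X f k h y) +
    (ennreal B * trunc_energy s p X f k h y + ennreal B * trunc_energy s p X (\<lambda>z. - f z) k h (- y))" for y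
  show "F \<in> borel_measurable borel" unfolding F_def by measurable
  show "hausdorff_premeasure (?n - s) \<delta> {x\<in>avg_level_set X f y. (\<lambda>i. mean_osc i f x) \<longlonglongrightarrow> 0} \<le> F y"
    if "?n * (1/2)^k \<le> \<delta>" for y \<delta>
    unfolding F_def A_def B_def C_def by (rule hausdorff_premeasure_avg_level_set[OF fm s p h X Xm that int])
  have C: "0 \<le> C" unfolding C_def using s DIM_positive[where 'a='a] by (intro cover_const_nonneg) linarith
  have fr: "0 \<le> frac_const ?n s p"
    using s p DIM_positive[where 'a='a] by (intro frac_const_nonneg add_pos_pos) (auto intro: order_trans[of s 1])
  have A: "0 \<le> A" using C by (simp add: A_def)
  have B: "0 \<le> B" using fr by (simp add: B_def)
  have \<omega>: "0 < ?\<omega>" by (rule nbhd_vol_pos)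
  have ch: "0 \<le> chain_const DIM('a) s p" by (rule chain_const_nonneg)
  define E where "E = local_energy s p X f k"
  define V where "V = emeasure lborel X"
  have hp: "h powr (1 - p) = \<eta> powr (1 - p) * 2 powr (s * (p - 1) * real k)"
    using \<eta> by (simp add: h_def powr_mult powr_powr algebra_simps)
  have neg: "(\<integral>\<^sup>+y. trunc_energy s p X (\<lambda>z. - f z) k h (- y) \<partial>lborel) = (\<integral>\<^sup>+y. trunc_energy s p X (\<lambda>z. - f z) k h y \<partial>lborel)"
    by (subst nn_integral_real_affine[where c = "-1" and t = 0 and f = "trunc_energy s p X (\<lambda>z. - f z) k h"]) auto
  have te: "(\<integral>\<^sup>+y. trunc_energy s p X g k h y \<partial>lborel) \<le> ennreal (chain_const DIM('a) s p * h powr (1 - p)) * local_energy s p X g k"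
    if [measurable]: "g \<in> borel_measurable borel" for g
    by (rule nn_integral_trunc_energy[OF that Xm p h])
  have "(\<integral>\<^sup>+y. F y \<partial>lborel) = ennreal A * (\<integral>\<^sup>+y. emeasure lborel (bad_set X f k h y) \<partial>lborel) +
    (ennreal B * (\<integral>\<^sup>+y. trunc_energy s p X f k h y \<partial>lborel) + ennreal B * (\<integral>\<^sup>+y. trunc_energy s p X (\<lambda>z. - f z) k h y \<partial>lborel))"
    unfolding F_def neg[symmetric] by (simp add: nn_integral_add nn_integral_cmult)
  also have "\<dots> \<le> ennreal A * (ennreal (2 * h) * V + 32 * (ennreal (h * ?\<omega>) * V +
      ennreal (h powr (1 - p) * ((?n + 1) powr q * 2 powr (- (s * p * real k)))) * E)) +
    (ennreal B * (ennreal (chain_const DIM('a) s p * h powr (1 - p)) * E) + ennreal B * (ennreal (chain_const DIM('a) s p * h powr (1 - p)) * E))"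
  proof (intro add_mono mult_left_mono)
    show "(\<integral>\<^sup>+y. emeasure lborel (bad_set X f k h y) \<partial>lborel) \<le> ennreal (2 * h) * V + 32 * (ennreal (h * ?\<omega>) * V +
      ennreal (h powr (1 - p) * ((?n + 1) powr q * 2 powr (- (s * p * real k)))) * E)"
      unfolding V_def E_def q_def
      by (rule order_trans[OF nn_integral_bad_set[OF fm Xm h]])
         (intro add_left_mono mult_left_mono nn_integral_mean_osc_le[OF fm h p s(1) X Xm]; simp)
    show "(\<integral>\<^sup>+y. trunc_energy s p X f k h y \<partial>lborel) \<le> ennreal (chain_const DIM('a) s p * h powr (1 - p)) * E"
      unfolding E_def by (rule te) measurable
    show "(\<integral>\<^sup>+y. trunc_energy s p X (\<lambda>z. - f z) k h y \<partial>lborel) \<le> ennreal (chain_const DIM('a) s p * h powr (1 - p)) * E"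
      unfolding E_def by (subst local_energy_uminus[symmetric], rule te) measurable
  qed auto
  also have "\<dots> = ennreal (A * (2 * h) + A * 32 * (h * ?\<omega>)) * V +
     ennreal (A * 32 * (h powr (1 - p) * ((?n + 1) powr q * 2 powr (- (s * p * real k)))) + 2 * (B * (chain_const DIM('a) s p * h powr (1 - p)))) * E"
  proof -
    define a1 where "a1 = 2 * h"
    define a2 where "a2 = h * ?\<omega>"
    define a3 where "a3 = h powr (1 - p) * ((?n + 1) powr q * 2 powr (- (s * p * real k)))"
    define a4 where "a4 = chain_const DIM('a) s p * h powr (1 - p)"
    have a: "0 \<le> a1" "0 \<le> a2" "0 \<le> a3" "0 \<le> a4" using h \<omega> ch by (auto simp: a1_def a2_def a3_def a4_def)
    have "ennreal A * (ennreal a1 * V + 32 * (ennreal a2 * V + ennreal a3 * E)) + (ennreal B * (ennreal a4 * E) + ennreal B * (ennreal a4 * E))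
      = (ennreal A * ennreal a1 + ennreal A * 32 * ennreal a2) * V + (ennreal A * 32 * ennreal a3 + 2 * (ennreal B * ennreal a4)) * E"
      unfolding mult_2 by (simp only: distrib_left distrib_right mult_ac add_ac)
    also have "ennreal A * ennreal a1 + ennreal A * 32 * ennreal a2 = ennreal (A * a1 + A * 32 * a2)"
      using A a by (simp add: ennreal_mult)
    also have "ennreal A * 32 * ennreal a3 + 2 * (ennreal B * ennreal a4) = ennreal (A * 32 * a3 + 2 * (B * a4))"
      using A B a by (simp add: ennreal_mult)
    finally show ?thesis by (simp only: a1_def a2_def a3_def a4_def)
  qed
  also have "A * (2 * h) + A * 32 * (h * ?\<omega>) = K1 * \<eta>"
  proof -
    have "A * h = C * \<eta>"
      by (simp add: A_def h_def mult_ac powr_add[symmetric])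
    moreover have "A * (2 * h) + A * 32 * (h * ?\<omega>) = (A * h) * (2 + 32 * ?\<omega>)"
      by (simp add: algebra_simps)
    ultimately show ?thesis by (simp add: K1_def)
  qed
  also have "A * 32 * (h powr (1 - p) * ((?n + 1) powr q * 2 powr (- (s * p * real k)))) + 2 * (B * (chain_const DIM('a) s p * h powr (1 - p))) = K2 * \<eta> powr (1 - p)"
  proof -
    have "2 powr (s * real k) * (2 powr (s * (p - 1) * real k) * 2 powr (- (s * p * real k))) = 1"
      by (simp add: powr_add[symmetric] algebra_simps)
    then have 1: "A * (h powr (1 - p) * 2 powr (- (s * p * real k))) = C * \<eta> powr (1 - p)"
      unfolding A_def hp by (metis (no_types, opaque_lifting) mult.assoc mult.left_commute mult.right_neutral)
    have "2 powr (- (s * (p - 1) * real k)) * 2 powr (s * (p - 1) * real k) = 1"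
      by (simp add: powr_add[symmetric])
    then have 2: "B * h powr (1 - p) = frac_const ?n s p * \<eta> powr (1 - p)"
      unfolding B_def hp by (metis (no_types, opaque_lifting) mult.assoc mult.left_commute mult.right_neutral)
    have 3: "A * 32 * (h powr (1 - p) * ((?n + 1) powr q * 2 powr (- (s * p * real k)))) = 32 * (?n + 1) powr q * (A * (h powr (1 - p) * 2 powr (- (s * p * real k))))"
      by (simp only: mult_ac)
    have 4: "B * (chain_const DIM('a) s p * h powr (1 - p)) = chain_const DIM('a) s p * (B * h powr (1 - p))"
      by (simp only: mult_ac)
    show ?thesis
      unfolding 3[unfolded 1] 4[unfolded 2] by (simp add: K2_def q_def algebra_simps)
  qed
  finally show "(\<integral>\<^sup>+y. F y \<partial>lborel) \<le> ennreal (K1 * \<eta>) * emeasure lborel X + ennreal (K2 * \<eta> powr (1 - p)) * local_energy s p X f k"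
    by (simp add: V_def E_def)
qed

text \<open>The majorants \<open>F m\<close> have integrals tending to \<open>0\<close>, so by
  Fatou's lemma their lower limit vanishes almost everywhere. For every \<open>\<delta>\<close> it
  bounds the premeasure, because all but finitely many \<open>m\<close> satisfy
  \<open>n 2^(-m) \<le> \<delta>\<close>; so one null set of levels works for all
  \<open>\<delta>\<close>.\<close>

lemma AE_hausdorff_measure_avg_level_set:
  fixes f :: "'a::euclidean_space \<Rightarrow> real"
  assumes fm [measurable]: "f \<in> borel_measurable borel" and s: "0 < s" "s < 1" and p: "1 \<le> p"
    and X: "saturated k0 X" and Xm [measurable]: "X \<in> sets borel" and Xfin: "emeasure lborel X < \<infinity>"
    and int: "\<And>x. x \<in> X \<Longrightarrow> set_integrable lborel (nbhd k0 x) f"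
    and fin: "local_energy s p X f k0 < \<infinity>"
  shows "AE y in lborel. hausdorff_measure (real DIM('a) - s) (avg_level_set X f y) = 0"
proof -
  let ?n = "real DIM('a)"
  define L where "L y = {x\<in>avg_level_set X f y. (\<lambda>i. mean_osc i f x) \<longlonglongrightarrow> 0}" for y
  define C where "C = cover_const ?n (?n - s)"
  define K1 where "K1 = C * (2 + 32 * nbhd_vol DIM('a))"
  define K2 where "K2 = C * 32 * (?n + 1) powr (s * p + ?n) + 2 * (frac_const ?n s p * chain_const DIM('a) s p)"
  have "\<exists>F. F \<in> borel_measurable borel \<and> (\<integral>\<^sup>+y. F y \<partial>lborel) \<le> ennreal (2 * (1/2)^m) \<and>
     (\<forall>y \<delta>. ?n * (1/2)^m \<le> \<delta> \<longrightarrow> hausdorff_premeasure (?n - s) \<delta> (L y) \<le> F y)" for m :: nat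
  proof -
    obtain V where V: "emeasure lborel X = ennreal V" "0 \<le> V"
      using Xfin by (cases "emeasure lborel X") auto
    have K1: "0 \<le> K1"
      unfolding K1_def C_def using s DIM_positive[where 'a='a] nbhd_vol_pos[of "DIM('a)"]
      by (intro mult_nonneg_nonneg cover_const_nonneg) linarith+
    \<comment> \<open>Makes the volume term at most \<open>(1/2)^m\<close>; the added
      \<open>1\<close> keeps the denominator positive if \<open>K1 * V = 0\<close>.\<close>
    define \<eta> where "\<eta> = (1/2)^m / (K1 * V + 1)"
    have kv: "0 < K1 * V + 1" using K1 V by (simp add: add_nonneg_pos)
    have \<eta>: "0 < \<eta>" using kv by (simp add: \<eta>_def)
    have 1: "ennreal (K1 * \<eta>) * emeasure lborel X \<le> ennreal ((1/2)^m)"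
    proof -
      have "K1 * \<eta> * V = (1/2)^m * (K1 * V / (K1 * V + 1))" by (simp add: \<eta>_def)
      also have "\<dots> \<le> (1/2)^m * 1" using kv by (intro mult_left_mono) auto
      finally show ?thesis using V by (simp add: ennreal_mult''[symmetric] ennreal_leI)
    qed
    \<comment> \<open>With \<open>\<eta>\<close> fixed, the factor \<open>\<eta>^(1 - p)\<close>,
      however large, is beaten by the decay of the energy in \<open>k\<close>.\<close>
    have "(\<lambda>k. ennreal (K2 * \<eta> powr (1 - p)) * local_energy s p X f k) \<longlonglongrightarrow> ennreal (K2 * \<eta> powr (1 - p)) * 0"
      by (intro ennreal_tendsto_cmult local_energy_tendsto_0[OF fm Xm fin]) simp
    then have "\<forall>\<^sub>F k in sequentially. ennreal (K2 * \<eta> powr (1 - p)) * local_energy s p X f k < ennreal ((1/2)^m)"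
      by (rule order_tendstoD) simp
    then have "\<forall>\<^sub>F k in sequentially. ennreal (K2 * \<eta> powr (1 - p)) * local_energy s p X f k < ennreal ((1/2)^m) \<and> k0 \<le> k \<and> m \<le> k"
      by (intro eventually_conj eventually_ge_at_top)
    then obtain k where k: "ennreal (K2 * \<eta> powr (1 - p)) * local_energy s p X f k < ennreal ((1/2)^m)" "k0 \<le> k" "m \<le> k"
      using eventually_happens' sequentially_bot by blast
    have int': "set_integrable lborel (nbhd k x) f" if "x \<in> X" for x
    proof (rule set_integrable_subset[OF int[OF that]])
      have "(1/2::real)^k \<le> (1/2)^k0" using k(2) by (intro power_decreasing) auto
      then show "nbhd k x \<subseteq> nbhd k0 x" by (intro subset_ball mult_left_mono) auto
    qed auto
    obtain F where F: "F \<in> borel_measurable borel"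
      "\<And>y \<delta>. ?n * (1/2)^k \<le> \<delta> \<Longrightarrow> hausdorff_premeasure (?n - s) \<delta> (L y) \<le> F y"
      "(\<integral>\<^sup>+y. F y \<partial>lborel) \<le> ennreal (K1 * \<eta>) * emeasure lborel X + ennreal (K2 * \<eta> powr (1 - p)) * local_energy s p X f k"
      unfolding L_def K1_def K2_def C_def
      by (rule avg_level_set_majorant[OF fm s p \<eta> saturated_antimono[OF X k(2)] Xm int']) auto
    note F(3)
    also have "\<dots> \<le> ennreal ((1/2)^m) + ennreal ((1/2)^m)"
      using 1 k(1) by (intro add_mono) auto
    also have "\<dots> = ennreal (2 * (1/2)^m)" by (simp flip: ennreal_plus)
    finally have "(\<integral>\<^sup>+y. F y \<partial>lborel) \<le> ennreal (2 * (1/2)^m)" .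
    moreover have "hausdorff_premeasure (?n - s) \<delta> (L y) \<le> F y" if "?n * (1/2)^m \<le> \<delta>" for y \<delta>
    proof (rule F(2))
      have "(1/2::real)^k \<le> (1/2)^m" using k(3) by (intro power_decreasing) auto
      then have "?n * (1/2)^k \<le> ?n * (1/2)^m" by (intro mult_left_mono) auto
      with that show "?n * (1/2)^k \<le> \<delta>" by linarith
    qed
    ultimately show ?thesis using F(1) by blast
  qed
  then obtain F where F: "\<And>m. F m \<in> borel_measurable borel"
    "\<And>m. (\<integral>\<^sup>+y. F m y \<partial>lborel) \<le> ennreal (2 * (1/2)^m)"
    "\<And>m y \<delta>. ?n * (1/2)^m \<le> \<delta> \<Longrightarrow> hausdorff_premeasure (?n - s) \<delta> (L y) \<le> F m y"
    by metis
  have [measurable]: "F m \<in> borel_measurable borel" for m by (rule F(1))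
  have "(\<integral>\<^sup>+y. liminf (\<lambda>m. F m y) \<partial>lborel) \<le> liminf (\<lambda>m. \<integral>\<^sup>+y. F m y \<partial>lborel)"
    by (rule nn_integral_liminf) measurable
  also have "\<dots> = 0"
  proof -
    have "(\<lambda>m. ennreal (2 * (1/2)^m)) \<longlonglongrightarrow> ennreal (2 * 0)"
      by (intro tendsto_ennrealI tendsto_mult tendsto_const LIMSEQ_realpow_zero) auto
    then have lim: "(\<lambda>m. ennreal (2 * (1/2)^m)) \<longlonglongrightarrow> 0" by simp
    have "(\<lambda>m. \<integral>\<^sup>+y. F m y \<partial>lborel) \<longlonglongrightarrow> 0"
      by (rule tendsto_sandwich[OF _ _ tendsto_const lim]) (simp_all only: F(2) zero_le eventually_True)
    then show ?thesis by (rule lim_imp_Liminf[rotated]) simp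
  qed
  finally have "(\<integral>\<^sup>+y. liminf (\<lambda>m. F m y) \<partial>lborel) = 0" by simp
  then have "AE y in lborel. liminf (\<lambda>m. F m y) = 0"
    by (subst (asm) nn_integral_0_iff_AE) measurable
  then show ?thesis
  proof eventually_elim
    fix y assume y: "liminf (\<lambda>m. F m y) = 0"
    have L0: "hausdorff_measure (?n - s) (L y) = 0"
      unfolding hausdorff_measure_eq_0_iff
    proof (intro allI impI)
      fix \<delta> :: real assume \<delta>: "0 < \<delta>"
      have "(\<lambda>m. ?n * (1/2::real)^m) \<longlonglongrightarrow> ?n * 0"
        by (intro tendsto_mult tendsto_const LIMSEQ_realpow_zero) auto
      then have "\<forall>\<^sub>F m in sequentially. ?n * (1/2::real)^m < \<delta>"
        by (rule order_tendstoD) (use \<delta> in auto)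
      then have "\<forall>\<^sub>F m in sequentially. hausdorff_premeasure (?n - s) \<delta> (L y) \<le> F m y"
        by eventually_elim (intro F(3); simp)
      then have "hausdorff_premeasure (?n - s) \<delta> (L y) \<le> liminf (\<lambda>m. F m y)"
        by (rule Liminf_bounded)
      with y show "hausdorff_premeasure (?n - s) \<delta> (L y) = 0" by simp
    qed
    \<comment> \<open>The exceptional points do not depend on \<open>y\<close>; one set serves all
      levels.\<close>
    define N where "N = {x\<in>X. \<not> (\<lambda>i. mean_osc i f x) \<longlonglongrightarrow> 0}"
    have N0: "hausdorff_measure (?n - s) N = 0"
      unfolding N_def by (rule mean_osc_null[OF s p fm X Xm fin])
    have "hausdorff_measure (?n - s) (\<Union>j::nat. if j = 0 then L y else N) = 0"
      by (rule hausdorff_measure_UN_eq_0) (simp add: L0 N0)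
    then show "hausdorff_measure (?n - s) (avg_level_set X f y) = 0"
    proof (rule hausdorff_measure_null_mono)
      show "avg_level_set X f y \<subseteq> (\<Union>j::nat. if j = 0 then L y else N)"
      proof
        fix x assume x: "x \<in> avg_level_set X f y"
        then have "x \<in> X" by (simp add: avg_level_set_def)
        with x have "x \<in> (if (0::nat) = 0 then L y else N) \<or> x \<in> (if (1::nat) = 0 then L y else N)"
          by (auto simp: L_def N_def)
        then show "x \<in> (\<Union>j::nat. if j = 0 then L y else N)" by blast
      qed
    qed
  qed
qed

section \<open>Borel representatives and localisation to cubes\<close>

text \<open>\<open>f\<close> is only Lebesgue measurable on \<Omega>, while the Fubini arguments
  above are carried out for Borel functions on the whole space. Extension by zero and a change on a
  null set preserve both integrals.\<close>

lemma fractional_sobolev_borel_representative: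
  fixes f :: "'a::euclidean_space \<Rightarrow> real"
  assumes "open \<Omega>" and f: "f \<in> fractional_sobolev s p \<Omega>"
  obtains g where "g \<in> borel_measurable borel" "AE x in lborel. x \<in> \<Omega> \<longrightarrow> f x = g x"
    "(\<integral>\<^sup>+x\<in>\<Omega>. ennreal (\<bar>g x\<bar> powr p) \<partial>lborel) < \<infinity>"
    "(\<integral>\<^sup>+a\<in>\<Omega>. (\<integral>\<^sup>+b\<in>\<Omega>. ennreal (\<bar>g a - g b\<bar> powr p) * ennreal (1 / norm (a - b) powr (s * p + real DIM('a))) \<partial>lborel) \<partial>lborel) < \<infinity>"
proof -
  have \<Omega>: "\<Omega> \<in> sets lborel" "\<Omega> \<inter> space lebesgue \<in> sets lebesgue"
    using \<open>open \<Omega>\<close> by auto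
  have fm: "f \<in> borel_measurable (lebesgue_on \<Omega>)" and fi: "integrable (lebesgue_on \<Omega>) (\<lambda>x. \<bar>f x\<bar> powr p)"
    and fe: "(\<integral>\<^sup>+ y. (\<integral>\<^sup>+ z. ennreal (\<bar>f y - f z\<bar> powr p / norm (y - z) powr (s * p + real DIM('a)))
           \<partial>lebesgue_on \<Omega>) \<partial>lebesgue_on \<Omega>) < \<infinity>"
    using f by (auto simp: fractional_sobolev_def Lp_on_def)
  have "(\<lambda>x. indicator \<Omega> x *\<^sub>R f x) \<in> borel_measurable lebesgue"
    using fm by (subst (asm) borel_measurable_restrict_space_iff[OF \<Omega>(2)])
  then obtain g where g: "g \<in> borel_measurable lborel" "AE x in lborel. indicator \<Omega> x *\<^sub>R f x = g x"
    using completion_ex_borel_measurable_real[of "\<lambda>x. indicator \<Omega> x *\<^sub>R f x" lborel] by auto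
  have ae: "AE x in lborel. x \<in> \<Omega> \<longrightarrow> f x = g x"
    using g(2) by eventually_elim auto
  \<comment> \<open>Valid for arbitrary \<open>u\<close>, so it applies to the inner integral
    without a proof that this is measurable in the outer variable.\<close>
  have lr: "(\<integral>\<^sup>+x. u x \<partial>lebesgue_on \<Omega>) = (\<integral>\<^sup>+x\<in>\<Omega>. u x \<partial>lborel)" for u :: "'a \<Rightarrow> ennreal"
    by (simp only: nn_integral_restrict_space[OF \<Omega>(2)] nn_integral_completion)
  show ?thesis
  proof
    show "g \<in> borel_measurable borel" using g(1) by simp
    show "AE x in lborel. x \<in> \<Omega> \<longrightarrow> f x = g x" by (rule ae)
    have "(\<integral>\<^sup>+x\<in>\<Omega>. ennreal (\<bar>g x\<bar> powr p) \<partial>lborel) = (\<integral>\<^sup>+x\<in>\<Omega>. ennreal (\<bar>f x\<bar> powr p) \<partial>lborel)"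
      by (rule nn_integral_cong_AE) (use ae in \<open>eventually_elim, auto simp: indicator_def\<close>)
    also have "\<dots> = (\<integral>\<^sup>+x. ennreal (norm (\<bar>f x\<bar> powr p)) \<partial>lebesgue_on \<Omega>)"
      by (simp add: lr)
    also have "\<dots> < \<infinity>" using fi by (simp add: integrable_iff_bounded)
    finally show "(\<integral>\<^sup>+x\<in>\<Omega>. ennreal (\<bar>g x\<bar> powr p) \<partial>lborel) < \<infinity>" .
    have "(\<integral>\<^sup>+a\<in>\<Omega>. (\<integral>\<^sup>+b\<in>\<Omega>. ennreal (\<bar>g a - g b\<bar> powr p) * ennreal (1 / norm (a - b) powr (s * p + real DIM('a))) \<partial>lborel) \<partial>lborel)
      = (\<integral>\<^sup>+a\<in>\<Omega>. (\<integral>\<^sup>+b\<in>\<Omega>. ennreal (\<bar>f a - f b\<bar> powr p / norm (a - b) powr (s * p + real DIM('a))) \<partial>lborel) \<partial>lborel)"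
    proof (rule nn_integral_cong_AE)
      show "AE a in lborel.
        (\<integral>\<^sup>+b\<in>\<Omega>. ennreal (\<bar>g a - g b\<bar> powr p) * ennreal (1 / norm (a - b) powr (s * p + real DIM('a))) \<partial>lborel) * indicator \<Omega> a
      = (\<integral>\<^sup>+b\<in>\<Omega>. ennreal (\<bar>f a - f b\<bar> powr p / norm (a - b) powr (s * p + real DIM('a))) \<partial>lborel) * indicator \<Omega> a"
        using ae
      proof eventually_elim
        fix a assume a: "a \<in> \<Omega> \<longrightarrow> f a = g a"
        show "(\<integral>\<^sup>+b\<in>\<Omega>. ennreal (\<bar>g a - g b\<bar> powr p) * ennreal (1 / norm (a - b) powr (s * p + real DIM('a))) \<partial>lborel) * indicator \<Omega> a
      = (\<integral>\<^sup>+b\<in>\<Omega>. ennreal (\<bar>f a - f b\<bar> powr p / norm (a - b) powr (s * p + real DIM('a))) \<partial>lborel) * indicator \<Omega> a"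
        proof (cases "a \<in> \<Omega>")
          case True
          have "(\<integral>\<^sup>+b\<in>\<Omega>. ennreal (\<bar>g a - g b\<bar> powr p) * ennreal (1 / norm (a - b) powr (s * p + real DIM('a))) \<partial>lborel)
            = (\<integral>\<^sup>+b\<in>\<Omega>. ennreal (\<bar>f a - f b\<bar> powr p / norm (a - b) powr (s * p + real DIM('a))) \<partial>lborel)"
          proof (rule nn_integral_cong_AE)
            show "AE b in lborel. ennreal (\<bar>g a - g b\<bar> powr p) * ennreal (1 / norm (a - b) powr (s * p + real DIM('a))) * indicator \<Omega> b
              = ennreal (\<bar>f a - f b\<bar> powr p / norm (a - b) powr (s * p + real DIM('a))) * indicator \<Omega> b"
              using ae by eventually_elim (use a True in \<open>auto simp: indicator_def ennreal_mult'[symmetric]\<close>)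
          qed
          then show ?thesis by simp
        qed simp
      qed
    qed
    also have "\<dots> < \<infinity>" using fe by (simp add: lr)
    finally show "(\<integral>\<^sup>+a\<in>\<Omega>. (\<integral>\<^sup>+b\<in>\<Omega>. ennreal (\<bar>g a - g b\<bar> powr p) * ennreal (1 / norm (a - b) powr (s * p + real DIM('a))) \<partial>lborel) \<partial>lborel) < \<infinity>" .
  qed
qed

text \<open>Level sets are defined through averages, so they are exactly the same for the
  representative. Equality up to a Lebesgue null set would be too weak, since such a set may have
  positive \<open>(n - s)\<close>-measure.\<close>

lemma ball_average_eq_avg:
  fixes f g :: "'a::euclidean_space \<Rightarrow> real"
  assumes [measurable]: "g \<in> borel_measurable borel" and ae: "AE x in lborel. x \<in> \<Omega> \<longrightarrow> f x = g x"
    and sub: "ball x r \<subseteq> \<Omega>" and fm: "f \<in> borel_measurable (lebesgue_on \<Omega>)" and "open \<Omega>"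
  shows "ball_average f x r = avg g (ball x r)"
proof -
  have ae': "AE z in lebesgue. indicator (ball x r) z *\<^sub>R f z = indicator (ball x r) z *\<^sub>R g z"
  proof (rule AE_completion)
    show "AE z in lborel. indicator (ball x r) z *\<^sub>R f z = indicator (ball x r) z *\<^sub>R g z"
      using ae by eventually_elim (use sub in \<open>auto simp: indicator_def\<close>)
  qed
  have gm: "(\<lambda>z. indicator (ball x r) z *\<^sub>R g z) \<in> borel_measurable lborel" by measurable
  have "f \<in> borel_measurable (lebesgue_on (ball x r))"
    by (rule measurable_restrict_mono[OF fm sub])
  then have "(\<lambda>z. indicator (ball x r) z *\<^sub>R f z) \<in> borel_measurable lebesgue"
    by (subst (asm) borel_measurable_restrict_space_iff) auto
  then have "(LINT z:ball x r|lebesgue. f z) = (LINT z:ball x r|lebesgue. g z)"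
    unfolding set_lebesgue_integral_def
    using measurable_completion[OF gm] ae' by (intro integral_cong_AE)
  also have "\<dots> = (LINT z:ball x r|lborel. g z)"
    unfolding set_lebesgue_integral_def by (rule integral_completion[OF gm])
  finally show ?thesis by (simp add: ball_average_def avg_def)
qed

theorem theorem1p3:
  fixes s p :: real and \<Omega> :: "'a::euclidean_space set" and f :: "'a \<Rightarrow> real"
  assumes "0 < s" and "s < 1" and "1 \<le> p"
    and "open \<Omega>" and "f \<in> fractional_sobolev s p \<Omega>"
  shows "AE y in lebesgue. hausdorff_measure (real DIM('a) - s) (level_set \<Omega> f y) = 0"
proof -
  let ?n = "real DIM('a)"
  obtain g where gm [measurable]: "g \<in> borel_measurable borel" and ae: "AE x in lborel. x \<in> \<Omega> \<longrightarrow> f x = g x"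
    and gp: "(\<integral>\<^sup>+x\<in>\<Omega>. ennreal (\<bar>g x\<bar> powr p) \<partial>lborel) < \<infinity>"
    and ge: "(\<integral>\<^sup>+a\<in>\<Omega>. (\<integral>\<^sup>+b\<in>\<Omega>. ennreal (\<bar>g a - g b\<bar> powr p) * ennreal (1 / norm (a - b) powr (s * p + ?n)) \<partial>lborel) \<partial>lborel) < \<infinity>"
    by (rule fractional_sobolev_borel_representative[OF assms(4,5)])
  have fm: "f \<in> borel_measurable (lebesgue_on \<Omega>)"
    using assms(5) by (simp add: fractional_sobolev_def Lp_on_def)
  \<comment> \<open>Countably many cubes whose neighbourhoods stay in \<Omega>. On each of them
    volume and local energy are finite and \<open>g\<close> is integrable near every point; null
    sets of levels and sets of zero Hausdorff measure survive countable unions.\<close>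
  define \<C> where "\<C> = {(k, Q). Q \<in> range (dcube k) \<and> (\<forall>a\<in>Q. nbhd k a \<subseteq> \<Omega>)}"
  have cC: "countable \<C>"
    by (rule countable_subset[of _ "SIGMA k:UNIV. range (dcube k)"])
       (auto simp: \<C>_def intro: countable_SIGMA countable_dcubes)
  have cover: "\<exists>(k, Q)\<in>\<C>. x \<in> Q" if x: "x \<in> \<Omega>" for x
  proof -
    obtain e where e: "0 < e" "ball x e \<subseteq> \<Omega>" using \<open>open \<Omega>\<close> x by (auto simp: open_contains_ball)
    \<comment> \<open>Here \<open>2 n + 1 = n + (n + 1)\<close>: the distance from \<open>x\<close>
      to \<open>a\<close> within a cube plus the radius of the neighbourhood of
      \<open>a\<close>.\<close>
    have "(\<lambda>k. (2 * ?n + 1) * (1/2::real)^k) \<longlonglongrightarrow> (2 * ?n + 1) * 0"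
      by (intro tendsto_mult tendsto_const LIMSEQ_realpow_zero) auto
    then have "\<forall>\<^sub>F k in sequentially. (2 * ?n + 1) * (1/2::real)^k < e"
      by (rule order_tendstoD) (use e in auto)
    then obtain k where k: "(2 * ?n + 1) * (1/2::real)^k < e"
      using eventually_happens' sequentially_bot by blast
    have "nbhd k a \<subseteq> \<Omega>" if a: "a \<in> dcube k x" for a
    proof
      fix z assume z: "z \<in> nbhd k a"
      have "dist x z \<le> dist a x + dist a z" by (metis dist_commute dist_triangle)
      also have "\<dots> < ?n * (1/2)^k + (?n + 1) * (1/2)^k"
        using dcube_dist[OF a] z by (auto simp: mem_ball)
      also have "\<dots> = (2 * ?n + 1) * (1/2)^k" by (simp add: algebra_simps)
      finally show "z \<in> \<Omega>" using k e(2) by auto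
    qed
    then have "(k, dcube k x) \<in> \<C>" by (auto simp: \<C>_def)
    then show ?thesis using dcube_self by blast
  qed
  have "AE y in lborel. hausdorff_measure (?n - s) (avg_level_set Q g y) = 0" if kQ: "(k, Q) \<in> \<C>" for k Q
  proof -
    obtain x where Q: "Q = dcube k x" "\<And>a. a \<in> Q \<Longrightarrow> nbhd k a \<subseteq> \<Omega>" using kQ by (auto simp: \<C>_def)
    show ?thesis
    proof (rule AE_hausdorff_measure_avg_level_set[OF gm assms(1-3)])
      show "saturated k Q" unfolding Q by (rule saturated_dcube)
      show "Q \<in> sets borel" unfolding Q by measurable
      show "emeasure lborel Q < \<infinity>" unfolding Q by (simp add: emeasure_dcube)
      show "set_integrable lborel (nbhd k a) g" if a: "a \<in> Q" for a
        unfolding set_integrable_def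
      proof (rule integrableI_bounded)
        have "(\<integral>\<^sup>+z. ennreal (norm (indicator (nbhd k a) z *\<^sub>R g z)) \<partial>lborel) \<le>
          (\<integral>\<^sup>+z. indicator (nbhd k a) z + ennreal (\<bar>g z\<bar> powr p) * indicator \<Omega> z \<partial>lborel)"
        proof (intro nn_integral_mono)
          fix z
          \<comment> \<open>Local integrability from \<open>L^p\<close>: the splitting at
            \<open>\<kappa> = 1\<close>, on a neighbourhood of finite volume.\<close>
          have "\<bar>g z\<bar> \<le> 1 + \<bar>g z\<bar> powr p" using le_plus_powr[of "\<bar>g z\<bar>" 1 p] \<open>1 \<le> p\<close> by simp
          then have "ennreal \<bar>g z\<bar> \<le> 1 + ennreal (\<bar>g z\<bar> powr p)"
            by (metis ennreal_1 ennreal_leI ennreal_plus powr_ge_zero zero_le_one)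
          then show "ennreal (norm (indicator (nbhd k a) z *\<^sub>R g z)) \<le> indicator (nbhd k a) z + ennreal (\<bar>g z\<bar> powr p) * indicator \<Omega> z"
            using Q(2)[OF a] by (cases "z \<in> nbhd k a") auto
        qed
        also have "\<dots> = emeasure lborel (nbhd k a) + (\<integral>\<^sup>+z\<in>\<Omega>. ennreal (\<bar>g z\<bar> powr p) \<partial>lborel)"
          using \<open>open \<Omega>\<close> by (subst nn_integral_add) auto
        also have "\<dots> < \<infinity>" using gp by (simp add: emeasure_nbhd)
        finally show "(\<integral>\<^sup>+z. ennreal (norm (indicator (nbhd k a) z *\<^sub>R g z)) \<partial>lborel) < \<infinity>" .
      qed measurable
      have "local_energy s p Q g k \<le> (\<integral>\<^sup>+a\<in>\<Omega>. (\<integral>\<^sup>+b\<in>\<Omega>. ennreal (\<bar>g a - g b\<bar> powr p) * ennreal (1 / norm (a - b) powr (s * p + ?n)) \<partial>lborel) \<partial>lborel)"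
        unfolding local_energy_def
      proof (intro nn_integral_mono)
        fix a
        show "(\<integral>\<^sup>+b\<in>nbhd k a. ennreal (\<bar>g a - g b\<bar> powr p) * ennreal (1 / norm (a - b) powr (s * p + ?n)) \<partial>lborel) * indicator Q a
          \<le> (\<integral>\<^sup>+b\<in>\<Omega>. ennreal (\<bar>g a - g b\<bar> powr p) * ennreal (1 / norm (a - b) powr (s * p + ?n)) \<partial>lborel) * indicator \<Omega> a"
        proof (cases "a \<in> Q")
          case True
          then have sub: "nbhd k a \<subseteq> \<Omega>" by (rule Q(2))
          then have "a \<in> \<Omega>" by auto
          moreover have "(\<integral>\<^sup>+b\<in>nbhd k a. ennreal (\<bar>g a - g b\<bar> powr p) * ennreal (1 / norm (a - b) powr (s * p + ?n)) \<partial>lborel)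
            \<le> (\<integral>\<^sup>+b\<in>\<Omega>. ennreal (\<bar>g a - g b\<bar> powr p) * ennreal (1 / norm (a - b) powr (s * p + ?n)) \<partial>lborel)"
            using sub by (intro nn_integral_mono) (auto simp: indicator_def)
          ultimately show ?thesis using True by simp
        qed simp
      qed
      also note ge
      finally show "local_energy s p Q g k < \<infinity>" .
    qed
  qed
  then have "AE y in lborel. \<forall>(k, Q)\<in>\<C>. hausdorff_measure (?n - s) (avg_level_set Q g y) = 0"
    by (subst AE_ball_countable[OF cC]) auto
  then have "AE y in lborel. hausdorff_measure (?n - s) (level_set \<Omega> f y) = 0"
  proof eventually_elim
    fix y assume y: "\<forall>(k, Q)\<in>\<C>. hausdorff_measure (?n - s) (avg_level_set Q g y) = 0"
    have sub: "level_set \<Omega> f y \<subseteq> (\<Union>(k, Q)\<in>\<C>. avg_level_set Q g y)"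
    proof
      fix x assume x: "x \<in> level_set \<Omega> f y"
      then have "x \<in> \<Omega>" by (simp add: level_set_def)
      then obtain k Q where kQ: "(k, Q) \<in> \<C>" "x \<in> Q" using cover by blast
      then have nb: "nbhd k x \<subseteq> \<Omega>" by (auto simp: \<C>_def)
      have "\<forall>\<^sub>F r in at_right 0. r \<in> {0<..<(?n + 1) * (1/2)^k}"
        by (rule eventually_at_right_real) (simp add: add_pos_pos)
      \<comment> \<open>Radii below that of \<open>nbhd k x\<close> involve only balls inside
        \<Omega>, and upper and lower limits at \<open>0\<close> see only such radii.\<close>
      then have ev: "\<forall>\<^sub>F r in at_right 0. ereal (ball_average f x r) = ereal (avg g (ball x r))"
      proof eventually_elim
        fix r assume "r \<in> {0<..<(?n + 1) * (1/2)^k}"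
        then have "ball x r \<subseteq> \<Omega>" using nb subset_ball[of r "(?n + 1) * (1/2)^k" x] by auto
        then show "ereal (ball_average f x r) = ereal (avg g (ball x r))"
          using ball_average_eq_avg[OF gm ae _ fm \<open>open \<Omega>\<close>] by simp
      qed
      have "x \<in> avg_level_set Q g y"
        using x kQ(2) Limsup_eq[OF ev] Liminf_eq[OF ev] by (simp add: level_set_def avg_level_set_def)
      with kQ show "x \<in> (\<Union>(k, Q)\<in>\<C>. avg_level_set Q g y)" by blast
    qed
    show "hausdorff_measure (?n - s) (level_set \<Omega> f y) = 0"
    proof (cases "\<C> = {}")
      case True
      with sub have "level_set \<Omega> f y = {}" by auto
      moreover have "hausdorff_measure (?n - s) (\<Union>j::nat. {} :: 'a set) = 0"
        by (rule hausdorff_measure_UN_eq_0)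
           (auto simp: hausdorff_measure_eq_0_iff hausdorff_weight_def
             intro!: antisym[OF order_trans[OF hausdorff_premeasure_le[where U = "\<lambda>_::nat. {}"]]])
      ultimately show ?thesis by simp
    next
      case False
      have "hausdorff_measure (?n - s) (\<Union>j. avg_level_set (snd (from_nat_into \<C> j)) g y) = 0"
      proof (rule hausdorff_measure_UN_eq_0)
        fix j
        show "hausdorff_measure (?n - s) (avg_level_set (snd (from_nat_into \<C> j)) g y) = 0"
          using y from_nat_into[OF False, of j] by auto
      qed
      moreover have "(\<Union>(k, Q)\<in>\<C>. avg_level_set Q g y) = (\<Union>j. avg_level_set (snd (from_nat_into \<C> j)) g y)"
      proof -
        have "(\<Union>(k, Q)\<in>\<C>. avg_level_set Q g y) = (\<Union>z\<in>range (from_nat_into \<C>). avg_level_set (snd z) g y)"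
          using range_from_nat_into[OF False cC] by (auto simp: case_prod_beta)
        then show ?thesis by simp
      qed
      ultimately show ?thesis using sub hausdorff_measure_null_mono by metis
    qed
  qed
  then show ?thesis by (rule AE_completion)
qed

end
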